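(* Let $S$ be a topological surface of finite type and negative Euler characteristic, let $\rho$ be a complete hyperbolic metric on $S$, and suppose $(S,\rho)$ is a hyperbolic surface with a puncture. For any $\epsilon>0$ there is $L_0=L_0(\rho,\epsilon)$ such that, for every $L\ge L_0$, $$f_\rho(L) \ge e^{\frac{L}{2+\epsilon}}.$$
   Context: Closed curves: $\mathcal{C}(S)$ denotes the set of closed curves on $S$, i.e. the set of free homotopy classes of images of immersions $S^1\to S$. For $\gamma\in\mathcal{C}(S)$, $\ell_\rho(\gamma)$ denotes the length of the $\rho$-geodesic representative of $\gamma$ on $S$ (so statements about $\ell_\rho(\gamma)$ concern curves that have a geodesic representative; curves winding around a puncture are not considered), and $\iota(\gamma,\gamma)$ denotes the geometric self-intersection number of $\gamma$ (the minimum number of self-intersections over transverse representatives). The curve $\gamma$ is simple when $\iota(\gamma,\gamma)=0$. Degree: a closed curve $\gamma$ lifts simply to a finite-sheeted (connected) cover $\pi:S'\to S$ if there is a simple closed curve $\gamma'$ on $S'$ that is a lift of $\gamma$, i.e. $\gamma$ (a suitable representative, as a map of $S^1$) lifts to a closed curve on $S'$ whose free homotopy class is simple. By a theorem of Scott every closed curve lifts simply to some finite-sheeted cover. Let $\deg(\gamma)$ denote the minimum degree of a cover of $S$ to which $\gamma$ lifts simply. The function: $f_\rho(L)$ is the minimum integer $d$ such that every $\gamma\in\mathcal{C}(S)$ with $\ell_\rho(\gamma)\le L$ has $\deg(\gamma)\le d$. Punctures: $(S,\rho)$ has a puncture if the closed curve homotopic to some boundary component (end) of $S$ has no geodesic representative,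 i.e. the corresponding holonomy is parabolic. *)

theory Defs
  imports "HOL-Analysis.Analysis" "HOL-Homology.Homology"
begin

section \<open>Surfaces of finite type and their Euler characteristic\<close>

definition surface :: "'a topology \<Rightarrow> bool" where
  "surface X \<longleftrightarrow> Hausdorff_space X \<and> second_countable X \<and> connected_space X \<and>
     (\<forall>x\<in>topspace X. \<exists>U V. openin X U \<and> x \<in> U \<and> open (V :: complex set) \<and>
        subtopology X U homeomorphic_space top_of_set V)"

text \<open>
  The ambient closed surface is sought on the type \<open>'a + nat\<close>; since only finitely many
  points are added to \<open>S\<close>, this is no restriction.
\<close>

definition finite_type :: "'a topology \<Rightarrow> bool" where
  "finite_type S \<longleftrightarrow> surface S \<and>
     (\<exists>(X :: ('a + nat) topology) F.
        surface X \<and> compact_space X \<and> finite F \<and> F \<subseteq> topspace X \<and>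
        S homeomorphic_space subtopology X (topspace X - F))"

text \<open>
  The rank of an abelian group: the largest \<open>n\<close> such that \<open>\<int>\<^sup>n\<close> embeds in it. The supremum is
  only meaningful for groups of finite rank, such as the homology of surfaces of finite type.
\<close>

definition abelian_rank :: "('g, 'm) monoid_scheme \<Rightarrow> nat" where
  "abelian_rank G = Sup {n. mon (free_Abelian_group {..<n}) G \<noteq> {}}"

text \<open>The homology of a surface vanishes above dimension 2.\<close>

definition euler_char :: "'a topology \<Rightarrow> int" where
  "euler_char S = (\<Sum>k\<le>2. (- 1) ^ k * int (abelian_rank (homology_group (int k) S)))"


section \<open>Complete hyperbolic metrics\<close>

text \<open>The distance of the hyperbolic plane (curvature \<open>-1\<close>) in the upper half-plane model.\<close>

definition hyp_dist :: "complex \<Rightarrow> complex \<Rightarrow> real" where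
  "hyp_dist z w = arcosh (1 + (cmod (z - w))\<^sup>2 / (2 * Im z * Im w))"

definition hyp_ball :: "complex \<Rightarrow> real \<Rightarrow> complex set" where
  "hyp_ball z r = {w. 0 < Im w \<and> hyp_dist z w < r}"

definition metric_length :: "('a \<Rightarrow> 'a \<Rightarrow> real) \<Rightarrow> (real \<Rightarrow> 'a) \<Rightarrow> ereal" where
  "metric_length \<rho> c =
     (SUP ts \<in> {ts. sorted ts \<and> set ts \<subseteq> {0..1}}.
        ereal (\<Sum>i<length ts - 1. \<rho> (c (ts ! i)) (c (ts ! Suc i))))"

text \<open>
  A Riemannian metric of curvature \<open>-1\<close> is represented by its distance function: a distance
  inducing the given topology that is the infimum of the lengths of paths and that is locally
  isometric to the hyperbolic plane.
\<close>

definition complete_hyperbolic_metric :: "'a topology \<Rightarrow> ('a \<Rightarrow> 'a \<Rightarrow> real) \<Rightarrow> bool" where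
  "complete_hyperbolic_metric S \<rho> \<longleftrightarrow>
     Metric_space (topspace S) \<rho> \<and>
     Metric_space.mtopology (topspace S) \<rho> = S \<and>
     Metric_space.mcomplete (topspace S) \<rho> \<and>
     (\<forall>x\<in>topspace S. \<forall>y\<in>topspace S. \<forall>e>0.
        \<exists>c. pathin S c \<and> c 0 = x \<and> c 1 = y \<and> metric_length \<rho> c \<le> ereal (\<rho> x y + e)) \<and>
     (\<forall>x\<in>topspace S. \<exists>r>0. \<exists>\<phi>.
        0 < Im (\<phi> x) \<and>
        \<phi> ` Metric_space.mball (topspace S) \<rho> x r = hyp_ball (\<phi> x) r \<and>
        (\<forall>y \<in> Metric_space.mball (topspace S) \<rho> x r.
         \<forall>z \<in> Metric_space.mball (topspace S) \<rho> x r. hyp_dist (\<phi> y) (\<phi> z) = \<rho> y z))"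


section \<open>Closed curves\<close>

text \<open>
  A free homotopy class of closed curves is given by any of its representatives
  \<open>c\<close>, a continuous map on the circle; every such class contains immersions. The notions
  below that depend on \<open>c\<close> are invariant under free homotopy.
\<close>

abbreviation circle :: "complex topology" where
  "circle \<equiv> top_of_set (sphere 0 1)"

definition closed_curve :: "'a topology \<Rightarrow> (complex \<Rightarrow> 'a) \<Rightarrow> bool" where
  "closed_curve X c \<longleftrightarrow> continuous_map circle X c"

definition freely_homotopic :: "'a topology \<Rightarrow> (complex \<Rightarrow> 'a) \<Rightarrow> (complex \<Rightarrow> 'a) \<Rightarrow> bool" where
  "freely_homotopic X c c' \<longleftrightarrow> homotopic_with (\<lambda>_. True) circle X c c'"

definition double_points :: "(complex \<Rightarrow> 'a) \<Rightarrow> complex set set" where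
  "double_points c = {{s, t} | s t. s \<in> sphere 0 1 \<and> t \<in> sphere 0 1 \<and> s \<noteq> t \<and> c s = c t}"

text \<open>
  Only the vanishing of this number is used below. A representative without double points
  is vacuously transverse, so transversality needs no separate condition.
\<close>

definition self_intersection_number :: "'a topology \<Rightarrow> (complex \<Rightarrow> 'a) \<Rightarrow> enat" where
  "self_intersection_number X c =
     (INF c' \<in> {c'. freely_homotopic X c c' \<and> finite (double_points c')}.
        enat (card (double_points c')))"

definition simple_curve :: "'a topology \<Rightarrow> (complex \<Rightarrow> 'a) \<Rightarrow> bool" where
  "simple_curve X c \<longleftrightarrow> closed_curve X c \<and> self_intersection_number X c = 0"

text \<open>
  A closed geodesic of length \<open>l\<close>, parametrized at constant speed by the angle. Constant curves
  are the closed geodesics of length 0, so on a complete hyperbolic surface the curves with no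
  geodesic representative are exactly those with parabolic holonomy.
\<close>

definition closed_geodesic ::
  "'a topology \<Rightarrow> ('a \<Rightarrow> 'a \<Rightarrow> real) \<Rightarrow> real \<Rightarrow> (complex \<Rightarrow> 'a) \<Rightarrow> bool" where
  "closed_geodesic S \<rho> l c \<longleftrightarrow> closed_curve S c \<and> 0 \<le> l \<and>
     (\<forall>t. \<exists>\<delta>>0. \<forall>u v. \<bar>u - t\<bar> < \<delta> \<and> \<bar>v - t\<bar> < \<delta> \<longrightarrow>
        \<rho> (c (cis u)) (c (cis v)) = l / (2 * pi) * \<bar>u - v\<bar>)"

text \<open>
  The geodesic representative of \<open>c\<close> exists and has length \<open>l\<close>. At most one \<open>l\<close> qualifies.
\<close>

definition has_geodesic_length ::
  "'a topology \<Rightarrow> ('a \<Rightarrow> 'a \<Rightarrow> real) \<Rightarrow> (complex \<Rightarrow> 'a) \<Rightarrow> real \<Rightarrow> bool" where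
  "has_geodesic_length S \<rho> c l \<longleftrightarrow> (\<exists>g. closed_geodesic S \<rho> l g \<and> freely_homotopic S c g)"

text \<open>
  A curve homotopic to an end of \<open>S\<close>: the core of an embedded open annulus, parametrized by the
  punctured disc. The closedness condition says that the annulus leaves every compact set
  of \<open>S\<close> towards the centre of the disc.
\<close>

definition end_curve :: "'a topology \<Rightarrow> (complex \<Rightarrow> 'a) \<Rightarrow> bool" where
  "end_curve S c \<longleftrightarrow>
     (\<exists>\<psi>. embedding_map (top_of_set {z :: complex. 0 < cmod z \<and> cmod z < 1}) S \<psi> \<and>
          openin S (\<psi> ` {z. 0 < cmod z \<and> cmod z < 1}) \<and>
          closedin S (\<psi> ` {z. 0 < cmod z \<and> cmod z \<le> 1 / 2}) \<and>
          freely_homotopic S c (\<lambda>z. \<psi> (z / 2)))"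

definition has_puncture :: "'a topology \<Rightarrow> ('a \<Rightarrow> 'a \<Rightarrow> real) \<Rightarrow> bool" where
  "has_puncture S \<rho> \<longleftrightarrow> (\<exists>c. end_curve S c \<and> (\<nexists>l. has_geodesic_length S \<rho> c l))"


section \<open>Finite covers and the degree of a curve\<close>

definition covering_map :: "'b topology \<Rightarrow> 'a topology \<Rightarrow> ('b \<Rightarrow> 'a) \<Rightarrow> bool" where
  "covering_map X' X p \<longleftrightarrow>
     continuous_map X' X p \<and> p ` topspace X' = topspace X \<and>
     (\<forall>x\<in>topspace X. \<exists>U. openin X U \<and> x \<in> U \<and>
        (\<exists>\<V>. \<Union>\<V> = {x' \<in> topspace X'. p x' \<in> U} \<and> pairwise disjnt \<V> \<and>
             (\<forall>V\<in>\<V>. openin X' V \<and>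
                homeomorphic_map (subtopology X' V) (subtopology X U) p)))"

definition finite_cover :: "'b topology \<Rightarrow> 'a topology \<Rightarrow> ('b \<Rightarrow> 'a) \<Rightarrow> nat \<Rightarrow> bool" where
  "finite_cover X' X p d \<longleftrightarrow>
     connected_space X' \<and> covering_map X' X p \<and> 0 < d \<and>
     (\<forall>x\<in>topspace X. card {x' \<in> topspace X'. p x' = x} = d)"

definition lifts_simply :: "'b topology \<Rightarrow> 'a topology \<Rightarrow> ('b \<Rightarrow> 'a) \<Rightarrow> (complex \<Rightarrow> 'a) \<Rightarrow> bool" where
  "lifts_simply X' X p c \<longleftrightarrow>
     (\<exists>c'. simple_curve X' c' \<and> freely_homotopic X c (p \<circ> c'))"

text \<open>
  Covers are taken on the type \<open>'a \<times> nat\<close> with an arbitrary topology; every cover of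
  finite degree \<open>d\<close> is isomorphic to one whose set of points is \<open>topspace S \<times> {..<d}\<close>.
  The minimum would be \<open>\<infinity>\<close> for a curve lifting simply to no finite cover; by a theorem of
  Scott there is none.
\<close>

definition curve_degree :: "'a topology \<Rightarrow> (complex \<Rightarrow> 'a) \<Rightarrow> enat" where
  "curve_degree S c =
     (INF d \<in> {d. \<exists>(S' :: ('a \<times> nat) topology) p. finite_cover S' S p d \<and> lifts_simply S' S p c}.
        enat d)"

definition max_degree :: "'a topology \<Rightarrow> ('a \<Rightarrow> 'a \<Rightarrow> real) \<Rightarrow> real \<Rightarrow> enat" where
  "max_degree S \<rho> L =
     (INF d \<in> {d :: nat. \<forall>c l. closed_curve S c \<and> has_geodesic_length S \<rho> c l \<and> l \<le> L \<longrightarrow>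
                              curve_degree S c \<le> enat d}.
        enat d)"

end

theory Submission
  imports Defs "HOL-Real_Asymp.Real_Asymp"
begin

text \<open>
  The cusp makes winding cheap: a closed geodesic can wind \<open>n\<close> times around the puncture at the
  cost of only \<open>2 ln n + O(1)\<close> in length, whereas a cover to which it lifts simply must have degree
  larger than \<open>n\<close>.

  Take the upper half-plane as the universal cover and put the cusp at infinity, so that
  \<open>z \<mapsto> z + 1\<close> is a deck transformation. If every deck transformation fixed infinity, the surface
  would be homotopy equivalent to a circle and its Euler characteristic would not be negative. So
  some deck transformation moves infinity; conjugating the translation by it gives a second parabolic
  deck transformation, which after a horizontal translation of coordinates is
  \<open>z \<mapsto> z / (c z + 1)\<close> with \<open>c > 0\<close> (\<open>second_parabolic\<close>). The product
  \<open>z \<mapsto> z / (c z + 1) + n\<close> has trace \<open>2 + n c\<close>, hence translation length at most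
  \<open>2 ln (2 + n c)\<close>, and the two real end points \<open>r1 < r2\<close> of its axis satisfy \<open>r2 - r1 > n\<close>. Let
  \<open>\<gamma>\<close> be the closed geodesic covered by this axis (\<open>long_cusp_excursion\<close>).

  Suppose that \<open>\<gamma>\<close> lifts simply to a cover of degree \<open>d \<le> n\<close>, and lift the half-plane to this cover.
  The \<open>d + 1\<close> points \<open>\<i>, \<i> + 1, \<dots>, \<i> + d\<close> lie over a single point of the surface, so two of
  them have the same image in the cover, and a translation by some \<open>m\<close> with \<open>1 \<le> m \<le> d\<close> is a deck
  transformation over the cover. A simple representative of the lifted curve lifts further to a
  curve in the half-plane that runs from \<open>r1\<close> to \<open>r2\<close>, because a homotopy of \<open>\<gamma>\<close> moves the axis
  by an equivariant homotopy. Its translate by \<open>m\<close> runs from \<open>r1 + m\<close> to \<open>r2 + m\<close>. As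
  \<open>r1 < r1 + m < r2 < r2 + m\<close>, the two curves cross, and a crossing is a double point of the simple
  representative (\<open>degree_lower_bound\<close>). Hence \<open>d > n\<close>, and the choice
  \<open>n = \<lceil>exp (L / (2 + \<epsilon>))\<rceil>\<close> gives the theorem for large \<open>L\<close>.

  The metric enters through the developing map. A local isometry from the half-plane to a complete
  hyperbolic surface continues along every segment, so by a monodromy argument (\<open>monodromy\<close>) there
  is a map of the whole half-plane that is everywhere a local isometry; it is a covering
  (\<open>developing_covering\<close>), and points with the same image differ by a deck transformation that is an
  isometry (\<open>developing_deck\<close>). The same monodromy argument gives the lifts of maps and homotopies
  through arbitrary coverings. A closed curve without geodesic representative must have parabolic
  holonomy: any other isometry is the identity, has a fixed point, or translates along an axis, and
  in these cases a straight-line homotopy moves the curve to a point or to a closed geodesic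
  (\<open>developing_parabolic\<close>). This is where the puncture produces the deck transformation
  \<open>z \<mapsto> z + 1\<close>.
\<close>

section \<open>Continuation along segments\<close>

lemma convex_open_between:
  fixes K :: "'c::real_normed_vector set"
  assumes "compact K" "convex K" "open U" "K \<subseteq> U"
  shows "\<exists>N. open N \<and> convex N \<and> K \<subseteq> N \<and> N \<subseteq> U"
proof -
  obtain d where d: "d > 0" "(\<Union>x\<in>K. ball x d) \<subseteq> U"
    using compact_subset_open_imp_ball_epsilon_subset assms by metis
  have eq: "(\<Union>x\<in>K. ball x d) = (\<Union>x\<in>K. \<Union>y\<in>ball 0 d. {x + y})"
  proof (rule SUP_cong[OF refl])
    fix x :: 'c show "ball x d = (\<Union>y\<in>ball 0 d. {x + y})"
    proof safe
      fix u assume "u \<in> ball x d"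
      then have "u - x \<in> ball 0 d" by (simp add: dist_norm norm_minus_commute)
      then have "\<exists>y\<in>ball 0 d. u = x + y" by (intro bexI[of _ "u - x"]) simp_all
      then show "u \<in> (\<Union>y\<in>ball 0 d. {x + y})" by blast
    qed (simp add: dist_norm)
  qed
  have "convex (\<Union>x\<in>K. ball x d)" unfolding eq using assms by (intro convex_sums convex_ball)
  then show ?thesis using d by (intro exI[of _ "\<Union>x\<in>K. ball x d"]) auto
qed

text \<open>
  An abstract form of analytic continuation. A predicate \<open>good f x\<close> says that \<open>f\<close> is a section of
  the right kind near \<open>x\<close>. Two instances occur: lifts of a given map through a covering, and local
  isometries from the hyperbolic plane to a surface. The point of the last assumption is that a
  section on a half-open segment extends over its end point; the extension \<open>g\<close> has to agree with \<open>f\<close>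
  near one point only, because uniqueness spreads the agreement.
\<close>

locale continuation =
  fixes D :: "'c::real_normed_vector set"
    and good :: "('c \<Rightarrow> 'b) \<Rightarrow> 'c \<Rightarrow> bool"
  assumes open_D: "open D" and convex_D: "convex D"
    and good_nearby: "x \<in> D \<Longrightarrow> good f x \<Longrightarrow> eventually (good f) (nhds x)"
    and good_cong: "x \<in> D \<Longrightarrow> good f x \<Longrightarrow> eventually (\<lambda>y. f y = g y) (nhds x) \<Longrightarrow> good g x"
    and good_limit: "x \<in> D \<Longrightarrow> good f x \<Longrightarrow> good g x \<Longrightarrow>
      frequently (\<lambda>y. eventually (\<lambda>u. f u = g u) (nhds y)) (nhds x) \<Longrightarrow>
      eventually (\<lambda>y. f y = g y) (nhds x)"
    and good_extend: "x \<in> D \<Longrightarrow> w \<in> D \<Longrightarrow>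
      (\<And>t. 0 \<le> t \<Longrightarrow> t < 1 \<Longrightarrow> good f (x + t *\<^sub>R (w - x))) \<Longrightarrow>
      \<exists>g t. 0 \<le> t \<and> t < 1 \<and> eventually (\<lambda>u. f u = g u) (nhds (x + t *\<^sub>R (w - x))) \<and>
        (\<forall>s. t \<le> s \<and> s \<le> (1::real) \<longrightarrow> good g (x + s *\<^sub>R (w - x)))"
begin

text \<open>
  The set where two sections have the same germ is open by definition and closed by
  \<open>good_limit\<close>.
\<close>

lemma unique_on_connected:
  assumes C: "connected C" "C \<subseteq> D" and f: "\<And>x. x \<in> C \<Longrightarrow> good f x" and g: "\<And>x. x \<in> C \<Longrightarrow> good g x"
    and a: "a \<in> C" "eventually (\<lambda>y. f y = g y) (nhds a)" and x: "x \<in> C"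
  shows "f x = g x"
proof -
  let ?E = "\<lambda>y. eventually (\<lambda>u. f u = g u) (nhds y)"
  have op: "open {y. ?E y}"
    unfolding open_subopen[of "{y. ?E y}"]
  proof
    fix y assume "y \<in> {y. ?E y}"
    then obtain U where "open U" "y \<in> U" "\<forall>u\<in>U. f u = g u" unfolding eventually_nhds by auto
    then show "\<exists>T. open T \<and> y \<in> T \<and> T \<subseteq> {y. ?E y}"
      by (intro exI[of _ U]) (auto simp: eventually_nhds)
  qed
  have "\<exists>T. open T \<and> y \<in> T \<and> (\<forall>z\<in>T. \<not> ?E z)" if "y \<in> C" "\<not> ?E y" for y
  proof -
    have "\<not> frequently ?E (nhds y)"
      using good_limit[of y f g] that f g C by blast
    then show ?thesis by (simp add: not_frequently eventually_nhds)
  qed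
  then obtain T where T: "\<And>y. y \<in> C \<Longrightarrow> \<not> ?E y \<Longrightarrow> open (T y) \<and> y \<in> T y \<and> (\<forall>z\<in>T y. \<not> ?E z)"
    by metis
  let ?V = "\<Union>(T ` {y\<in>C. \<not> ?E y})"
  have "{y. ?E y} \<inter> C = {} \<or> ?V \<inter> C = {}"
  proof (rule connectedD[OF C(1) op])
    show "open ?V" using T by blast
    show "{y. ?E y} \<inter> ?V \<inter> C = {}" using T by blast
    show "C \<subseteq> {y. ?E y} \<union> ?V" using T by blast
  qed
  then have "?E x" using a x T by blast
  then show ?thesis by (rule eventually_nhds_x_imp_x)
qed

text \<open>
  Let \<open>\<Omega>\<close> be the set of points \<open>w\<close> for which the segment from \<open>x0\<close> to \<open>w\<close> has a convex
  neighbourhood with a section extending the germ of \<open>f0\<close>. Two such neighbourhoods intersect in a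
  convex set, so their sections agree there and fit together to one section on \<open>\<Omega>\<close>. The set \<open>\<Omega>\<close> is
  open, and the extension property shows that a segment from \<open>x0\<close> cannot leave it.
\<close>

lemma monodromy:
  assumes x0: "x0 \<in> D" and f0: "good f0 x0"
  shows "\<exists>f. (\<forall>x\<in>D. good f x) \<and> eventually (\<lambda>y. f y = f0 y) (nhds x0)"
proof -
  let ?sec = "\<lambda>w N f. open N \<and> convex N \<and> N \<subseteq> D \<and> closed_segment x0 w \<subseteq> N \<and> (\<forall>y\<in>N. good f y) \<and>
     eventually (\<lambda>y. f y = f0 y) (nhds x0)"
  define \<Omega> where "\<Omega> = {w. \<exists>N f. ?sec w N f}"
  have ex: "\<exists>f N. ?sec w N f" if "w \<in> \<Omega>" for w using that unfolding \<Omega>_def by blast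
  obtain sec N where sec: "\<And>w. w \<in> \<Omega> \<Longrightarrow> ?sec w (N w) (sec w)"
    using ex by metis
  define F where "F = (\<lambda>y. sec y y)"
  have mem: "x0 \<in> N w" "w \<in> N w" if "w \<in> \<Omega>" for w using sec[OF that] by auto
  have agree: "f y = g y" if "?sec w M f" "?sec w' M' g" "y \<in> M \<inter> M'" for f g M M' w w' y
  proof (rule unique_on_connected[of "M \<inter> M'" f g x0 y])
    show "connected (M \<inter> M')" using that by (intro convex_connected convex_Int) auto
    show "\<forall>\<^sub>F y in nhds x0. f y = g y"
      using that by (auto elim: eventually_elim2)
  qed (use that in auto)
  have sub: "N w \<subseteq> \<Omega>" if "w \<in> \<Omega>" for w
  proof
    fix y assume "y \<in> N w"
    then have "closed_segment x0 y \<subseteq> N w"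
      using sec[OF that] mem[OF that] by (meson closed_segment_subset)
    then show "y \<in> \<Omega>" using sec[OF that] unfolding \<Omega>_def by blast
  qed
  have Fsec: "F y = f y" if "?sec w M f" "y \<in> M" for w M f y
  proof -
    have "closed_segment x0 y \<subseteq> M"
      using that by (metis closed_segment_subset ends_in_segment(1) subsetD)
    then have "y \<in> \<Omega>" using that unfolding \<Omega>_def by blast
    then show ?thesis
      unfolding F_def using agree[OF sec that(1)] that(2) mem by blast
  qed
  have evF: "eventually (\<lambda>y. f y = F y) (nhds y)" if "?sec w M f" "y \<in> M" for w M f y
    unfolding eventually_nhds using Fsec[OF that(1)] that by (intro exI[of _ M]) auto
  have goodF: "good F w" if "w \<in> \<Omega>" for w
    using evF[OF sec[OF that] mem(2)[OF that]] sec[OF that] mem(2)[OF that] good_cong by blast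
  have open_\<Omega>: "open \<Omega>"
  proof (subst open_subopen, intro ballI)
    fix w assume w: "w \<in> \<Omega>"
    show "\<exists>T. open T \<and> w \<in> T \<and> T \<subseteq> \<Omega>"
      using sub[OF w] sec[OF w] mem[OF w] by (intro exI[of _ "N w"]) simp
  qed
  have x0\<Omega>: "x0 \<in> \<Omega>"
  proof -
    have "eventually (good f0) (nhds x0)" using good_nearby x0 f0 by blast
    then have "eventually (\<lambda>x. x \<in> D \<and> good f0 x) (nhds x0)"
      using open_D x0 by (simp add: eventually_conj eventually_nhds_in_open)
    then obtain e where e: "e > 0" "\<And>x. dist x x0 < e \<Longrightarrow> x \<in> D \<and> good f0 x"
      unfolding eventually_nhds_metric by blast
    have "?sec x0 (ball x0 e) f0" using e by (simp add: dist_commute subset_iff)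
    then show ?thesis unfolding \<Omega>_def by blast
  qed
  have step: "w \<in> \<Omega>" if w: "w \<in> D" and half: "\<And>t. 0 \<le> t \<Longrightarrow> t < 1 \<Longrightarrow> x0 + t *\<^sub>R (w - x0) \<in> \<Omega>" for w
  proof -
    let ?p = "\<lambda>t::real. x0 + t *\<^sub>R (w - x0)"
    obtain g t where g: "0 \<le> t" "t < 1" "eventually (\<lambda>u. F u = g u) (nhds (?p t))"
      "\<And>s. t \<le> s \<Longrightarrow> s \<le> 1 \<Longrightarrow> good g (?p s)"
      using good_extend[OF x0 w, of F] goodF half by blast
    let ?y = "?p t"
    have y: "?y \<in> \<Omega>" using half g by simp
    have segy: "u \<in> closed_segment ?y w \<longleftrightarrow> (\<exists>s. t \<le> s \<and> s \<le> 1 \<and> u = ?p s)" for u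
    proof
      assume "u \<in> closed_segment ?y w"
      then obtain r where r: "0 \<le> r" "r \<le> 1" "u = (1 - r) *\<^sub>R ?y + r *\<^sub>R w"
        unfolding closed_segment_def by blast
      let ?s = "t + r * (1 - t)"
      have "u = ?p ?s" unfolding r(3) by (simp add: algebra_simps)
      moreover have "t \<le> ?s" using r g by simp
      moreover have "?s \<le> 1" using mult_right_mono[of r 1 "1 - t"] r g by (smt (verit))
      ultimately show "\<exists>s. t \<le> s \<and> s \<le> 1 \<and> u = ?p s" by blast
    next
      assume "\<exists>s. t \<le> s \<and> s \<le> 1 \<and> u = ?p s"
      then obtain s where s: "t \<le> s" "s \<le> 1" "u = ?p s" by blast
      define r where "r = (s - t) / (1 - t)"
      have s': "s = t + r * (1 - t)" unfolding r_def using g by simp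
      have "0 \<le> r" "r \<le> 1" unfolding r_def using s g by (simp_all add: field_simps)
      moreover have "u = (1 - r) *\<^sub>R ?y + r *\<^sub>R w" unfolding s(3) s' by (simp add: algebra_simps)
      ultimately show "u \<in> closed_segment ?y w" unfolding closed_segment_def by blast
    qed
    have "open {x\<in>D. good g x}"
    proof (subst open_subopen, intro ballI)
      fix u assume u: "u \<in> {x\<in>D. good g x}"
      then have "eventually (\<lambda>x. x \<in> D \<and> good g x) (nhds u)"
        using open_D good_nearby[of u g] by (simp add: eventually_conj eventually_nhds_in_open)
      then show "\<exists>T. open T \<and> u \<in> T \<and> T \<subseteq> {x\<in>D. good g x}"
        unfolding eventually_nhds by blast
    qed
    moreover have "?y \<in> D" using sec[OF y] mem[OF y] by blast
    then have "closed_segment ?y w \<subseteq> D" using convex_D w by (simp add: closed_segment_subset)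
    then have "closed_segment ?y w \<subseteq> {x\<in>D. good g x}" using g(4) segy by auto
    ultimately obtain B where B: "open B" "convex B" "closed_segment ?y w \<subseteq> B" "B \<subseteq> {x\<in>D. good g x}"
      using convex_open_between[OF compact_segment convex_closed_segment] by (smt (verit))
    have yB: "?y \<in> B" using B(3) by auto
    let ?M = "N ?y" and ?f = "sec ?y"
    note secy = sec[OF y]
    have fg: "?f u = g u" if u: "u \<in> ?M \<inter> B" for u
    proof (rule unique_on_connected[of "?M \<inter> B" ?f g ?y])
      show "connected (?M \<inter> B)" using secy B by (intro convex_connected convex_Int) auto
      have "eventually (\<lambda>u. ?f u = F u) (nhds ?y)"
        using evF[OF secy] mem[OF y] by blast
      then show "\<forall>\<^sub>F u in nhds ?y. ?f u = g u" using g(3) by (auto elim: eventually_elim2)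
    qed (use secy mem[OF y] B yB u in \<open>simp_all add: subset_iff\<close>)
    define h where "h = (\<lambda>u. if u \<in> B then g u else ?f u)"
    have hf: "h u = ?f u" if "u \<in> ?M" for u using fg that by (auto simp: h_def)
    have seg: "closed_segment x0 w \<subseteq> ?M \<union> B"
    proof
      fix u assume "u \<in> closed_segment x0 w"
      then obtain s where s: "0 \<le> s" "s \<le> 1" "u = ?p s"
        unfolding closed_segment_def by (auto simp: algebra_simps)
      show "u \<in> ?M \<union> B"
      proof (cases "s \<le> t")
        case True
        then have "u \<in> closed_segment x0 ?y"
          unfolding closed_segment_def s(3) using s g
          by (cases "t = 0") (auto intro!: exI[of _ "s / t"] simp: algebra_simps)
        then show ?thesis using secy by blast
      next
        case False
        then show ?thesis using segy[of u] s B by fastforce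
      qed
    qed
    have goodh: "good h u" if "u \<in> ?M \<union> B" for u
    proof (cases "u \<in> ?M")
      case True
      have "eventually (\<lambda>u. ?f u = h u) (nhds u)"
        unfolding eventually_nhds using hf secy True by (intro exI[of _ ?M]) auto
      then show ?thesis using good_cong secy True by blast
    next
      case False
      then have u: "u \<in> B" using that by blast
      then have "eventually (\<lambda>u. g u = h u) (nhds u)"
        unfolding eventually_nhds using B by (intro exI[of _ B]) (auto simp: h_def)
      then show ?thesis using good_cong B u by blast
    qed
    obtain K where K: "open K" "convex K" "closed_segment x0 w \<subseteq> K" "K \<subseteq> ?M \<union> B"
      using convex_open_between[OF compact_segment convex_closed_segment _ seg] secy B
      by (metis open_Un)
    have "eventually (\<lambda>u. h u = ?f u) (nhds x0)"
      unfolding eventually_nhds using hf secy mem[OF y] by (intro exI[of _ ?M]) auto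
    then have "eventually (\<lambda>y. h y = f0 y) (nhds x0)" using secy by (auto elim: eventually_elim2)
    moreover have "K \<subseteq> D" using K(4) secy B by blast
    ultimately have "?sec w K h" using K goodh by blast
    then show ?thesis unfolding \<Omega>_def by blast
  qed
  have "D \<subseteq> \<Omega>"
  proof (rule ccontr)
    assume "\<not> D \<subseteq> \<Omega>"
    then obtain w where w: "w \<in> D" "w \<notin> \<Omega>" by blast
    let ?p = "\<lambda>t::real. x0 + t *\<^sub>R (w - x0)"
    define K where "K = {0..1} \<inter> ?p -` (- \<Omega>)"
    have "closed (?p -` (- \<Omega>))"
      using open_\<Omega> by (intro closed_vimage) (auto intro!: continuous_intros)
    then have "compact K" unfolding K_def by (intro compact_Int_closed) auto
    moreover have "1 \<in> K" using w by (simp add: K_def)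
    ultimately obtain t where t: "t \<in> K" "\<And>s. s \<in> K \<Longrightarrow> t \<le> s"
      using compact_attains_inf[of K] by blast
    have pt: "?p t \<in> D"
    proof -
      have "?p t = (1 - t) *\<^sub>R x0 + t *\<^sub>R w" by (simp add: algebra_simps)
      then show ?thesis using convex_D x0 w t unfolding K_def
        by (metis IntD1 atLeastAtMost_iff convex_alt)
    qed
    have "x0 + s *\<^sub>R (?p t - x0) \<in> \<Omega>" if "0 \<le> s" "s < 1" for s
    proof -
      have "t > 0" using t x0\<Omega> unfolding K_def by (cases "t = 0") auto
      then have "s * t < t" using that by simp
      then have "s * t \<notin> K" using t(2) by force
      then have "?p (s * t) \<in> \<Omega>" using that t(1) \<open>s * t < t\<close> unfolding K_def by auto
      then show ?thesis by (simp add: algebra_simps)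
    qed
    then have "?p t \<in> \<Omega>" using step[OF pt] by blast
    then show False using t(1) by (simp add: K_def)
  qed
  moreover have "eventually (\<lambda>y. F y = f0 y) (nhds x0)"
  proof -
    have "eventually (\<lambda>y. sec x0 y = F y) (nhds x0)" using evF[OF sec[OF x0\<Omega>]] mem x0\<Omega> by blast
    then show ?thesis using sec[OF x0\<Omega>] by (auto elim: eventually_elim2)
  qed
  ultimately show ?thesis using goodF by blast
qed

end

section \<open>Lifting through coverings\<close>

lemma open_preimage:
  assumes "open N" "continuous_map (top_of_set N) X f" "openin X V"
  shows "open {y\<in>N. f y \<in> V}"
  using openin_continuous_map_preimage[OF assms(2,3)] assms(1)
  by (simp add: openin_open_eq)

lemma continuous_map_local:
  assumes "\<And>x. x \<in> D \<Longrightarrow> \<exists>N. open N \<and> x \<in> N \<and> N \<subseteq> D \<and> continuous_map (top_of_set N) X f"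
  shows "continuous_map (top_of_set D) X f"
proof -
  have "f x \<in> topspace X" if x: "x \<in> D" for x
  proof -
    obtain N where "x \<in> N" "continuous_map (top_of_set N) X f" using assms[OF x] by blast
    then show ?thesis by (auto simp: continuous_map_def)
  qed
  moreover have "openin (top_of_set D) {x \<in> D. f x \<in> U}" if U: "openin X U" for U
  proof (subst openin_subopen, intro ballI)
    fix x assume x: "x \<in> {x \<in> D. f x \<in> U}"
    then obtain N where N: "open N" "x \<in> N" "N \<subseteq> D" "continuous_map (top_of_set N) X f"
      using assms[of x] by blast
    have "open {y\<in>N. f y \<in> U}" using open_preimage N U by blast
    then have "openin (top_of_set D) {y\<in>N. f y \<in> U}" using N by (simp add: open_subset subset_eq)
    then show "\<exists>T. openin (top_of_set D) T \<and> x \<in> T \<and> T \<subseteq> {x \<in> D. f x \<in> U}"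
      using N x by (intro exI[of _ "{y\<in>N. f y \<in> U}"]) auto
  qed
  ultimately show ?thesis unfolding continuous_map_def by auto
qed

text \<open>
  Evenly covered sets in a form suited to calculation: \<open>sh e\<close> is the sheet through \<open>e\<close>, and
  \<open>sec e\<close> is the inverse of the projection on that sheet.
\<close>

definition evenly_covered where
  "evenly_covered X' X p U sh sec \<longleftrightarrow> openin X U \<and>
     (\<forall>e\<in>topspace X'. p e \<in> U \<longrightarrow>
        openin X' (sh e) \<and> e \<in> sh e \<and> p ` sh e \<subseteq> U \<and>
        (\<forall>v\<in>sh e. sh v = sh e \<and> sec e (p v) = v) \<and>
        continuous_map (subtopology X U) X' (sec e) \<and>
        (\<forall>y\<in>U. sec e y \<in> sh e \<and> p (sec e y) = y))"

lemma evenly_coveredD: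
  assumes "evenly_covered X' X p U sh sec"
  shows "openin X U"
    and "e \<in> topspace X' \<Longrightarrow> p e \<in> U \<Longrightarrow> openin X' (sh e) \<and> e \<in> sh e \<and> p ` sh e \<subseteq> U"
    and "e \<in> topspace X' \<Longrightarrow> p e \<in> U \<Longrightarrow> v \<in> sh e \<Longrightarrow> sh v = sh e \<and> sec e (p v) = v"
    and "e \<in> topspace X' \<Longrightarrow> p e \<in> U \<Longrightarrow> continuous_map (subtopology X U) X' (sec e)"
    and "e \<in> topspace X' \<Longrightarrow> p e \<in> U \<Longrightarrow> y \<in> U \<Longrightarrow> sec e y \<in> sh e \<and> p (sec e y) = y"
  using assms unfolding evenly_covered_def by blast+

lemma covering_sheets:
  assumes cov: "covering_map X' X p" and x: "x \<in> topspace X"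
  shows "\<exists>U sh sec. evenly_covered X' X p U sh sec \<and> x \<in> U"
proof -
  obtain U \<V> where U: "openin X U" "x \<in> U" and V: "\<Union>\<V> = {x' \<in> topspace X'. p x' \<in> U}" "pairwise disjnt \<V>"
    "\<And>V. V \<in> \<V> \<Longrightarrow> openin X' V \<and> homeomorphic_map (subtopology X' V) (subtopology X U) p"
    using cov x unfolding covering_map_def by auto
  define sh where "sh e = (SOME V. V \<in> \<V> \<and> e \<in> V)" for e
  have sh: "sh e \<in> \<V> \<and> e \<in> sh e" if "e \<in> topspace X'" "p e \<in> U" for e
  proof -
    have "\<exists>V. V \<in> \<V> \<and> e \<in> V" using V(1) that by blast
    then show ?thesis unfolding sh_def by (rule someI_ex)
  qed
  have "\<exists>s. homeomorphic_maps (subtopology X' V) (subtopology X U) p s" if "V \<in> \<V>" for V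
    using V(3)[OF that] by (simp add: homeomorphic_map_maps)
  then obtain s where s: "\<And>V. V \<in> \<V> \<Longrightarrow> homeomorphic_maps (subtopology X' V) (subtopology X U) p (s V)"
    by metis
  have subU: "U \<subseteq> topspace X" using U by (simp add: openin_subset)
  have subV: "V \<subseteq> topspace X' \<and> p ` V \<subseteq> U" if "V \<in> \<V>" for V using V(1) that by blast
  have s1: "continuous_map (subtopology X U) X' (s V)" "\<And>y. y \<in> U \<Longrightarrow> s V y \<in> V \<and> p (s V y) = y"
    "\<And>v. v \<in> V \<Longrightarrow> s V (p v) = v" if W: "V \<in> \<V>" for V
  proof -
    have *: "continuous_map (subtopology X U) (subtopology X' V) (s V)"
      "\<forall>x\<in>topspace (subtopology X' V). s V (p x) = x" "\<forall>y\<in>topspace (subtopology X U). p (s V y) = y"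
      using s[OF W] unfolding homeomorphic_maps_def by auto
    show "continuous_map (subtopology X U) X' (s V)" using *(1) continuous_map_into_fulltopology by blast
    show "s V y \<in> V \<and> p (s V y) = y" if "y \<in> U" for y
      using *(1,3) that subU unfolding continuous_map_def by (auto simp: Pi_iff)
    show "s V (p v) = v" if "v \<in> V" for v using *(2) that subV[OF W] by auto
  qed
  have shv: "sh v = sh e" if "e \<in> topspace X'" "p e \<in> U" "v \<in> sh e" for e v
  proof -
    have e: "sh e \<in> \<V>" using sh that by blast
    then have v: "v \<in> topspace X'" "p v \<in> U" using subV that(3) by blast+
    have "\<not> disjnt (sh e) (sh v)" using sh[OF v] that(3) by (auto simp: disjnt_def)
    then show ?thesis using V(2) e sh[OF v] unfolding pairwise_def by metis
  qed
  have "openin X' (sh e) \<and> e \<in> sh e \<and> p ` sh e \<subseteq> U \<and>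
        (\<forall>v\<in>sh e. sh v = sh e \<and> s (sh e) (p v) = v) \<and>
        continuous_map (subtopology X U) X' (s (sh e)) \<and>
        (\<forall>y\<in>U. s (sh e) y \<in> sh e \<and> p (s (sh e) y) = y)"
    if e: "e \<in> topspace X'" "p e \<in> U" for e
  proof (intro conjI ballI)
    note she = sh[OF e]
    show "openin X' (sh e)" "e \<in> sh e" "p ` sh e \<subseteq> U" using she V(3) subV by blast+
    show "continuous_map (subtopology X U) X' (s (sh e))" using she s1(1) by blast
    fix v assume "v \<in> sh e"
    then show "sh v = sh e" "s (sh e) (p v) = v" using shv[OF e] s1(3) she by blast+
  next
    note she = sh[OF e]
    fix y assume "y \<in> U"
    then show "s (sh e) y \<in> sh e" "p (s (sh e) y) = y" using s1(2) she by blast+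
  qed
  then have "evenly_covered X' X p U sh (\<lambda>e. s (sh e))"
    unfolding evenly_covered_def using U by blast
  then show ?thesis using U by blast
qed

text \<open>
  The total space need not be Hausdorff, so the sheets through the two values are compared instead of
  the values: they meet, hence they coincide, and both lifts are given by the section of that
  sheet.
\<close>

lemma lifts_agree_nearby:
  assumes cov: "covering_map X' X p" and N: "open N" "x \<in> N"
    and f: "continuous_map (top_of_set N) X' f" and g: "continuous_map (top_of_set N) X' g"
    and fg: "\<And>y. y \<in> N \<Longrightarrow> p (f y) = p (g y)"
    and freq: "frequently (\<lambda>y. f y = g y) (nhds x)"
  shows "eventually (\<lambda>y. f y = g y) (nhds x)"
proof -
  have fx: "f x \<in> topspace X'" and gx: "g x \<in> topspace X'"
    using f g N by (auto simp: continuous_map_def)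
  have "p (f x) \<in> topspace X" using cov fx unfolding covering_map_def by blast
  then obtain U sh sec where ev: "evenly_covered X' X p U sh sec" and xU: "p (f x) \<in> U"
    using covering_sheets[OF cov] by blast
  note U = evenly_coveredD(1)[OF ev] xU
  note sh = evenly_coveredD(2)[OF ev]
  note sec = evenly_coveredD(3-5)[OF ev]
  have pgx: "p (g x) \<in> U" using fg N U by metis
  let ?M = "{y\<in>N. f y \<in> sh (f x)} \<inter> {y\<in>N. g y \<in> sh (g x)}"
  have M: "open ?M" "x \<in> ?M"
    using open_preimage[OF N(1) f] open_preimage[OF N(1) g] sh[OF fx U(2)] sh[OF gx pgx] N by auto
  then have "eventually (\<lambda>y. y \<in> ?M) (nhds x)" unfolding eventually_nhds by blast
  from frequently_ex[OF frequently_eventually_conj[OF freq this]]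
  obtain y where y: "y \<in> ?M" "f y = g y" by blast
  have eq: "sh (f x) = sh (g x)"
    using sec(1)[OF fx U(2), of "f y"] sec(1)[OF gx pgx, of "g y"] y by auto
  have "f u = g u" if u: "u \<in> ?M" for u
  proof -
    have "sec (f x) (p (f u)) = f u" using sec(1)[OF fx U(2)] u by blast
    moreover have "sec (f x) (p (g u)) = g u" using sec(1)[OF fx U(2)] u eq by blast
    moreover have "p (f u) = p (g u)" using fg u by blast
    ultimately show ?thesis by (smt (verit))
  qed
  then show ?thesis unfolding eventually_nhds using M by (intro exI[of _ ?M]) simp
qed

definition local_lift where
  "local_lift X' p F D f x \<longleftrightarrow>
     (\<exists>N. open N \<and> x \<in> N \<and> N \<subseteq> D \<and> continuous_map (top_of_set N) X' f \<and> (\<forall>y\<in>N. p (f y) = F y))"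

lemma local_liftI:
  "open N \<Longrightarrow> x \<in> N \<Longrightarrow> N \<subseteq> D \<Longrightarrow> continuous_map (top_of_set N) X' f \<Longrightarrow> (\<And>y. y \<in> N \<Longrightarrow> p (f y) = F y)
    \<Longrightarrow> local_lift X' p F D f x"
  unfolding local_lift_def by blast

lemma section_local_lift:
  assumes "open D" "continuous_map (top_of_set D) X F" "openin X U"
    and "continuous_map (subtopology X U) X' s" "\<And>y. y \<in> U \<Longrightarrow> p (s y) = y"
    and "x \<in> D" "F x \<in> U"
  shows "local_lift X' p F D (\<lambda>y. s (F y)) x"
proof (rule local_liftI)
  let ?N = "{y\<in>D. F y \<in> U}"
  show "open ?N" using open_preimage assms by blast
  have "continuous_map (top_of_set ?N) (subtopology X U) F"
    using continuous_map_from_subtopology_mono[OF assms(2)] by (auto simp: continuous_map_in_subtopology)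
  from continuous_map_compose[OF this assms(4)]
  show "continuous_map (top_of_set ?N) X' (\<lambda>y. s (F y))" by (simp add: o_def)
qed (use assms in auto)

lemma continuation_local_lift:
  fixes D :: "'c::real_normed_vector set"
  assumes cov: "covering_map X' X p" and D: "open D" "convex D"
    and F: "continuous_map (top_of_set D) X F"
  shows "continuation D (local_lift X' p F D)"
proof
  fix x f assume x: "x \<in> D" and f: "local_lift X' p F D f x"
  then obtain N where N: "open N" "x \<in> N" "N \<subseteq> D" "continuous_map (top_of_set N) X' f" "\<forall>y\<in>N. p (f y) = F y"
    unfolding local_lift_def by blast
  show "eventually (local_lift X' p F D f) (nhds x)"
    unfolding eventually_nhds using N by (intro exI[of _ N]) (auto simp: local_lift_def)
  fix g
  show "local_lift X' p F D g x" if eq: "\<forall>\<^sub>F y in nhds x. f y = g y"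
  proof -
    obtain M where M: "open M" "x \<in> M" "\<forall>y\<in>M. f y = g y" using eq unfolding eventually_nhds by blast
    have "continuous_map (top_of_set (N \<inter> M)) X' g"
    proof (rule continuous_map_eq)
      show "continuous_map (top_of_set (N \<inter> M)) X' f"
        using continuous_map_from_subtopology_mono[OF N(4)] by blast
    qed (use M in auto)
    then show ?thesis using N M by (intro local_liftI[of "N \<inter> M"]) auto
  qed
  show "\<forall>\<^sub>F y in nhds x. f y = g y"
    if g: "local_lift X' p F D g x" and fr: "\<exists>\<^sub>F y in nhds x. \<forall>\<^sub>F u in nhds y. f u = g u"
  proof -
    obtain M where M: "open M" "x \<in> M" "M \<subseteq> D" "continuous_map (top_of_set M) X' g" "\<forall>y\<in>M. p (g y) = F y"
      using g unfolding local_lift_def by blast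
    show ?thesis
    proof (rule lifts_agree_nearby[OF cov, of "N \<inter> M"])
      show "continuous_map (top_of_set (N \<inter> M)) X' f" "continuous_map (top_of_set (N \<inter> M)) X' g"
        using continuous_map_from_subtopology_mono[OF N(4)] continuous_map_from_subtopology_mono[OF M(4)] by blast+
      show "\<exists>\<^sub>F y in nhds x. f y = g y"
        using fr by (rule frequently_mono[rotated]) (auto dest: eventually_nhds_x_imp_x)
    qed (use N M in auto)
  qed
next
  fix x w f assume x: "x \<in> D" and w: "w \<in> D"
    and f: "\<And>t. 0 \<le> t \<Longrightarrow> t < 1 \<Longrightarrow> local_lift X' p F D f (x + t *\<^sub>R (w - x))"
  let ?p = "\<lambda>t::real. x + t *\<^sub>R (w - x)"
  have "F w \<in> topspace X" using F w by (auto simp: continuous_map_def)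
  then obtain U sh sec where ev: "evenly_covered X' X p U sh sec" and xU: "F w \<in> U"
    using covering_sheets[OF cov] by blast
  note U = evenly_coveredD(1)[OF ev] xU
  note sh = evenly_coveredD(2)[OF ev]
  note sec = evenly_coveredD(3-5)[OF ev]
  have "open {y\<in>D. F y \<in> U}" using open_preimage D F U by blast
  then obtain e where e: "e > 0" "ball w e \<subseteq> {y\<in>D. F y \<in> U}"
    using w U by (auto elim!: openE[of _ w])
  have "filterlim ?p (nhds (?p 1)) (at_left 1)" by (intro tendsto_intros)
  then have "eventually (\<lambda>t. dist (?p t) w < e) (at_left 1)" using e(1) by (auto simp: tendsto_iff)
  moreover have "eventually (\<lambda>t::real. 0 < t \<and> t < 1) (at_left 1)"
    using eventually_at_left_real[of 0 "1::real"] by simp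
  ultimately have "eventually (\<lambda>t. dist (?p t) w < e \<and> 0 < t \<and> t < 1) (at_left 1)"
    by (rule eventually_conj)
  then obtain t where t: "dist (?p t) w < e" "0 < t" "t < 1"
    using eventually_happens[of _ "at_left (1::real)"] by auto
  have pB: "?p s \<in> ball w e" if "t \<le> s" "s \<le> 1" for s
  proof -
    have n: "dist (?p r) w = \<bar>r - 1\<bar> * norm (w - x)" for r
    proof -
      have "?p r - w = (r - 1) *\<^sub>R (w - x)" by (simp add: algebra_simps)
      then show ?thesis unfolding dist_norm by (metis norm_scaleR)
    qed
    have "\<bar>s - 1\<bar> * norm (w - x) \<le> \<bar>t - 1\<bar> * norm (w - x)" using that by (intro mult_right_mono) auto
    then show ?thesis using t(1) n[of s] n[of t] by (simp add: dist_commute)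
  qed
  obtain N where N: "open N" "?p t \<in> N" "N \<subseteq> D" "continuous_map (top_of_set N) X' f" "\<forall>y\<in>N. p (f y) = F y"
    using f[of t] t unfolding local_lift_def by auto
  let ?e = "f (?p t)"
  have pt: "?p t \<in> D" "F (?p t) \<in> U" using pB[of t] e t by auto
  have e': "?e \<in> topspace X'" "p ?e \<in> U" using N pt by (auto simp: continuous_map_def)
  let ?g = "\<lambda>y. sec ?e (F y)"
  have "local_lift X' p F D ?g (?p s)" if "t \<le> s" "s \<le> 1" for s
    using pB[OF that] e sec[OF e'] by (intro section_local_lift[OF D(1) F U(1)]) auto
  moreover have "eventually (\<lambda>u. f u = ?g u) (nhds (?p t))"
  proof -
    let ?M = "{y\<in>N. f y \<in> sh ?e}"
    have "open ?M" "?p t \<in> ?M" using open_preimage[OF N(1,4)] sh[OF e'] N by auto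
    moreover have "f u = ?g u" if "u \<in> ?M" for u using sec(1)[OF e', of "f u"] N(5) that by force
    ultimately show ?thesis unfolding eventually_nhds by blast
  qed
  ultimately show "\<exists>g t. 0 \<le> t \<and> t < 1 \<and> eventually (\<lambda>u. f u = g u) (nhds (x + t *\<^sub>R (w - x))) \<and>
        (\<forall>s. t \<le> s \<and> s \<le> (1::real) \<longrightarrow> local_lift X' p F D g (x + s *\<^sub>R (w - x)))"
    using t by (intro exI[of _ ?g] exI[of _ t]) auto
qed (use D in auto)

text \<open>
  Every convex open set is simply connected, so there is no obstruction to lifting. The universal
  cover, the real line and the plane of homotopy parameters are all of this kind.
\<close>

lemma covering_lift_exists:
  fixes D :: "'c::real_normed_vector set"
  assumes cov: "covering_map X' X p" and D: "open D" "convex D"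
    and F: "continuous_map (top_of_set D) X F"
    and x0: "x0 \<in> D" "e0 \<in> topspace X'" "p e0 = F x0"
  obtains f where "continuous_map (top_of_set D) X' f" "\<And>x. x \<in> D \<Longrightarrow> p (f x) = F x" "f x0 = e0"
proof -
  interpret continuation D "local_lift X' p F D" by (rule continuation_local_lift[OF cov D F])
  have "F x0 \<in> topspace X" using F x0 by (auto simp: continuous_map_def)
  then obtain U sh sec where ev: "evenly_covered X' X p U sh sec" and xU: "F x0 \<in> U"
    using covering_sheets[OF cov] by blast
  note U = evenly_coveredD(1)[OF ev] xU
  note sh = evenly_coveredD(2)[OF ev]
  note sec = evenly_coveredD(3-5)[OF ev]
  have e0: "p e0 \<in> U" using x0 U by simp
  have "local_lift X' p F D (\<lambda>y. sec e0 (F y)) x0"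
    using x0 U sec[OF x0(2) e0] by (intro section_local_lift[OF D(1) F U(1)]) auto
  from monodromy[OF x0(1) this] obtain f where
    f: "\<forall>x\<in>D. local_lift X' p F D f x" "eventually (\<lambda>y. f y = sec e0 (F y)) (nhds x0)" by blast
  show thesis
  proof (rule that)
    show "continuous_map (top_of_set D) X' f"
      by (rule continuous_map_local) (use f(1) in \<open>auto simp: local_lift_def\<close>)
    show "p (f x) = F x" if "x \<in> D" for x using f(1) that by (auto simp: local_lift_def)
    have "f x0 = sec e0 (F x0)" using f(2) by (rule eventually_nhds_x_imp_x)
    then show "f x0 = e0" using sec(1)[OF x0(2) e0, of e0] sh[OF x0(2) e0] x0(3) by simp
  qed
qed

lemma covering_lift_unique:
  fixes D :: "'c::real_normed_vector set"
  assumes cov: "covering_map X' X p" and D: "open D" "convex D"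
    and f: "continuous_map (top_of_set D) X' f" and g: "continuous_map (top_of_set D) X' g"
    and fg: "\<And>y. y \<in> D \<Longrightarrow> p (f y) = p (g y)" and a: "a \<in> D" "f a = g a" and x: "x \<in> D"
  shows "f x = g x"
proof -
  let ?F = "\<lambda>y. p (f y)"
  have "continuous_map X' X p" using cov by (simp add: covering_map_def)
  from continuous_map_compose[OF f this] have F: "continuous_map (top_of_set D) X ?F" by (simp add: o_def)
  interpret continuation D "local_lift X' p ?F D" by (rule continuation_local_lift[OF cov D F])
  show ?thesis
  proof (rule unique_on_connected[of D f g a x])
    show "local_lift X' p ?F D f x" "local_lift X' p ?F D g x" if "x \<in> D" for x
      using that D f g fg by (auto intro!: local_liftI[of D])
    show "\<forall>\<^sub>F y in nhds a. f y = g y"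
    proof (rule lifts_agree_nearby[OF cov D(1) a(1) f g fg])
      show "\<exists>\<^sub>F y in nhds a. f y = g y"
        unfolding frequently_def using a(2) eventually_nhds_x_imp_x by blast
    qed
  qed (use D a x in \<open>auto intro: convex_connected\<close>)
qed

section \<open>The hyperbolic plane\<close>

definition UH :: "complex set" where "UH = {z. 0 < Im z}"

lemma in_UH [simp]: "z \<in> UH \<longleftrightarrow> 0 < Im z" by (simp add: UH_def)

lemma open_UH: "open UH" unfolding UH_def by (rule open_halfspace_Im_gt)

lemma convex_UH: "convex UH" unfolding UH_def by (rule convex_halfspace_Im_gt)

text \<open>
  The quantity \<open>2 (cosh (hyp_dist z w) - 1)\<close>. It is rational in the coordinates, which makes
  the isometry conditions polynomial.
\<close>

definition chord :: "complex \<Rightarrow> complex \<Rightarrow> real" where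
  "chord z w = (cmod (z - w))\<^sup>2 / (Im z * Im w)"

lemma chord_commute: "chord z w = chord w z"
  by (simp add: chord_def norm_minus_commute mult.commute)

lemma chord_nonneg: "z \<in> UH \<Longrightarrow> w \<in> UH \<Longrightarrow> 0 \<le> chord z w"
  by (simp add: chord_def)

lemma chord_eq_0: "z \<in> UH \<Longrightarrow> w \<in> UH \<Longrightarrow> chord z w = 0 \<longleftrightarrow> z = w"
  by (auto simp: chord_def)

lemma hyp_dist_chord: "hyp_dist z w = arcosh (1 + chord z w / 2)"
  by (simp add: hyp_dist_def chord_def mult_ac)

lemma hyp_dist_eq_iff:
  assumes "z \<in> UH" "w \<in> UH" "z' \<in> UH" "w' \<in> UH"
  shows "hyp_dist z w = hyp_dist z' w' \<longleftrightarrow> chord z w = chord z' w'"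
proof
  assume "hyp_dist z w = hyp_dist z' w'"
  then have "cosh (arcosh (1 + chord z w / 2)) = cosh (arcosh (1 + chord z' w' / 2))"
    by (simp add: hyp_dist_chord)
  then show "chord z w = chord z' w'"
    using chord_nonneg[OF assms(1,2)] chord_nonneg[OF assms(3,4)]
    by (smt (verit) cosh_arcosh_real field_sum_of_halves)
qed (simp add: hyp_dist_chord)

lemma hyp_dist_nonneg: "z \<in> UH \<Longrightarrow> w \<in> UH \<Longrightarrow> 0 \<le> hyp_dist z w"
  using chord_nonneg[of z w] by (simp add: hyp_dist_chord)

lemma hyp_dist_commute: "hyp_dist z w = hyp_dist w z"
  by (simp add: hyp_dist_chord chord_commute)

lemma cosh_hyp_dist: "z \<in> UH \<Longrightarrow> w \<in> UH \<Longrightarrow> cosh (hyp_dist z w) = 1 + chord z w / 2"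
  using chord_nonneg[of z w] by (simp add: hyp_dist_chord)

lemma hyp_dist_self [simp]: "hyp_dist z z = 0"
  by (simp add: hyp_dist_chord chord_def)

lemma hyp_dist_eq_0: "z \<in> UH \<Longrightarrow> w \<in> UH \<Longrightarrow> hyp_dist z w = 0 \<longleftrightarrow> z = w"
  using chord_nonneg[of z w] chord_eq_0[of z w] by (simp add: hyp_dist_chord)

lemma chord_Re_Im: "chord z w = ((Re z - Re w)\<^sup>2 + (Im z - Im w)\<^sup>2) / (Im z * Im w)"
  by (simp add: chord_def cmod_power2)

text \<open>
  Hyperbolic balls are Euclidean balls with another centre. Hence they are convex in the Euclidean
  sense, and the two metrics induce the same topology.
\<close>

lemma hyp_ball_eq_ball:
  assumes z: "z \<in> UH" and r: "0 < r"
  shows "hyp_ball z r = ball (Complex (Re z) (Im z * cosh r)) (Im z * sinh r)"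
proof (rule Set.set_eqI)
  fix w
  let ?y = "Im z" and ?v = "Im w" and ?d = "(Re z - Re w)\<^sup>2"
  have y: "0 < ?y" using z by simp
  have s: "0 < sinh r" using r by simp
  have "dist (Complex (Re z) (?y * cosh r)) w < ?y * sinh r \<longleftrightarrow>
     (dist (Complex (Re z) (?y * cosh r)) w)\<^sup>2 < (?y * sinh r)\<^sup>2"
    using y s by (intro iffI power_strict_mono) (auto dest: power_less_imp_less_base)
  also have "(dist (Complex (Re z) (?y * cosh r)) w)\<^sup>2 = ?d + (?y * cosh r - ?v)\<^sup>2"
    by (simp add: dist_norm cmod_power2)
  also have "?d + (?y * cosh r - ?v)\<^sup>2 < (?y * sinh r)\<^sup>2 \<longleftrightarrow> ?d + (?y - ?v)\<^sup>2 < 2 * ?y * ?v * (cosh r - 1)"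
  proof -
    have "(?y * cosh r)\<^sup>2 = ?y\<^sup>2 + (?y * sinh r)\<^sup>2"
      by (simp add: cosh_square_eq power_mult_distrib algebra_simps)
    then show ?thesis by (simp add: power2_diff algebra_simps)
  qed
  finally have 1: "w \<in> ball (Complex (Re z) (?y * cosh r)) (?y * sinh r) \<longleftrightarrow>
     ?d + (?y - ?v)\<^sup>2 < 2 * ?y * ?v * (cosh r - 1)" by simp
  have pos: "0 < ?v" if "?d + (?y - ?v)\<^sup>2 < 2 * ?y * ?v * (cosh r - 1)"
  proof -
    have "0 \<le> ?d + (?y - ?v)\<^sup>2" by simp
    moreover have "2 * ?y * ?v * (cosh r - 1) = (2 * ?y * (cosh r - 1)) * ?v" by simp
    ultimately have "0 < (2 * ?y * (cosh r - 1)) * ?v" using that by linarith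
    moreover have "0 \<le> 2 * ?y * (cosh r - 1)" using y cosh_real_ge_1[of r] by simp
    ultimately show ?thesis by (metis mult_nonneg_nonpos not_le)
  qed
  have 2: "hyp_dist z w < r \<longleftrightarrow> ?d + (?y - ?v)\<^sup>2 < 2 * ?y * ?v * (cosh r - 1)" if v: "0 < ?v"
  proof -
    have w: "w \<in> UH" using v by simp
    have "hyp_dist z w < r \<longleftrightarrow> cosh (hyp_dist z w) < cosh r"
      using hyp_dist_nonneg[OF z w] r by (simp add: cosh_real_nonneg_less_iff)
    also have "\<dots> \<longleftrightarrow> chord z w < 2 * (cosh r - 1)" using cosh_hyp_dist[OF z w] by auto
    also have "\<dots> \<longleftrightarrow> ?d + (?y - ?v)\<^sup>2 < 2 * ?y * ?v * (cosh r - 1)"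
      unfolding chord_Re_Im using y v by (simp add: pos_divide_less_eq mult_ac)
    finally show ?thesis .
  qed
  show "w \<in> hyp_ball z r \<longleftrightarrow> w \<in> ball (Complex (Re z) (?y * cosh r)) (?y * sinh r)"
    unfolding 1 hyp_ball_def using pos 2 by auto
qed

lemma hyp_ball_subset_UH: "hyp_ball z r \<subseteq> UH" by (auto simp: hyp_ball_def)

lemma open_hyp_ball: "z \<in> UH \<Longrightarrow> 0 < r \<Longrightarrow> open (hyp_ball z r)"
  and convex_hyp_ball: "z \<in> UH \<Longrightarrow> 0 < r \<Longrightarrow> convex (hyp_ball z r)"
  by (simp_all add: hyp_ball_eq_ball)

lemma centre_in_hyp_ball: "z \<in> UH \<Longrightarrow> 0 < r \<Longrightarrow> z \<in> hyp_ball z r"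
  by (simp add: hyp_ball_def)

lemma hyp_ball_in_open:
  assumes z: "z \<in> UH" and U: "open U" "z \<in> U"
  shows "\<exists>s>0. hyp_ball z s \<subseteq> U"
proof -
  obtain e where e: "e > 0" "ball z e \<subseteq> U" using U openE by blast
  have y: "0 < Im z" using z by simp
  define s where "s = ln (1 + e / Im z)"
  have s: "s > 0" unfolding s_def by (rule ln_gt_zero) (use e y in simp)
  have es: "exp s = 1 + e / Im z" unfolding s_def using e y by (simp add: add_pos_pos)
  have "hyp_ball z s \<subseteq> ball z e"
  proof
    fix w assume "w \<in> hyp_ball z s"
    then have "dist (Complex (Re z) (Im z * cosh s)) w < Im z * sinh s"
      using hyp_ball_eq_ball[OF z s] by simp
    moreover have "z - Complex (Re z) (Im z * cosh s) = Complex 0 (Im z * (1 - cosh s))"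
      by (simp add: complex_eq_iff algebra_simps)
    then have "dist z (Complex (Re z) (Im z * cosh s)) = Im z * (cosh s - 1)"
      unfolding dist_norm using y cosh_real_ge_1[of s] by (simp add: cmod_def abs_mult)
    ultimately have "dist z w < Im z * (cosh s - 1) + Im z * sinh s"
      using dist_triangle[of z w "Complex (Re z) (Im z * cosh s)"] by linarith
    also have "\<dots> = Im z * (exp s - 1)" by (simp add: cosh_plus_sinh[symmetric] algebra_simps)
    also have "\<dots> = e" unfolding es using y by simp
    finally show "w \<in> ball z e" by simp
  qed
  then show ?thesis using s e by blast
qed

text \<open>
  Away from the real axis the hyperbolic metric is bounded by a multiple of the Euclidean one,
  because \<open>1 + x\<^sup>2 / 2 \<le> cosh x\<close>. This controls the images of Euclidean segments under local
  isometries.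
\<close>

lemma hyp_dist_Lipschitz:
  assumes m: "0 < m" "m \<le> Im z" "m \<le> Im w"
  shows "hyp_dist z w \<le> cmod (z - w) / m"
proof -
  let ?x = "cmod (z - w) / m"
  have UH: "z \<in> UH" "w \<in> UH" using m by auto
  have x: "0 \<le> ?x" using m by simp
  have "m * m \<le> Im z * Im w" using m by (intro mult_mono) auto
  then have "chord z w \<le> (cmod (z - w))\<^sup>2 / (m * m)"
    unfolding chord_def using m by (intro divide_left_mono) auto
  also have "\<dots> = ?x\<^sup>2" by (simp add: power2_eq_square)
  finally have "1 + chord z w / 2 \<le> 1 + ?x\<^sup>2 / 2" by simp
  also have "\<dots> \<le> cosh ?x"
  proof -
    have "cosh ?x = 1 + 2 * (sinh (?x / 2))\<^sup>2"
      using cosh_double_cosh[of "?x/2"] by (simp add: cosh_square_eq)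
    moreover have "(?x / 2)\<^sup>2 \<le> (sinh (?x / 2))\<^sup>2"
    proof (rule power_mono)
      have "0 \<le> ?x / 2" using x by simp
      then have "(\<lambda>t. sinh t - t) 0 \<le> (\<lambda>t. sinh t - t) (?x / 2)"
        by (rule DERIV_nonneg_imp_nondecreasing)
          (auto intro!: exI derivative_eq_intros simp: cosh_real_ge_1)
      then show "?x / 2 \<le> sinh (?x / 2)" by simp
    qed (use x in simp)
    ultimately show ?thesis by (simp add: power2_eq_square)
  qed
  finally have "cosh (hyp_dist z w) \<le> cosh ?x" using cosh_hyp_dist[OF UH] by simp
  then show ?thesis using hyp_dist_nonneg[OF UH] x by (simp add: cosh_real_nonneg_le_iff)
qed

lemma hyp_dist_vertical: "hyp_dist (\<i> * of_real (exp a)) (\<i> * of_real (exp b)) = \<bar>a - b\<bar>"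
proof -
  let ?z = "\<i> * of_real (exp a)" and ?w = "\<i> * of_real (exp b)"
  have UH: "?z \<in> UH" "?w \<in> UH" by simp_all
  have "cosh (hyp_dist ?z ?w) = 1 + (exp a - exp b)\<^sup>2 / (2 * (exp a * exp b))"
    unfolding cosh_hyp_dist[OF UH] chord_Re_Im by simp
  also have "\<dots> = cosh (a - b)"
    by (simp add: cosh_field_def exp_diff exp_minus field_simps power2_eq_square)
  also have "\<dots> = cosh \<bar>a - b\<bar>" by (simp add: abs_if)
  finally show ?thesis using hyp_dist_nonneg[OF UH] by simp
qed

section \<open>Isometries of the hyperbolic plane\<close>

text \<open>
  Isometric embeddings of an arbitrary subset are needed for the transition maps between charts,
  which are defined on small sets only.
\<close>

definition isom_on :: "complex set \<Rightarrow> (complex \<Rightarrow> complex) \<Rightarrow> bool" where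
  "isom_on B f \<longleftrightarrow> f ` B \<subseteq> UH \<and> (\<forall>z\<in>B. \<forall>w\<in>B. chord (f z) (f w) = chord z w)"

definition isom :: "(complex \<Rightarrow> complex) \<Rightarrow> bool" where
  "isom A \<longleftrightarrow> isom_on UH A \<and> A ` UH = UH"

lemma isom_UH: "isom A \<Longrightarrow> z \<in> UH \<Longrightarrow> A z \<in> UH" by (auto simp: isom_def isom_on_def)

lemma isom_chord: "isom A \<Longrightarrow> z \<in> UH \<Longrightarrow> w \<in> UH \<Longrightarrow> chord (A z) (A w) = chord z w"
  by (simp add: isom_def isom_on_def)

lemma isom_dist: "isom A \<Longrightarrow> z \<in> UH \<Longrightarrow> w \<in> UH \<Longrightarrow> hyp_dist (A z) (A w) = hyp_dist z w"
  by (simp add: hyp_dist_chord isom_chord)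

lemma isom_inj: "isom A \<Longrightarrow> z \<in> UH \<Longrightarrow> w \<in> UH \<Longrightarrow> A z = A w \<longleftrightarrow> z = w"
  using chord_eq_0 isom_UH isom_chord by metis

lemma isom_comp: "isom A \<Longrightarrow> isom B \<Longrightarrow> isom (\<lambda>z. A (B z))"
proof -
  assume A: "isom A" and B: "isom B"
  have "(\<lambda>z. A (B z)) ` UH = A ` B ` UH" by (simp add: image_image)
  then have "(\<lambda>z. A (B z)) ` UH = UH" using A B by (simp add: isom_def)
  moreover have "chord (A (B z)) (A (B w)) = chord z w" if "z \<in> UH" "w \<in> UH" for z w
    using isom_chord[OF A isom_UH[OF B that(1)] isom_UH[OF B that(2)]] isom_chord[OF B that] by simp
  ultimately show ?thesis unfolding isom_def isom_on_def by simp
qed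

lemma isom_id: "isom (\<lambda>z. z)" by (auto simp: isom_def isom_on_def)

lemma isom_inverse:
  assumes "isom A"
  obtains B where "isom B" "\<And>z. z \<in> UH \<Longrightarrow> B (A z) = z" "\<And>z. z \<in> UH \<Longrightarrow> A (B z) = z"
proof
  let ?B = "inv_into UH A"
  have inj: "inj_on A UH" using isom_inj[OF assms] by (simp add: inj_on_def)
  have im: "A ` UH = UH" using assms by (simp add: isom_def)
  show 1: "?B (A z) = z" if "z \<in> UH" for z using inj that by (rule inv_into_f_f)
  show 2: "A (?B z) = z" if "z \<in> UH" for z using im that f_inv_into_f[of z A UH] by simp
  have B: "?B z \<in> UH" if "z \<in> UH" for z using im that inv_into_into[of z A UH] by simp
  have "chord (?B z) (?B w) = chord z w" if "z \<in> UH" "w \<in> UH" for z w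
    using isom_chord[OF assms B[OF that(1)] B[OF that(2)]] 2 that by simp
  moreover have "?B ` UH = UH" using B 1 isom_UH[OF assms] by (metis image_subset_iff subsetI subset_antisym image_eqI)
  ultimately show "isom ?B" unfolding isom_def isom_on_def by simp
qed

lemma isom_hyp_ball:
  assumes "isom A" "z \<in> UH" "u \<in> UH"
  shows "A u \<in> hyp_ball (A z) r \<longleftrightarrow> u \<in> hyp_ball z r"
  using isom_dist[OF assms] isom_UH[OF assms(1,3)] assms by (simp add: hyp_ball_def)

lemma isom_nbhd:
  assumes A: "isom A" and z: "z \<in> UH" and U: "open U" "A z \<in> U"
  shows "eventually (\<lambda>u. u \<in> UH \<and> A u \<in> U) (nhds z)"
proof -
  obtain s where s: "s > 0" "hyp_ball (A z) s \<subseteq> U"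
    using hyp_ball_in_open[OF isom_UH[OF A z] U] by blast
  then show ?thesis unfolding eventually_nhds
    using open_hyp_ball[OF z s(1)] centre_in_hyp_ball[OF z s(1)] isom_hyp_ball[OF A z] hyp_ball_subset_UH
    by (intro exI[of _ "hyp_ball z s"]) blast
qed

lemma continuous_on_isom: "isom A \<Longrightarrow> continuous_on UH A"
  unfolding continuous_on_def
proof (intro ballI topological_tendstoI)
  fix z U assume "isom A" "z \<in> UH" "open U" "A z \<in> U"
  from isom_nbhd[OF this] show "\<forall>\<^sub>F x in at z within UH. A x \<in> U"
    unfolding eventually_at_topological eventually_nhds by blast
qed

lemma chord_eqD:
  assumes "chord z p = chord z' p" "z \<in> UH" "z' \<in> UH" "p \<in> UH"
  shows "((Re z - Re p)\<^sup>2 + (Im z - Im p)\<^sup>2) * Im z' = ((Re z' - Re p)\<^sup>2 + (Im z' - Im p)\<^sup>2) * Im z"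
proof -
  have "A * v' = B * v" if "A / (v * y) = B / (v' * y)" "v > 0" "v' > 0" "y > 0" for A B v v' y :: real
    using that by (simp add: field_simps)
  then show ?thesis using assms in_UH unfolding chord_Re_Im by blast
qed

text \<open>
  A point is determined by its distances to three points on a horizontal line. After clearing
  denominators the second difference of the three equations gives the imaginary part, and the first
  difference the real part.
\<close>

lemma chord_determines:
  assumes z: "z \<in> UH" "z' \<in> UH" and p: "p \<in> UH" and h: "h \<noteq> 0"
    and eq: "chord z p = chord z' p" "chord z (p + of_real h) = chord z' (p + of_real h)"
      "chord z (p - of_real h) = chord z' (p - of_real h)"
  shows "z = z'"
proof -
  define x y u v u' v' where d: "x = Re p" "y = Im p" "u = Re z" "v = Im z" "u' = Re z'" "v' = Im z'"
  have pos: "0 < y" "0 < v" "0 < v'" using z p d by auto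
  have ph: "p + of_real h \<in> UH" "p - of_real h \<in> UH" using p by simp_all
  have e1: "((u - x)\<^sup>2 + (v - y)\<^sup>2) * v' = ((u' - x)\<^sup>2 + (v' - y)\<^sup>2) * v"
    using chord_eqD[OF eq(1) z p] by (simp add: d)
  have e2: "((u - (x + h))\<^sup>2 + (v - y)\<^sup>2) * v' = ((u' - (x + h))\<^sup>2 + (v' - y)\<^sup>2) * v"
    using chord_eqD[OF eq(2) z ph(1)] by (simp add: d)
  have e3: "((u - (x - h))\<^sup>2 + (v - y)\<^sup>2) * v' = ((u' - (x - h))\<^sup>2 + (v' - y)\<^sup>2) * v"
    using chord_eqD[OF eq(3) z ph(2)] by (simp add: d)
  have "2 * h\<^sup>2 * v' = 2 * h\<^sup>2 * v" using e1 e2 e3 by Groebner_Basis.algebra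
  then have v: "v' = v" using h by simp
  have "4 * h * (u - u') * v = 0" using e2 e3 unfolding v by Groebner_Basis.algebra
  then have "u = u'" using h pos by simp
  then show ?thesis using v d by (simp add: complex_eq_iff)
qed

text \<open>
  If \<open>A\<close> and \<open>B\<close> agree near \<open>p\<close>, then \<open>z\<close> and \<open>A\<^sup>-\<^sup>1 (B z)\<close> have the same distances to all points
  near \<open>p\<close>.
\<close>

lemma isom_eqI:
  assumes A: "isom A" and B: "isom B" and p: "p \<in> UH" and eq: "eventually (\<lambda>u. A u = B u) (nhds p)"
    and z: "z \<in> UH"
  shows "A z = B z"
proof -
  obtain C where C: "isom C" "\<And>z. z \<in> UH \<Longrightarrow> C (A z) = z" "\<And>z. z \<in> UH \<Longrightarrow> A (C z) = z"
    using isom_inverse[OF A] by blast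
  obtain e where e: "e > 0" "\<And>u. dist u p < e \<Longrightarrow> A u = B u" using eq unfolding eventually_nhds_metric by blast
  define h where "h = e / 2"
  let ?w = "C (B z)"
  have w: "?w \<in> UH" using B C z isom_UH by blast
  have ch: "chord z u = chord ?w u" if u: "u \<in> UH" "dist u p < e" for u
  proof -
    have "chord ?w u = chord (A ?w) (A u)" using isom_chord[OF A w u(1)] by simp
    also have "\<dots> = chord (B z) (B u)" using C(3)[OF isom_UH[OF B z]] e(2)[OF u(2)] by simp
    also have "\<dots> = chord z u" using isom_chord[OF B z u(1)] .
    finally show ?thesis by simp
  qed
  have h: "h \<noteq> 0" "dist (p + of_real h) p < e" "dist (p - of_real h) p < e" using e by (auto simp: h_def dist_norm)
  have "z = ?w" using p e h by (intro chord_determines[OF z w p h(1)] ch) auto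
  then show ?thesis using C(3)[OF isom_UH[OF B z]] by simp
qed

text \<open>
  Any positive determinant is allowed, so that matrices need not be normalised.
\<close>

definition mob :: "real \<Rightarrow> real \<Rightarrow> real \<Rightarrow> real \<Rightarrow> complex \<Rightarrow> complex" where
  "mob a b c d z = (of_real a * z + of_real b) / (of_real c * z + of_real d)"

lemma denom_nonzero:
  assumes "a * d - b * c > 0" "z \<in> UH"
  shows "of_real c * z + of_real d \<noteq> 0"
proof
  assume 0: "of_real c * z + of_real d = 0"
  then have "Im (of_real c * z + of_real d) = 0" "Re (of_real c * z + of_real d) = 0" by simp_all
  then have "c = 0" "d = 0" using assms by simp_all
  then show False using assms by simp
qed

lemma mob_diff:
  assumes D: "a * d - b * c > 0" and z: "z \<in> UH" and w: "w \<in> UH"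
  shows "mob a b c d z - mob a b c d w =
    of_real (a * d - b * c) * (z - w) / ((of_real c * z + of_real d) * (of_real c * w + of_real d))"
  using denom_nonzero[OF D z] denom_nonzero[OF D w] unfolding mob_def
  by (simp add: diff_frac_eq algebra_simps)

lemma Im_mob:
  assumes D: "a * d - b * c > 0" and z: "z \<in> UH"
  shows "Im (mob a b c d z) = (a * d - b * c) * Im z / (cmod (of_real c * z + of_real d))\<^sup>2"
  unfolding mob_def complex_div_cnj[of "of_real a * z + of_real b"]
  by (simp add: cmod_power2 algebra_simps)

lemma mob_UH: "a * d - b * c > 0 \<Longrightarrow> z \<in> UH \<Longrightarrow> mob a b c d z \<in> UH"
  using denom_nonzero[of a d b c z] by (simp add: Im_mob)

lemma mob_chord:
  assumes D: "a * d - b * c > 0" and z: "z \<in> UH" and w: "w \<in> UH"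
  shows "chord (mob a b c d z) (mob a b c d w) = chord z w"
proof -
  let ?D = "a * d - b * c" and ?k = "cmod (of_real c * z + of_real d)" and ?l = "cmod (of_real c * w + of_real d)"
  have kl: "?k > 0" "?l > 0" using denom_nonzero[OF D] z w by auto
  have "chord (mob a b c d z) (mob a b c d w) =
     (?D * cmod (z - w) / (?k * ?l))\<^sup>2 / ((?D * Im z / ?k\<^sup>2) * (?D * Im w / ?l\<^sup>2))"
    unfolding chord_def mob_diff[OF assms] Im_mob[OF D z] Im_mob[OF D w]
    using D by (simp add: norm_mult norm_divide del: of_real_diff of_real_mult)
  also have "\<dots> = (cmod (z - w))\<^sup>2 / (Im z * Im w)"
  proof -
    have "(D * n / (k * l))\<^sup>2 / ((D * p / k\<^sup>2) * (D * q / l\<^sup>2)) = n\<^sup>2 / (p * q)"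
      if "D > 0" "k > 0" "l > 0" for D n k l p q :: real
      using that by (simp add: field_simps power2_eq_square)
    then show ?thesis using D kl by blast
  qed
  finally show ?thesis by (simp add: chord_def)
qed

lemma mob_comp:
  assumes D: "a * d - b * c > 0" "a' * d' - b' * c' > 0" and z: "z \<in> UH"
  shows "mob a b c d (mob a' b' c' d' z) =
    mob (a * a' + b * c') (a * b' + b * d') (c * a' + d * c') (c * b' + d * d') z"
proof -
  have k: "of_real c' * z + of_real d' \<noteq> 0" using denom_nonzero[OF D(2) z] .
  have l: "of_real c * mob a' b' c' d' z + of_real d \<noteq> 0"
    using denom_nonzero[OF D(1) mob_UH[OF D(2) z]] .
  have eq: "(of_real p * mob a' b' c' d' z + of_real q) * (of_real c' * z + of_real d')
    = of_real (p * a' + q * c') * z + of_real (p * b' + q * d')" for p q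
    unfolding mob_def using k by (simp add: field_simps)
  have "mob a b c d (mob a' b' c' d' z) =
    ((of_real a * mob a' b' c' d' z + of_real b) * (of_real c' * z + of_real d')) /
    ((of_real c * mob a' b' c' d' z + of_real d) * (of_real c' * z + of_real d'))"
    unfolding mob_def[of a b c d] using k by simp
  then show ?thesis unfolding eq by (simp add: mob_def)
qed

lemma mob_inverse:
  assumes D: "a * d - b * c > 0" and z: "z \<in> UH"
  shows "mob d (-b) (-c) a (mob a b c d z) = z" "mob a b c d (mob d (-b) (-c) a z) = z"
proof -
  have D': "d * a - (-b) * (-c) > 0" using D by (simp add: algebra_simps)
  have id: "mob k 0 0 k z = z" if "k \<noteq> 0" for k using that by (simp add: mob_def)
  have k: "a * d - b * c \<noteq> 0" using D by simp
  show "mob d (-b) (-c) a (mob a b c d z) = z" "mob a b c d (mob d (-b) (-c) a z) = z"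
    using mob_comp[OF D' D z] mob_comp[OF D D' z] id[OF k] by (simp_all add: algebra_simps)
qed

lemma isom_mob:
  assumes D: "a * d - b * c > 0"
  shows "isom (mob a b c d)"
proof -
  have D': "d * a - (-b) * (-c) > 0" using D by (simp add: algebra_simps)
  have "mob a b c d ` UH = UH"
    using mob_UH[OF D] mob_UH[OF D'] mob_inverse[OF D]
    by (metis image_eqI image_subset_iff subsetI subset_antisym)
  then show ?thesis unfolding isom_def isom_on_def using mob_chord[OF D] by auto
qed

lemma chord_reflect: "chord (- cnj z) (- cnj w) = chord z w"
  by (simp add: chord_Re_Im power2_commute[of "Re w"] power2_eq_square algebra_simps)

lemma isom_reflect: "isom (\<lambda>z. - cnj z)"
proof -
  have "z \<in> (\<lambda>z. - cnj z) ` UH" if "z \<in> UH" for z using that by (intro image_eqI[of _ _ "- cnj z"]) auto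
  then show ?thesis unfolding isom_def isom_on_def by (auto simp: chord_reflect)
qed

definition moebius :: "(complex \<Rightarrow> complex) \<Rightarrow> bool" where
  "moebius f \<longleftrightarrow> (\<exists>a b c d. a * d - b * c > 0 \<and> (\<forall>z\<in>UH. f z = mob a b c d z))"

definition antimoebius :: "(complex \<Rightarrow> complex) \<Rightarrow> bool" where
  "antimoebius f \<longleftrightarrow> (\<exists>a b c d. a * d - b * c > 0 \<and> (\<forall>z\<in>UH. f z = mob a b c d (- cnj z)))"

lemma isom_cong: "isom A \<Longrightarrow> (\<And>z. z \<in> UH \<Longrightarrow> B z = A z) \<Longrightarrow> isom B"
  unfolding isom_def isom_on_def by (simp add: image_def)

lemma moebius_isom: "moebius f \<Longrightarrow> isom f"
  unfolding moebius_def using isom_mob isom_cong by blast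

lemma antimoebius_isom:
  assumes "antimoebius f" shows "isom f"
proof -
  obtain a b c d where D: "a * d - b * c > 0" "\<forall>z\<in>UH. f z = mob a b c d (- cnj z)"
    using assms unfolding antimoebius_def by blast
  show ?thesis by (rule isom_cong[OF isom_comp[OF isom_mob[OF D(1)] isom_reflect]]) (use D in blast)
qed

lemma moebius_mob: "a * d - b * c > 0 \<Longrightarrow> moebius (mob a b c d)"
  unfolding moebius_def by blast

lemma moebius_comp:
  assumes "moebius f" "moebius g" shows "moebius (\<lambda>z. f (g z))"
proof -
  obtain a b c d where 1: "a * d - b * c > 0" "\<forall>z\<in>UH. f z = mob a b c d z"
    using assms unfolding moebius_def by blast
  obtain a' b' c' d' where 2: "a' * d' - b' * c' > 0" "\<forall>z\<in>UH. g z = mob a' b' c' d' z"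
    using assms unfolding moebius_def by blast
  have "(a * a' + b * c') * (c * b' + d * d') - (a * b' + b * d') * (c * a' + d * c') = (a * d - b * c) * (a' * d' - b' * c')"
    by Groebner_Basis.algebra
  moreover have "f (g z) = mob (a * a' + b * c') (a * b' + b * d') (c * a' + d * c') (c * b' + d * d') z" if "z \<in> UH" for z
    using 1 2 that mob_UH[OF 2(1) that] mob_comp[OF 1(1) 2(1) that] by simp
  ultimately show ?thesis unfolding moebius_def using 1 2
    by (intro exI[of _ "a * a' + b * c'"] exI[of _ "a * b' + b * d'"] exI[of _ "c * a' + d * c'"] exI[of _ "c * b' + d * d'"])
       (simp add: mult_pos_pos)
qed

lemma moebius_inverse:
  assumes "moebius f"
  obtains g where "moebius g" "\<And>z. z \<in> UH \<Longrightarrow> g (f z) = z" "\<And>z. z \<in> UH \<Longrightarrow> f (g z) = z"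
proof -
  obtain a b c d where 1: "a * d - b * c > 0" "\<forall>z\<in>UH. f z = mob a b c d z"
    using assms unfolding moebius_def by blast
  have D': "d * a - (-b) * (-c) > 0" using 1 by (simp add: algebra_simps)
  show thesis
    using that[of "mob d (-b) (-c) a"] moebius_mob[OF D'] mob_inverse[OF 1(1)] 1 mob_UH[OF D'] by metis
qed

text \<open>
  An affine map moves \<open>z\<close> to \<open>\<i>\<close>. The rotations about \<open>\<i>\<close> have the matrices with rows \<open>(x, s)\<close> and
  \<open>(-s, x)\<close>; such a rotation moves the image of \<open>w\<close> to the imaginary axis when a quadratic equation
  holds, which always has a real solution. If the image lies below \<open>\<i>\<close>, the half-turn \<open>-1 / z\<close> puts
  it above.
\<close>

lemma moebius_to_axis:
  assumes z: "z \<in> UH" and w: "w \<in> UH" and ne: "z \<noteq> w"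
  obtains M y where "moebius M" "M z = \<i>" "1 < y" "M w = \<i> * of_real y"
proof -
  let ?M1 = "mob 1 (- Re z) 0 (Im z)"
  have D1: "1 * Im z - (- Re z) * 0 > 0" using z by simp
  have M1z: "?M1 z = \<i>" using z by (simp add: mob_def complex_eq_iff field_simps)
  let ?w = "?M1 w"
  have w1: "?w \<in> UH" using mob_UH[OF D1 w] .
  define p q where "p = Re ?w" and "q = (cmod ?w)\<^sup>2"
  have "\<exists>x s :: real. x\<^sup>2 + s\<^sup>2 > 0 \<and> x * s * (1 - q) + (x\<^sup>2 - s\<^sup>2) * p = 0"
  proof (cases "p = 0")
    case True
    then show ?thesis by (intro exI[of _ 1] exI[of _ 0]) simp
  next
    case False
    define r where "r = sqrt ((1 - q)\<^sup>2 + 4 * p\<^sup>2)"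
    have r: "r\<^sup>2 = (1 - q)\<^sup>2 + 4 * p\<^sup>2" by (simp add: r_def)
    define x where "x = (- (1 - q) + r) / (2 * p)"
    have px: "2 * p * x = r - (1 - q)" using False by (simp add: x_def)
    have "4 * p * (p * x\<^sup>2 + (1 - q) * x - p) = (2 * p * x)\<^sup>2 + 2 * (1 - q) * (2 * p * x) - 4 * p\<^sup>2"
      by (simp add: power2_eq_square algebra_simps)
    also have "\<dots> = 0" unfolding px using r by (simp add: power2_eq_square algebra_simps)
    finally have "p * x\<^sup>2 + (1 - q) * x - p = 0" using False by simp
    then have "x * (1 - q) + (x\<^sup>2 - 1) * p = 0" by Groebner_Basis.algebra
    moreover have "x\<^sup>2 + 1\<^sup>2 > 0" by (simp add: add_nonneg_pos)
    ultimately have "x\<^sup>2 + 1\<^sup>2 > 0 \<and> x * 1 * (1 - q) + (x\<^sup>2 - 1\<^sup>2) * p = 0" by simp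
    then show ?thesis by blast
  qed
  then obtain x s :: real where xs: "x\<^sup>2 + s\<^sup>2 > 0" "x * s * (1 - q) + (x\<^sup>2 - s\<^sup>2) * p = 0" by blast
  let ?M2 = "mob x s (- s) x"
  have D2: "x * x - s * (- s) > 0" using xs(1) by (simp add: power2_eq_square)
  have iUH: "\<i> \<in> UH" by simp
  have M2i: "?M2 \<i> = \<i>"
    using denom_nonzero[OF D2 iUH] unfolding mob_def by (simp add: divide_eq_eq algebra_simps)
  have "Re (?M2 ?w) = (x * s * (1 - q) + (x\<^sup>2 - s\<^sup>2) * p) / (cmod (of_real (- s) * ?w + of_real x))\<^sup>2"
    unfolding mob_def[of x] complex_div_cnj[of "of_real x * ?w + of_real s"] p_def q_def cmod_power2
    by (simp add: power2_eq_square algebra_simps)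
  then have re0: "Re (?M2 ?w) = 0" using xs(2) by simp
  define y where "y = Im (?M2 ?w)"
  have y: "0 < y" using mob_UH[OF D2 w1] by (simp add: y_def)
  have M2w: "?M2 ?w = \<i> * of_real y" using re0 by (simp add: complex_eq_iff y_def)
  have mM: "moebius (\<lambda>u. ?M2 (?M1 u))" by (rule moebius_comp[OF moebius_mob[OF D2] moebius_mob[OF D1]])
  have "?M2 ?w \<noteq> \<i>"
    using isom_inj[OF moebius_isom[OF mM] z w] ne M1z M2i by auto
  then have y1: "y \<noteq> 1" using M2w by auto
  show thesis
  proof (cases "1 < y")
    case True
    then show ?thesis using that[OF mM _ _ M2w] M1z M2i by simp
  next
    case False
    then have "1 < inverse y" using y y1 by (simp add: one_less_inverse)
    moreover have "moebius (\<lambda>u. mob 0 (-1) 1 0 (?M2 (?M1 u)))"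
      by (rule moebius_comp[OF moebius_mob mM]) simp
    moreover have "mob 0 (-1) 1 0 (?M2 (?M1 w)) = \<i> * of_real (inverse y)"
      unfolding M2w using y by (simp add: mob_def complex_eq_iff Re_divide Im_divide power2_eq_square field_simps)
    moreover have "mob 0 (-1) 1 0 (?M2 (?M1 z)) = \<i>" unfolding M1z M2i by (simp add: mob_def)
    ultimately show ?thesis using that by blast
  qed
qed

text \<open>
  The distances to two points of the imaginary axis determine a point up to reflection in this axis,
  so each point is fixed or reflected. A fixed and a reflected point off the axis cannot occur
  together, since the reflection changes their distance.
\<close>

lemma isom_on_fixing_axis:
  assumes f: "isom_on B f" and B: "B \<subseteq> UH" "\<i> \<in> B" "\<i> * of_real y \<in> B" and y: "1 < y"
    and fix1: "f \<i> = \<i>" "f (\<i> * of_real y) = \<i> * of_real y"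
  shows "(\<forall>z\<in>B. f z = z) \<or> (\<forall>z\<in>B. f z = - cnj z)"
proof -
  have either: "f z = z \<or> f z = - cnj z" if z: "z \<in> B" for z
  proof -
    define u v u' v' where d: "u = Re z" "v = Im z" "u' = Re (f z)" "v' = Im (f z)"
    have pos: "0 < v" "0 < v'" using f B z unfolding isom_on_def d by auto
    have "chord (f z) (f \<i>) = chord z \<i>" "chord (f z) (f (\<i> * of_real y)) = chord z (\<i> * of_real y)"
      using f B z unfolding isom_on_def by auto
    then have ch: "chord (f z) \<i> = chord z \<i>" "chord (f z) (\<i> * of_real y) = chord z (\<i> * of_real y)"
      unfolding fix1 by simp_all
    have UH: "f z \<in> UH" "z \<in> UH" "\<i> \<in> UH" "\<i> * of_real y \<in> UH" using pos d y by simp_all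
    have e: "(u'\<^sup>2 + (v' - 1)\<^sup>2) * v = (u\<^sup>2 + (v - 1)\<^sup>2) * v'"
      "(u'\<^sup>2 + (v' - y)\<^sup>2) * v = (u\<^sup>2 + (v - y)\<^sup>2) * v'"
      using chord_eqD[OF ch(1) UH(1-3)] chord_eqD[OF ch(2) UH(1,2,4)] by (simp_all add: d)
    have "(y - 1) * (y + 1) * (v - v') = 0" using e by Groebner_Basis.algebra
    then have v: "v' = v" using y by simp
    have "(u'\<^sup>2 - u\<^sup>2) * v = 0" using e(1) unfolding v by (simp add: algebra_simps)
    then have "u'\<^sup>2 = u\<^sup>2" using pos by simp
    then have "u' = u \<or> u' = - u" by (simp add: power2_eq_iff)
    then show ?thesis using v d by (auto simp: complex_eq_iff)
  qed
  show ?thesis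
  proof (rule ccontr)
    assume "\<not> ?thesis"
    then obtain z w where z: "z \<in> B" "f z = z" "z \<noteq> - cnj z" and w: "w \<in> B" "f w = - cnj w" "w \<noteq> - cnj w"
      using either by metis
    have "chord (- cnj w) z = chord w z" using f z w unfolding isom_on_def by metis
    moreover have "0 < Im z" "0 < Im w" using B z w by auto
    ultimately have "(- Re w - Re z)\<^sup>2 = (Re w - Re z)\<^sup>2" unfolding chord_Re_Im by (simp add: field_simps)
    then have "Re w * Re z = 0" by (simp add: power2_eq_iff)
    then show False using z w by (auto simp: complex_eq_iff)
  qed
qed

text \<open>
  Moving two points and their images to the imaginary axis reduces the claim to
  \<open>isom_on_fixing_axis\<close>. So every isometric embedding of a set with at least two points is the
  restriction of a Moebius transformation or of the composition of one with the reflection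
  \<open>z \<mapsto> - cnj z\<close>.
\<close>

lemma isom_on_extends:
  assumes f: "isom_on B f" and B: "B \<subseteq> UH" "z \<in> B" "w \<in> B" "z \<noteq> w"
  obtains A where "moebius A \<or> antimoebius A" "\<And>u. u \<in> B \<Longrightarrow> f u = A u"
proof -
  have fUH: "f u \<in> UH" if "u \<in> B" for u using f that by (auto simp: isom_on_def)
  have fch: "chord (f u) (f v) = chord u v" if "u \<in> B" "v \<in> B" for u v using f that by (auto simp: isom_on_def)
  have zw: "z \<in> UH" "w \<in> UH" using B by blast+
  have "chord (f z) (f w) \<noteq> 0" using fch[OF B(2,3)] chord_eq_0[OF zw] B(4) by simp
  then have ne: "f z \<noteq> f w" using chord_eq_0 fUH B by metis
  obtain M y where M: "moebius M" "M z = \<i>" "1 < y" "M w = \<i> * of_real y"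
    using moebius_to_axis[OF zw B(4)] by blast
  obtain N y' where N: "moebius N" "N (f z) = \<i>" "1 < y'" "N (f w) = \<i> * of_real y'"
    using moebius_to_axis[OF fUH[OF B(2)] fUH[OF B(3)] ne] by blast
  note iM = moebius_isom[OF M(1)] and iN = moebius_isom[OF N(1)]
  have "chord \<i> (\<i> * of_real y) = chord \<i> (\<i> * of_real y')"
    using isom_chord[OF iM zw] isom_chord[OF iN fUH[OF B(2)] fUH[OF B(3)]] fch[OF B(2,3)] M N by simp
  then have "(1 - y)\<^sup>2 * y' = (1 - y')\<^sup>2 * y" unfolding chord_Re_Im using M N by (simp add: field_simps)
  then have "(y - y') * (y * y' - 1) = 0" by Groebner_Basis.algebra
  moreover have "y * y' > 1" using M(3) N(3) less_1_mult by blast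
  ultimately have y': "y' = y" by simp
  obtain M' where M': "moebius M'" "\<And>z. z \<in> UH \<Longrightarrow> M' (M z) = z" "\<And>z. z \<in> UH \<Longrightarrow> M (M' z) = z"
    using moebius_inverse[OF M(1)] by blast
  obtain N' where N': "moebius N'" "\<And>z. z \<in> UH \<Longrightarrow> N' (N z) = z" "\<And>z. z \<in> UH \<Longrightarrow> N (N' z) = z"
    using moebius_inverse[OF N(1)] by blast
  let ?g = "\<lambda>u. N (f (M' u))"
  have gM: "?g (M u) = N (f u)" if "u \<in> B" for u using M'(2) B(1) that by (simp add: subset_iff)
  have "isom_on (M ` B) ?g"
    unfolding isom_on_def
  proof (intro conjI ballI)
    show "?g ` M ` B \<subseteq> UH" using gM isom_UH[OF iN fUH] by (auto simp: image_subset_iff)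
    fix u v assume "u \<in> M ` B" "v \<in> M ` B"
    then obtain u0 v0 where uv: "u = M u0" "v = M v0" "u0 \<in> B" "v0 \<in> B" by blast
    have "u0 \<in> UH" "v0 \<in> UH" using uv B by blast+
    then show "chord (?g u) (?g v) = chord u v"
      using gM[OF uv(3)] gM[OF uv(4)] isom_chord[OF iN fUH[OF uv(3)] fUH[OF uv(4)]] fch[OF uv(3,4)]
        isom_chord[OF iM] uv by simp
  qed
  moreover have "M ` B \<subseteq> UH" using isom_UH[OF iM] B by blast
  moreover have "\<i> \<in> M ` B" "\<i> * of_real y \<in> M ` B" using M B by (metis image_eqI)+
  moreover have "?g \<i> = \<i>" "?g (\<i> * of_real y) = \<i> * of_real y"
    using gM[OF B(2)] gM[OF B(3)] M N y' by simp_all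
  ultimately have "(\<forall>z\<in>M ` B. ?g z = z) \<or> (\<forall>z\<in>M ` B. ?g z = - cnj z)"
    using isom_on_fixing_axis M(3) by blast
  then consider "\<forall>u\<in>B. N (f u) = M u" | "\<forall>u\<in>B. N (f u) = - cnj (M u)" using gM by auto
  then show thesis
  proof cases
    case 1
    have "f u = N' (M u)" if "u \<in> B" for u using 1 N'(2)[OF fUH[OF that]] that by force
    then show ?thesis using that[of "\<lambda>u. N' (M u)"] moebius_comp[OF N'(1) M(1)] by blast
  next
    case 2
    have *: "f u = N' (- cnj (M u))" if "u \<in> B" for u using 2 N'(2)[OF fUH[OF that]] that by force
    obtain a b c d where D: "a * d - b * c > 0" "\<forall>z\<in>UH. M z = mob a b c d z"
      using M(1) unfolding moebius_def by blast
    have D2: "a * d - (-b) * (-c) > 0" using D by simp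
    have "- cnj (M u) = mob a (-b) (-c) d (- cnj u)" if "u \<in> UH" for u
    proof -
      have "- cnj (mob a b c d u) = (- (of_real a * cnj u + of_real b)) / (of_real c * cnj u + of_real d)"
      proof -
        have "- cnj (mob a b c d u) = - ((of_real a * cnj u + of_real b) / (of_real c * cnj u + of_real d))"
          by (simp add: mob_def)
        then show ?thesis unfolding minus_divide_left .
      qed
      also have "\<dots> = mob a (-b) (-c) d (- cnj u)" by (simp add: mob_def)
      finally show ?thesis using D(2) that by simp
    qed
    then have f: "f u = N' (mob a (-b) (-c) d (- cnj u))" if "u \<in> B" for u using * that B(1) by auto
    have "moebius (\<lambda>u. N' (mob a (-b) (-c) d u))" using moebius_comp[OF N'(1) moebius_mob[OF D2]] .
    then obtain a' b' c' d' where E: "a' * d' - b' * c' > 0"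
      "\<forall>z\<in>UH. N' (mob a (-b) (-c) d z) = mob a' b' c' d' z"
      unfolding moebius_def by blast
    have "antimoebius (\<lambda>u. N' (mob a (-b) (-c) d (- cnj u)))"
      unfolding antimoebius_def using E by (intro exI[of _ a'] exI[of _ b'] exI[of _ c'] exI[of _ d']) simp
    then show ?thesis using that[of "\<lambda>u. N' (mob a (-b) (-c) d (- cnj u))"] f by blast
  qed
qed

lemma isom_form:
  assumes "isom A"
  shows "moebius A \<or> antimoebius A"
proof -
  have "isom_on UH A" using assms by (simp add: isom_def)
  then obtain C where C: "moebius C \<or> antimoebius C" "\<And>u. u \<in> UH \<Longrightarrow> A u = C u"
    using isom_on_extends[of UH A \<i> "2 * \<i>"] by (auto simp: complex_eq_iff)
  then show ?thesis unfolding moebius_def antimoebius_def by auto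
qed

text \<open>
  After moving \<open>z\<close> and \<open>w\<close> to the imaginary axis, their distance is the difference of the logarithms
  of the imaginary parts, and this difference is a lower bound for the distance of any two
  points.
\<close>

lemma hyp_dist_triangle:
  assumes z: "z \<in> UH" and w: "w \<in> UH" and u: "u \<in> UH"
  shows "hyp_dist z w \<le> hyp_dist z u + hyp_dist u w"
proof (cases "z = w")
  case True
  then show ?thesis using hyp_dist_nonneg assms by simp
next
  case False
  obtain M y where M: "moebius M" "M z = \<i>" "1 < y" "M w = \<i> * of_real y"
    using moebius_to_axis[OF z w False] by blast
  note iM = moebius_isom[OF M(1)]
  have vert: "\<bar>ln (Im p) - ln (Im q)\<bar> \<le> hyp_dist p q" if p: "p \<in> UH" and q: "q \<in> UH" for p q
  proof -
    have "cosh \<bar>ln (Im p) - ln (Im q)\<bar> = 1 + (Im p - Im q)\<^sup>2 / (Im p * Im q) / 2"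
      using p q by (simp add: cosh_field_def exp_diff exp_minus field_simps power2_eq_square abs_if)
    also have "\<dots> \<le> 1 + chord p q / 2"
      unfolding chord_Re_Im using p q by (simp add: divide_right_mono)
    also have "\<dots> = cosh (hyp_dist p q)" using cosh_hyp_dist[OF p q] by simp
    finally show ?thesis using hyp_dist_nonneg[OF p q] by (smt (verit, ccfv_SIG) cosh_real_nonneg_le_iff)
  qed
  have MU: "M z \<in> UH" "M w \<in> UH" "M u \<in> UH" using isom_UH[OF iM] assms by auto
  have "hyp_dist z w = hyp_dist (\<i> * of_real (exp 0)) (\<i> * of_real (exp (ln y)))"
    using isom_dist[OF iM z w] M by simp
  also have "\<dots> = \<bar>ln (Im (M z)) - ln (Im (M w))\<bar>" unfolding hyp_dist_vertical using M by simp
  also have "\<dots> \<le> hyp_dist (M z) (M u) + hyp_dist (M u) (M w)"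
    using vert[OF MU(1,3)] vert[OF MU(3,2)] by linarith
  also have "\<dots> = hyp_dist z u + hyp_dist u w" using isom_dist[OF iM] assms by simp
  finally show ?thesis .
qed

section \<open>The developing map of a complete hyperbolic surface\<close>

lemma isom_preimage_ball:
  assumes A: "isom A" and a: "a \<in> UH"
  obtains b where "b \<in> UH" "{u\<in>UH. A u \<in> hyp_ball a r} = hyp_ball b r"
proof -
  obtain B where B: "isom B" "\<And>z. z \<in> UH \<Longrightarrow> A (B z) = z" using isom_inverse[OF A] by metis
  have b: "B a \<in> UH" using isom_UH[OF B(1) a] .
  have "{u\<in>UH. A u \<in> hyp_ball a r} = hyp_ball (B a) r"
    using isom_hyp_ball[OF A b] B(2)[OF a] hyp_ball_subset_UH by fastforce
  then show ?thesis using that b by blast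
qed

lemma continuous_isom: "isom A \<Longrightarrow> continuous_map (top_of_set UH) (top_of_set UH) A"
  using continuous_on_isom isom_UH by (auto simp: continuous_map_in_subtopology)

locale hyperbolic_surface =
  fixes S :: "'a topology" and \<rho> :: "'a \<Rightarrow> 'a \<Rightarrow> real"
  assumes hyperbolic: "complete_hyperbolic_metric S \<rho>" and connected: "connected_space S"
begin

sublocale Metric_space "topspace S" \<rho>
  using hyperbolic unfolding complete_hyperbolic_metric_def by blast

lemma mtopology_eq: "mtopology = S"
  using hyperbolic unfolding complete_hyperbolic_metric_def by blast

lemma mcomplete_S: "mcomplete"
  using hyperbolic unfolding complete_hyperbolic_metric_def by blast

text \<open>
  Charts are used as parametrizations by hyperbolic balls, the inverses of the maps in the definition
  of a hyperbolic metric.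
\<close>

definition chart :: "'a \<Rightarrow> real \<Rightarrow> complex \<Rightarrow> (complex \<Rightarrow> 'a) \<Rightarrow> bool" where
  "chart x r a \<psi> \<longleftrightarrow> x \<in> topspace S \<and> 0 < r \<and> a \<in> UH \<and> \<psi> a = x \<and> \<psi> ` hyp_ball a r = mball x r \<and>
     (\<forall>u\<in>hyp_ball a r. \<forall>v\<in>hyp_ball a r. \<rho> (\<psi> u) (\<psi> v) = hyp_dist u v)"

lemma chartD:
  assumes "chart x r a \<psi>"
  shows "x \<in> topspace S" "0 < r" "a \<in> UH" "\<psi> a = x" "\<psi> ` hyp_ball a r = mball x r"
    "u \<in> hyp_ball a r \<Longrightarrow> v \<in> hyp_ball a r \<Longrightarrow> \<rho> (\<psi> u) (\<psi> v) = hyp_dist u v"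
  using assms unfolding chart_def by auto

lemma chart_exists:
  assumes x: "x \<in> topspace S"
  obtains r a \<psi> where "chart x r a \<psi>"
proof -
  obtain r \<phi> where r: "r > 0" "0 < Im (\<phi> x)" "\<phi> ` mball x r = hyp_ball (\<phi> x) r"
    "\<And>y z. y \<in> mball x r \<Longrightarrow> z \<in> mball x r \<Longrightarrow> hyp_dist (\<phi> y) (\<phi> z) = \<rho> y z"
    using hyperbolic x unfolding complete_hyperbolic_metric_def by blast
  have inj: "inj_on \<phi> (mball x r)"
  proof (rule inj_onI)
    fix y z assume yz: "y \<in> mball x r" "z \<in> mball x r" "\<phi> y = \<phi> z"
    then have "\<rho> y z = 0" using r(4)[of y z] by simp
    then show "y = z" using yz by simp
  qed
  define \<psi> where "\<psi> = inv_into (mball x r) \<phi>"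
  have 1: "\<psi> (\<phi> y) = y" if "y \<in> mball x r" for y
    unfolding \<psi>_def using inj that by (rule inv_into_f_f)
  have "chart x r (\<phi> x) \<psi>"
    unfolding chart_def
  proof (intro conjI ballI)
    show "\<psi> (\<phi> x) = x" using 1 x r by simp
    show "\<psi> ` hyp_ball (\<phi> x) r = mball x r" unfolding r(3)[symmetric] using 1 by (auto simp: image_iff)
    fix u v assume "u \<in> hyp_ball (\<phi> x) r" "v \<in> hyp_ball (\<phi> x) r"
    then obtain y z where "y \<in> mball x r" "z \<in> mball x r" "u = \<phi> y" "v = \<phi> z"
      unfolding r(3)[symmetric] by blast
    then show "\<rho> (\<psi> u) (\<psi> v) = hyp_dist u v" using 1 r(4) by simp
  qed (use x r in auto)
  then show ?thesis using that by blast
qed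

lemma chart_inj:
  assumes "chart x r a \<psi>" "u \<in> hyp_ball a r" "v \<in> hyp_ball a r" "\<psi> u = \<psi> v"
  shows "u = v"
proof -
  have "\<psi> u \<in> topspace S" using chartD(5)[OF assms(1)] assms(2) by auto
  then have "hyp_dist u v = 0" using chartD(6)[OF assms(1-3)] assms(4) by simp
  then show ?thesis using hyp_dist_eq_0 assms(2,3) hyp_ball_subset_UH by blast
qed

definition isometric_near :: "(complex \<Rightarrow> 'a) \<Rightarrow> complex \<Rightarrow> bool" where
  "isometric_near f z \<longleftrightarrow> (\<exists>N. open N \<and> z \<in> N \<and> N \<subseteq> UH \<and> f ` N \<subseteq> topspace S \<and>
     (\<forall>u\<in>N. \<forall>v\<in>N. \<rho> (f u) (f v) = hyp_dist u v))"

lemma isometric_nearI: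
  "open N \<Longrightarrow> z \<in> N \<Longrightarrow> N \<subseteq> UH \<Longrightarrow> (\<And>u. u \<in> N \<Longrightarrow> f u \<in> topspace S) \<Longrightarrow>
    (\<And>u v. u \<in> N \<Longrightarrow> v \<in> N \<Longrightarrow> \<rho> (f u) (f v) = hyp_dist u v) \<Longrightarrow> isometric_near f z"
  unfolding isometric_near_def by blast

lemma isometric_nearE:
  assumes "isometric_near f z"
  obtains N where "open N" "z \<in> N" "N \<subseteq> UH" "\<And>u. u \<in> N \<Longrightarrow> f u \<in> topspace S"
    "\<And>u v. u \<in> N \<Longrightarrow> v \<in> N \<Longrightarrow> \<rho> (f u) (f v) = hyp_dist u v"
  using assms unfolding isometric_near_def by blast

lemma isometric_near_topspace: "isometric_near f z \<Longrightarrow> f z \<in> topspace S"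
  unfolding isometric_near_def by blast

text \<open>
  In a chart a local isometry becomes an isometric embedding of a small ball into the hyperbolic
  plane, so it is the restriction of a global isometry. This rigidity is behind both the uniqueness
  and the extension of local isometries.
\<close>

lemma isometric_near_chart:
  assumes f: "isometric_near f z" and ch: "chart x r a \<psi>" and fz: "f z \<in> mball x r"
  obtains A where "isom A" "A z \<in> hyp_ball a r" "eventually (\<lambda>u. f u = \<psi> (A u)) (nhds z)"
proof -
  obtain N where N: "open N" "z \<in> N" "N \<subseteq> UH" "\<And>u. u \<in> N \<Longrightarrow> f u \<in> topspace S"
    "\<And>u v. u \<in> N \<Longrightarrow> v \<in> N \<Longrightarrow> \<rho> (f u) (f v) = hyp_dist u v"
    using f isometric_nearE by metis
  have z: "z \<in> UH" using N by blast
  obtain s where s: "s > 0" "hyp_ball z s \<subseteq> N" using hyp_ball_in_open[OF z N(1,2)] by blast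
  define s' where "s' = min s (r - \<rho> x (f z))"
  have s': "s' > 0" using s fz by (simp add: s'_def)
  let ?B = "hyp_ball z s'"
  have BN: "?B \<subseteq> N" using s(2) unfolding s'_def hyp_ball_def by auto
  have zB: "z \<in> ?B" using centre_in_hyp_ball[OF z s'] .
  have fB: "f u \<in> mball x r" if u: "u \<in> ?B" for u
  proof -
    have uN: "u \<in> N" using BN u by blast
    have "\<rho> (f z) (f u) < s'" using N(5)[OF N(2) uN] u by (simp add: hyp_ball_def)
    moreover have "f u \<in> topspace S" using N(4) BN u by blast
    ultimately show ?thesis using triangle[of x "f z" "f u"] fz by (auto simp: s'_def)
  qed
  define g where "g u = inv_into (hyp_ball a r) \<psi> (f u)" for u
  have g: "g u \<in> hyp_ball a r" "\<psi> (g u) = f u" if "u \<in> ?B" for u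
  proof -
    have "f u \<in> \<psi> ` hyp_ball a r" using fB[OF that] chartD(5)[OF ch] by simp
    then show "g u \<in> hyp_ball a r" "\<psi> (g u) = f u" unfolding g_def by (simp_all add: inv_into_into f_inv_into_f)
  qed
  have BUH: "?B \<subseteq> UH" by (rule hyp_ball_subset_UH)
  have gUH: "g u \<in> UH" if "u \<in> ?B" for u using g(1)[OF that] hyp_ball_subset_UH by blast
  have "isom_on ?B g"
    unfolding isom_on_def
  proof (intro conjI ballI)
    show "g ` ?B \<subseteq> UH" using gUH by blast
    fix u v assume uv: "u \<in> ?B" "v \<in> ?B"
    have "hyp_dist (g u) (g v) = \<rho> (f u) (f v)"
      using chartD(6)[OF ch g(1)[OF uv(1)] g(1)[OF uv(2)]] g(2) uv by simp
    also have "\<dots> = hyp_dist u v" using N(5) uv BN by blast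
    finally have "hyp_dist (g u) (g v) = hyp_dist u v" .
    then show "chord (g u) (g v) = chord u v"
      using hyp_dist_eq_iff[of "g u" "g v" u v] gUH uv BUH by blast
  qed
  moreover obtain w where "w \<in> ?B" "w \<noteq> z"
  proof -
    obtain e where e: "e > 0" "ball z e \<subseteq> ?B" using openE[OF open_hyp_ball[OF z s'] zB] by blast
    have "z + of_real (e / 2) \<in> ball z e" using e by (simp add: dist_norm)
    then show ?thesis using e that[of "z + of_real (e / 2)"] by auto
  qed
  ultimately obtain A where A: "moebius A \<or> antimoebius A" "\<And>u. u \<in> ?B \<Longrightarrow> g u = A u"
    using isom_on_extends[of ?B g z w] BUH zB by metis
  have "isom A" using A moebius_isom antimoebius_isom by blast
  moreover have "A z \<in> hyp_ball a r" using g(1)[OF zB] A(2)[OF zB] by simp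
  moreover have "eventually (\<lambda>u. f u = \<psi> (A u)) (nhds z)"
    unfolding eventually_nhds using open_hyp_ball[OF z s'] zB g(2) A(2) by (intro exI[of _ ?B]) auto
  ultimately show ?thesis using that by blast
qed

lemma chart_isometric_near:
  assumes ch: "chart x r a \<psi>" and A: "isom A" and z: "z \<in> UH" "A z \<in> hyp_ball a r"
  shows "isometric_near (\<lambda>u. \<psi> (A u)) z"
proof -
  obtain b where b: "b \<in> UH" "{u\<in>UH. A u \<in> hyp_ball a r} = hyp_ball b r"
    using isom_preimage_ball[OF A chartD(3)[OF ch]] by metis
  show ?thesis
  proof (rule isometric_nearI[of "{u\<in>UH. A u \<in> hyp_ball a r}"])
    show "open {u \<in> UH. A u \<in> hyp_ball a r}" unfolding b(2) using open_hyp_ball[OF b(1) chartD(2)[OF ch]] .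
    fix u v assume u: "u \<in> {u \<in> UH. A u \<in> hyp_ball a r}"
    then show "\<psi> (A u) \<in> topspace S" using chartD(5)[OF ch] by auto
    assume v: "v \<in> {u \<in> UH. A u \<in> hyp_ball a r}"
    show "\<rho> (\<psi> (A u)) (\<psi> (A v)) = hyp_dist u v"
      using chartD(6)[OF ch] isom_dist[OF A] u v by simp
  qed (use z in auto)
qed

lemma chart_isom_unique:
  assumes ch: "chart x r a \<psi>" and A: "isom A" and B: "isom B"
    and z: "z \<in> UH" "A z \<in> hyp_ball a r" "B z \<in> hyp_ball a r"
    and eq: "eventually (\<lambda>u. \<psi> (A u) = \<psi> (B u)) (nhds z)" and w: "w \<in> UH"
  shows "A w = B w"
proof (rule isom_eqI[OF A B z(1) _ w])
  have op: "open (hyp_ball a r)" using open_hyp_ball chartD(2,3)[OF ch] by blast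
  show "\<forall>\<^sub>F u in nhds z. A u = B u"
    using isom_nbhd[OF A z(1) op z(2)] isom_nbhd[OF B z(1) op z(3)] eq
    by eventually_elim (use chart_inj[OF ch] in blast)
qed

lemma isometric_near_limit:
  assumes z: "z \<in> UH" and f: "isometric_near f z" and g: "isometric_near g z"
    and fr: "frequently (\<lambda>y. eventually (\<lambda>u. f u = g u) (nhds y)) (nhds z)"
  shows "eventually (\<lambda>u. f u = g u) (nhds z)"
proof -
  obtain N where N: "open N" "z \<in> N" "N \<subseteq> UH" "\<And>u. u \<in> N \<Longrightarrow> f u \<in> topspace S"
    "\<And>u v. u \<in> N \<Longrightarrow> v \<in> N \<Longrightarrow> \<rho> (f u) (f v) = hyp_dist u v"
    using f isometric_nearE by metis
  obtain M where M: "open M" "z \<in> M" "M \<subseteq> UH" "\<And>u. u \<in> M \<Longrightarrow> g u \<in> topspace S"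
    "\<And>u v. u \<in> M \<Longrightarrow> v \<in> M \<Longrightarrow> \<rho> (g u) (g v) = hyp_dist u v"
    using g isometric_nearE by metis
  have fz: "f z \<in> topspace S" and gz: "g z \<in> topspace S" using N M by auto
  have fg: "f z = g z"
  proof (rule ccontr)
    assume "f z \<noteq> g z"
    then have d: "\<rho> (f z) (g z) > 0" using fz gz by simp
    let ?U = "N \<inter> M \<inter> hyp_ball z (\<rho> (f z) (g z) / 2)"
    have "open ?U" "z \<in> ?U" using N(1,2) M(1,2) d open_hyp_ball[OF z] centre_in_hyp_ball[OF z] by auto
    then have "eventually (\<lambda>u. u \<in> ?U) (nhds z)" unfolding eventually_nhds by blast
    from frequently_ex[OF frequently_eventually_conj[OF fr this]]
    obtain u where u: "u \<in> ?U" "f u = g u" using eventually_nhds_x_imp_x by auto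
    have "\<rho> (f z) (g z) \<le> \<rho> (f z) (f u) + \<rho> (g u) (g z)"
      using triangle[of "f z" "f u" "g z"] u N M by auto
    also have "\<dots> = hyp_dist z u + hyp_dist u z" using N(5)[of z u] M(5)[of u z] u N(2) M(2) by auto
    also have "\<dots> < \<rho> (f z) (g z)" using u hyp_dist_commute[of u z] by (auto simp: hyp_ball_def)
    finally show False by simp
  qed
  obtain r a \<psi> where ch: "chart (f z) r a \<psi>" using chart_exists[OF fz] by blast
  have c: "f z \<in> mball (f z) r" using chartD(1,2)[OF ch] by simp
  obtain A where A: "isom A" "A z \<in> hyp_ball a r" "eventually (\<lambda>u. f u = \<psi> (A u)) (nhds z)"
    using isometric_near_chart[OF f ch c] by blast
  obtain B where B: "isom B" "B z \<in> hyp_ball a r" "eventually (\<lambda>u. g u = \<psi> (B u)) (nhds z)"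
    using isometric_near_chart[OF g ch] c fg by metis
  have op: "open (hyp_ball a r)" using open_hyp_ball chartD(2,3)[OF ch] by blast
  have "eventually (\<lambda>y. eventually (\<lambda>u. f u = \<psi> (A u)) (nhds y) \<and> eventually (\<lambda>u. g u = \<psi> (B u)) (nhds y) \<and>
      (y \<in> UH \<and> A y \<in> hyp_ball a r) \<and> (y \<in> UH \<and> B y \<in> hyp_ball a r)) (nhds z)"
    using iffD2[OF eventually_eventually A(3)] iffD2[OF eventually_eventually B(3)]
      isom_nbhd[OF A(1) z op A(2)] isom_nbhd[OF B(1) z op B(2)]
    by eventually_elim blast
  from frequently_ex[OF frequently_eventually_conj[OF fr this]]
  obtain y where y: "eventually (\<lambda>u. f u = \<psi> (A u)) (nhds y)" "eventually (\<lambda>u. g u = \<psi> (B u)) (nhds y)"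
    "y \<in> UH" "A y \<in> hyp_ball a r" "B y \<in> hyp_ball a r" "eventually (\<lambda>u. f u = g u) (nhds y)"
    by blast
  have "eventually (\<lambda>u. \<psi> (A u) = \<psi> (B u)) (nhds y)"
    using y(1,2,6) by eventually_elim simp
  then have AB: "A w = B w" if "w \<in> UH" for w
    using chart_isom_unique[OF ch A(1) B(1) y(3-5)] that by blast
  have "eventually (\<lambda>u. u \<in> UH) (nhds z)" using open_UH z unfolding eventually_nhds by blast
  then show ?thesis using A(3) B(3) by eventually_elim (simp add: AB)
qed

text \<open>
  A local isometry is Lipschitz along the segment, so its values converge towards the end point by
  completeness of \<open>S\<close>. Once a value is within half the radius of a chart around the limit, and the
  rest of the segment is shorter than the other half, the isometry given by
  \<open>isometric_near_chart\<close> continues the map through the rest of the segment.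
\<close>

lemma isometric_near_extend:
  assumes x: "x \<in> UH" and w: "w \<in> UH"
    and f: "\<And>t. 0 \<le> t \<Longrightarrow> t < 1 \<Longrightarrow> isometric_near f (x + t *\<^sub>R (w - x))"
  shows "\<exists>g t. 0 \<le> t \<and> t < 1 \<and> eventually (\<lambda>u. f u = g u) (nhds (x + t *\<^sub>R (w - x))) \<and>
        (\<forall>s. t \<le> s \<and> s \<le> (1::real) \<longrightarrow> isometric_near g (x + s *\<^sub>R (w - x)))"
proof -
  let ?p = "\<lambda>t::real. x + t *\<^sub>R (w - x)"
  define m where "m = min (Im x) (Im w)"
  have m: "0 < m" using x w by (simp add: m_def)
  have pm: "m \<le> Im (?p t)" if "0 \<le> t" "t \<le> 1" for t
  proof -
    have "Im (?p t) = (1 - t) * Im x + t * Im w" by (simp add: algebra_simps)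
    moreover have "(1 - t) * m \<le> (1 - t) * Im x" "t * m \<le> t * Im w"
      using that by (auto simp: m_def intro!: mult_left_mono)
    ultimately show ?thesis by (simp add: algebra_simps)
  qed
  have pUH: "?p t \<in> UH" if "0 \<le> t" "t \<le> 1" for t using pm[OF that] m by simp
  define K where "K = cmod (w - x) / m"
  have K: "0 \<le> K" using m by (simp add: K_def)
  have lip: "hyp_dist (?p s) (?p t) \<le> K * (t - s)" if "0 \<le> s" "s \<le> t" "t \<le> 1" for s t
  proof -
    have "?p s - ?p t = (s - t) *\<^sub>R (w - x)" by (simp add: algebra_simps)
    then have "cmod (?p s - ?p t) = (t - s) * cmod (w - x)" using that by (metis abs_minus_commute abs_of_nonneg diff_ge_0_iff_ge norm_scaleR)
    then show ?thesis using hyp_dist_Lipschitz[OF m pm[of s] pm[of t]] that by (simp add: K_def mult.commute)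
  qed
  have flip: "\<rho> (f (?p s)) (f (?p t)) \<le> K * (t - s)" if st: "0 \<le> s" "s \<le> t" "t < 1" for s t
  proof -
    have "s \<le> s \<and> t \<le> t \<longrightarrow> \<rho> (f (?p s)) (f (?p t)) \<le> K * (t - s)"
    proof (rule Bolzano[OF st(2), of "\<lambda>a b. s \<le> a \<and> b \<le> t \<longrightarrow> \<rho> (f (?p a)) (f (?p b)) \<le> K * (b - a)"])
      fix a b c
      assume tr: "s \<le> a \<and> b \<le> t \<longrightarrow> \<rho> (f (?p a)) (f (?p b)) \<le> K * (b - a)"
        "s \<le> b \<and> c \<le> t \<longrightarrow> \<rho> (f (?p b)) (f (?p c)) \<le> K * (c - b)" "a \<le> b" "b \<le> c"
      show "s \<le> a \<and> c \<le> t \<longrightarrow> \<rho> (f (?p a)) (f (?p c)) \<le> K * (c - a)"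
      proof
        assume ac: "s \<le> a \<and> c \<le> t"
        have "f (?p q) \<in> topspace S" if "q \<in> {a, b, c}" for q
          using that isometric_near_topspace[OF f[of q]] ac tr(3,4) st by auto
        then have "\<rho> (f (?p a)) (f (?p c)) \<le> \<rho> (f (?p a)) (f (?p b)) + \<rho> (f (?p b)) (f (?p c))"
          by (intro triangle) simp_all
        also have "\<dots> \<le> K * (b - a) + K * (c - b)" using tr ac by (intro add_mono) auto
        finally show "\<rho> (f (?p a)) (f (?p c)) \<le> K * (c - a)" by (simp add: algebra_simps)
      qed
    next
      fix q assume "s \<le> q" "q \<le> t"
      then have q: "0 \<le> q" "q < 1" using st by auto
      obtain N where N: "open N" "?p q \<in> N" "N \<subseteq> UH"
        "\<And>u v. u \<in> N \<Longrightarrow> v \<in> N \<Longrightarrow> \<rho> (f u) (f v) = hyp_dist u v"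
        using isometric_nearE[OF f[OF q]] by metis
      have "open (?p -` N)" using N(1) by (intro open_vimage continuous_intros)
      then obtain d where d: "d > 0" "ball q d \<subseteq> ?p -` N" using openE[of "?p -` N" q] N(2) by auto
      have "\<rho> (f (?p a)) (f (?p b)) \<le> K * (b - a)"
        if "a \<le> q" "q \<le> b" "b - a < d" "s \<le> a" "b \<le> t" for a b
      proof -
        have "a \<in> ball q d" "b \<in> ball q d" using that by (auto simp: dist_real_def)
        then have "?p a \<in> N" "?p b \<in> N" using d(2) by auto
        then have "\<rho> (f (?p a)) (f (?p b)) = hyp_dist (?p a) (?p b)" using N(4) by blast
        then show ?thesis using lip[of a b] that st by simp
      qed
      then show "\<exists>d>0. \<forall>a b. a \<le> q \<and> q \<le> b \<and> b - a < d \<longrightarrow>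
          s \<le> a \<and> b \<le> t \<longrightarrow> \<rho> (f (?p a)) (f (?p b)) \<le> K * (b - a)" using d(1) by blast
    qed
    then show ?thesis by simp
  qed
  define \<tau> where "\<tau> n = 1 - inverse (real (Suc n))" for n
  have \<tau>: "0 \<le> \<tau> n" "\<tau> n < 1" for n by (simp_all add: \<tau>_def inverse_le_1_iff)
  have \<tau>mono: "\<tau> m \<le> \<tau> n" if "m \<le> n" for m n
    unfolding \<tau>_def using that by (simp add: le_imp_inverse_le)
  have \<tau>lim: "\<tau> \<longlonglongrightarrow> 1"
    unfolding \<tau>_def using tendsto_diff[OF tendsto_const[of "1::real"] LIMSEQ_inverse_real_of_nat] by simp
  define \<sigma> where "\<sigma> n = f (?p (\<tau> n))" for n
  have \<sigma>S: "\<sigma> n \<in> topspace S" for n unfolding \<sigma>_def using isometric_near_topspace[OF f[OF \<tau>]] .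
  have ev: "\<exists>N. \<forall>n\<ge>N. K * (1 - \<tau> n) < e" if "e > 0" for e
  proof -
    have "(\<lambda>n. K * (1 - \<tau> n)) \<longlonglongrightarrow> K * (1 - 1)" by (intro tendsto_intros \<tau>lim)
    then have "eventually (\<lambda>n. K * (1 - \<tau> n) < e) sequentially"
      using that by (intro order_tendstoD(2)) auto
    then show ?thesis by (simp add: eventually_sequentially)
  qed
  have \<sigma>d: "\<rho> (\<sigma> m) (\<sigma> n) < e" if "m \<le> n" "K * (1 - \<tau> m) < e" for m n e
  proof -
    have "\<rho> (\<sigma> m) (\<sigma> n) \<le> K * (\<tau> n - \<tau> m)" unfolding \<sigma>_def using flip \<tau> \<tau>mono that by blast
    also have "\<dots> \<le> K * (1 - \<tau> m)" using K \<tau>(2)[of n] by (intro mult_left_mono) auto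
    finally show ?thesis using that by simp
  qed
  have "MCauchy \<sigma>"
    unfolding MCauchy_def
  proof (intro conjI allI impI)
    show "range \<sigma> \<subseteq> topspace S" using \<sigma>S by blast
    fix e :: real assume "e > 0"
    then obtain N where N: "\<forall>n\<ge>N. K * (1 - \<tau> n) < e" using ev by blast
    show "\<exists>N. \<forall>n n'. N \<le> n \<longrightarrow> N \<le> n' \<longrightarrow> \<rho> (\<sigma> n) (\<sigma> n') < e"
    proof (intro exI[of _ N] allI impI)
      fix n n' assume "N \<le> n" "N \<le> n'"
      then show "\<rho> (\<sigma> n) (\<sigma> n') < e"
        using N \<sigma>d[of n n' e] \<sigma>d[of n' n e] commute[of "\<sigma> n" "\<sigma> n'"] by (cases "n \<le> n'") auto
    qed
  qed
  then obtain y where y: "limitin mtopology \<sigma> y sequentially" using mcomplete_S unfolding mcomplete_def by blast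
  then have yS: "y \<in> topspace S" using limitin_mspace by blast
  obtain r a \<psi> where ch: "chart y r a \<psi>" using chart_exists[OF yS] by blast
  note r = chartD(2)[OF ch] and a = chartD(3)[OF ch]
  have "\<exists>N. \<forall>n\<ge>N. \<sigma> n \<in> topspace S \<and> \<rho> (\<sigma> n) y < r / 2"
    using y r unfolding limit_metric_sequentially by (meson half_gt_zero)
  then obtain N1 where N1: "\<And>n. n \<ge> N1 \<Longrightarrow> \<rho> (\<sigma> n) y < r / 2" by blast
  obtain N2 where N2: "\<And>n. n \<ge> N2 \<Longrightarrow> K * (1 - \<tau> n) < r / 2" using ev[of "r / 2"] r by auto
  define t where "t = \<tau> (max N1 N2)"
  have t: "0 \<le> t" "t < 1" using \<tau> by (simp_all add: t_def)
  have ty: "\<rho> y (f (?p t)) < r / 2" using N1[of "max N1 N2"] commute by (simp add: t_def \<sigma>_def)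
  have tK: "K * (1 - t) < r / 2" using N2[of "max N1 N2"] by (simp add: t_def)
  have fpt: "f (?p t) \<in> mball y r"
    using ty r yS isometric_near_topspace[OF f[OF t]] by simp
  obtain A where A: "isom A" "A (?p t) \<in> hyp_ball a r" "eventually (\<lambda>u. f u = \<psi> (A u)) (nhds (?p t))"
    using isometric_near_chart[OF f[OF t] ch fpt] by blast
  have aA: "hyp_dist a (A (?p t)) < r / 2"
  proof -
    have "f (?p t) = \<psi> (A (?p t))" using A(3) by (rule eventually_nhds_x_imp_x)
    then have "hyp_dist a (A (?p t)) = \<rho> y (f (?p t))"
      using chartD(6)[OF ch centre_in_hyp_ball[OF a r] A(2)] chartD(4)[OF ch] by simp
    then show ?thesis using ty by simp
  qed
  have "isometric_near (\<lambda>u. \<psi> (A u)) (?p s)" if s: "t \<le> s" "s \<le> 1" for s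
  proof (rule chart_isometric_near[OF ch A(1)])
    have p: "?p s \<in> UH" "?p t \<in> UH" using pUH s t by auto
    show "?p s \<in> UH" by (rule p)
    have "hyp_dist (A (?p t)) (A (?p s)) \<le> K * (s - t)" using isom_dist[OF A(1) p(2,1)] lip s t by simp
    also have "\<dots> \<le> K * (1 - t)" using K s by (intro mult_left_mono) auto
    finally have "hyp_dist a (A (?p s)) < r"
      using aA tK hyp_dist_triangle[OF a isom_UH[OF A(1) p(1)] isom_UH[OF A(1) p(2)]] by linarith
    then show "A (?p s) \<in> hyp_ball a r" using isom_UH[OF A(1) p(1)] by (simp add: hyp_ball_def)
  qed
  then show ?thesis using t A(3) by (intro exI[of _ "\<lambda>u. \<psi> (A u)"] exI[of _ t]) auto
qed

sublocale continuation UH isometric_near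
proof
  fix x f assume x: "x \<in> UH" and f: "isometric_near f x"
  obtain N where N: "open N" "x \<in> N" "N \<subseteq> UH" "\<And>u. u \<in> N \<Longrightarrow> f u \<in> topspace S"
    "\<And>u v. u \<in> N \<Longrightarrow> v \<in> N \<Longrightarrow> \<rho> (f u) (f v) = hyp_dist u v"
    using f isometric_nearE by metis
  have "isometric_near f y" if "y \<in> N" for y by (rule isometric_nearI[of N]) (use N that in auto)
  then show "eventually (isometric_near f) (nhds x)" unfolding eventually_nhds using N(1,2) by blast
  fix g
  show "isometric_near g x" if eq: "\<forall>\<^sub>F y in nhds x. f y = g y"
  proof -
    obtain M where M: "open M" "x \<in> M" "\<forall>y\<in>M. f y = g y" using eq unfolding eventually_nhds by blast
    show ?thesis by (rule isometric_nearI[of "N \<inter> M"]) (use N M in \<open>auto simp flip: M(3)\<close>)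
  qed
qed (use open_UH convex_UH isometric_near_limit isometric_near_extend in blast)+

text \<open>
  The developing maps of \<open>S\<close>. They are not unique: precomposition with an isometry of the hyperbolic
  plane gives another one, and this freedom is used to normalise deck transformations.
\<close>

definition developing :: "(complex \<Rightarrow> 'a) \<Rightarrow> bool" where
  "developing f \<longleftrightarrow> (\<forall>z\<in>UH. isometric_near f z)"

lemma developing_exists:
  assumes "topspace S \<noteq> {}"
  obtains f where "developing f"
proof -
  obtain x where "x \<in> topspace S" using assms by blast
  then obtain r a \<psi> where ch: "chart x r a \<psi>" using chart_exists by metis
  have "isometric_near \<psi> a"
    using chart_isometric_near[OF ch isom_id chartD(3)[OF ch]] centre_in_hyp_ball chartD(2,3)[OF ch] by simp
  then show ?thesis using monodromy[OF chartD(3)[OF ch]] that unfolding developing_def by blast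
qed

lemma developing_comp:
  assumes f: "developing f" and A: "isom A"
  shows "developing (\<lambda>z. f (A z))"
  unfolding developing_def
proof
  fix z assume z: "z \<in> UH"
  then have "isometric_near f (A z)" using f isom_UH[OF A z] by (simp add: developing_def)
  then obtain N where N: "open N" "A z \<in> N" "N \<subseteq> UH" "\<And>u. u \<in> N \<Longrightarrow> f u \<in> topspace S"
    "\<And>u v. u \<in> N \<Longrightarrow> v \<in> N \<Longrightarrow> \<rho> (f u) (f v) = hyp_dist u v"
    using isometric_nearE by metis
  obtain M where M: "open M" "z \<in> M" "\<forall>u\<in>M. u \<in> UH \<and> A u \<in> N"
    using isom_nbhd[OF A z N(1,2)] unfolding eventually_nhds by blast
  show "isometric_near (\<lambda>z. f (A z)) z"
    by (rule isometric_nearI[of M]) (use M N isom_dist[OF A] in auto)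
qed

lemma developing_unique:
  assumes "developing f" "developing g" "a \<in> UH" "eventually (\<lambda>u. f u = g u) (nhds a)" "z \<in> UH"
  shows "f z = g z"
  using unique_on_connected[of UH f g a z] assms convex_connected[OF convex_UH] by (auto simp: developing_def)

text \<open>
  The whole preimage of a chart ball under the isometry is mapped as in the chart, since it is
  connected and the two local isometries agree near \<open>z\<close>. These balls will be the sheets over the
  chart.
\<close>

lemma developing_sheet:
  assumes f: "developing f" and ch: "chart x r a \<psi>" and z: "z \<in> UH" "f z \<in> mball x r"
  obtains A where "isom A" "A z \<in> hyp_ball a r" "\<And>u. u \<in> UH \<Longrightarrow> A u \<in> hyp_ball a r \<Longrightarrow> f u = \<psi> (A u)"
proof -
  obtain A where A: "isom A" "A z \<in> hyp_ball a r" "eventually (\<lambda>u. f u = \<psi> (A u)) (nhds z)"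
    using isometric_near_chart[of f z x r a \<psi>] ch z(2) f z(1) unfolding developing_def by blast
  obtain b where b: "b \<in> UH" "{u\<in>UH. A u \<in> hyp_ball a r} = hyp_ball b r"
    using isom_preimage_ball[OF A(1) chartD(3)[OF ch]] by metis
  have "f u = \<psi> (A u)" if u: "u \<in> UH" "A u \<in> hyp_ball a r" for u
  proof (rule unique_on_connected[of "{u\<in>UH. A u \<in> hyp_ball a r}" f "\<lambda>u. \<psi> (A u)" z u])
    show "connected {u \<in> UH. A u \<in> hyp_ball a r}"
      unfolding b(2) using convex_hyp_ball[OF b(1) chartD(2)[OF ch]] by (rule convex_connected)
    show "isometric_near f v" if "v \<in> {u \<in> UH. A u \<in> hyp_ball a r}" for v
      using f that by (simp add: developing_def)
    show "isometric_near (\<lambda>u. \<psi> (A u)) v" if "v \<in> {u \<in> UH. A u \<in> hyp_ball a r}" for v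
      using chart_isometric_near[OF ch A(1)] that by simp
  qed (use A z u in auto)
  then show ?thesis using that A by blast
qed

lemma developing_continuous:
  assumes f: "developing f"
  shows "continuous_map (top_of_set UH) S f"
proof -
  have "continuous_map (top_of_set UH) mtopology f"
    unfolding continuous_map_to_metric
  proof (intro ballI allI impI)
    fix z e assume "z \<in> topspace (top_of_set UH)" and e: "(0::real) < e"
    then have z: "z \<in> UH" by simp
    obtain N where N: "open N" "z \<in> N" "N \<subseteq> UH" "\<And>u. u \<in> N \<Longrightarrow> f u \<in> topspace S"
      "\<And>u v. u \<in> N \<Longrightarrow> v \<in> N \<Longrightarrow> \<rho> (f u) (f v) = hyp_dist u v"
      using f z isometric_nearE unfolding developing_def by metis
    let ?U = "N \<inter> hyp_ball z e"
    have "open ?U" using N(1) open_hyp_ball[OF z e] by blast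
    then have "openin (top_of_set UH) ?U" using N(3) by (simp add: open_openin_trans open_subset le_infI1)
    moreover have "z \<in> ?U" using N(2) centre_in_hyp_ball[OF z e] by simp
    moreover have "f y \<in> mball (f z) e" if "y \<in> ?U" for y
      using that N by (simp add: hyp_ball_def)
    ultimately show "\<exists>U. openin (top_of_set UH) U \<and> z \<in> U \<and> (\<forall>y\<in>U. f y \<in> mball (f z) e)" by blast
  qed
  then show ?thesis by (simp add: mtopology_eq)
qed

text \<open>
  Every chart ball is evenly covered: its preimage is a union of hyperbolic balls of the same radius,
  and two of these that meet come from the same isometry. In particular the image is open, and so is
  its complement, whence the map is onto by connectedness.
\<close>

lemma developing_covering:
  assumes f: "developing f"
  shows "covering_map (top_of_set UH) S f"
  unfolding covering_map_def
proof (intro conjI ballI)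
  show cont: "continuous_map (top_of_set UH) S f" by (rule developing_continuous[OF f])
  have mballs: "mball x r \<subseteq> f ` UH" if ch: "chart x r a \<psi>" and z: "z \<in> UH" "f z \<in> mball x r" for x r a \<psi> z
  proof
    fix y assume "y \<in> mball x r"
    then obtain v where v: "v \<in> hyp_ball a r" "y = \<psi> v" using chartD(5)[OF ch] by blast
    obtain A where A: "isom A" "\<And>u. u \<in> UH \<Longrightarrow> A u \<in> hyp_ball a r \<Longrightarrow> f u = \<psi> (A u)"
      using developing_sheet[OF f ch z] by metis
    obtain B where B: "isom B" "\<And>z. z \<in> UH \<Longrightarrow> A (B z) = z" using isom_inverse[OF A(1)] by metis
    have vU: "v \<in> UH" using v hyp_ball_subset_UH by blast
    then have "f (B v) = y" using A(2)[of "B v"] isom_UH[OF B(1) vU] B(2)[OF vU] v by simp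
    then show "y \<in> f ` UH" using isom_UH[OF B(1) vU] by blast
  qed
  have fS: "f ` UH \<subseteq> topspace S" using cont by (auto simp: continuous_map_def)
  show "f ` topspace (top_of_set UH) = topspace S"
  proof -
    have "openin S (f ` UH)"
    proof (subst openin_subopen, intro ballI)
      fix x assume x: "x \<in> f ` UH"
      then have xS: "x \<in> topspace S" using fS by blast
      then obtain r a \<psi> where ch: "chart x r a \<psi>" using chart_exists by metis
      have "x \<in> mball x r" using chartD(2)[OF ch] xS by simp
      moreover have "openin S (mball x r)" using openin_mball by (simp add: mtopology_eq)
      ultimately show "\<exists>T. openin S T \<and> x \<in> T \<and> T \<subseteq> f ` UH" using mballs[OF ch] x by blast
    qed
    moreover have "openin S (topspace S - f ` UH)"
    proof (subst openin_subopen, intro ballI)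
      fix x assume x: "x \<in> topspace S - f ` UH"
      then obtain r a \<psi> where ch: "chart x r a \<psi>" using chart_exists by blast
      have "x \<in> mball x r" using chartD(2)[OF ch] x by simp
      moreover have "openin S (mball x r)" using openin_mball by (simp add: mtopology_eq)
      moreover have "mball x r \<inter> f ` UH = {}" using mballs[OF ch] x \<open>x \<in> mball x r\<close> by blast
      moreover have "mball x r \<subseteq> topspace S" by (rule mball_subset_mspace)
      ultimately show "\<exists>T. openin S T \<and> x \<in> T \<and> T \<subseteq> topspace S - f ` UH" by blast
    qed
    then have "closedin S (f ` UH)" using fS by (simp add: closedin_def)
    moreover have "f ` UH \<noteq> {}" using in_UH[of \<i>] by fastforce
    ultimately have "f ` UH = topspace S" using connected unfolding connected_space_clopen_in by blast
    then show ?thesis by simp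
  qed
  fix x assume x: "x \<in> topspace S"
  then obtain r a \<psi> where ch: "chart x r a \<psi>" using chart_exists by metis
  note r = chartD(2)[OF ch] and a = chartD(3)[OF ch]
  let ?W = "\<lambda>A. {u\<in>UH. A u \<in> hyp_ball a r}"
  define \<V> where "\<V> = {V. \<exists>A. isom A \<and> V = ?W A \<and> (\<forall>u\<in>V. f u = \<psi> (A u))}"
  have openW: "open (?W A)" if "isom A" for A
    using isom_preimage_ball[OF that a, of r] open_hyp_ball r by metis
  show "\<exists>U. openin S U \<and> x \<in> U \<and> (\<exists>\<V>. \<Union>\<V> = {x' \<in> topspace (top_of_set UH). f x' \<in> U} \<and> pairwise disjnt \<V> \<and>
             (\<forall>V\<in>\<V>. openin (top_of_set UH) V \<and>
                homeomorphic_map (subtopology (top_of_set UH) V) (subtopology S U) f))"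
  proof (intro exI[of _ "mball x r"] conjI exI[of _ \<V>] ballI)
    show "openin S (mball x r)" using openin_mball by (simp add: mtopology_eq)
    show "x \<in> mball x r" using r x by simp
    show "\<Union> \<V> = {x' \<in> topspace (top_of_set UH). f x' \<in> mball x r}"
    proof (intro subset_antisym subsetI)
      fix z assume "z \<in> \<Union> \<V>"
      then obtain A where "isom A" "z \<in> UH" "A z \<in> hyp_ball a r" "f z = \<psi> (A z)" unfolding \<V>_def by blast
      then show "z \<in> {x' \<in> topspace (top_of_set UH). f x' \<in> mball x r}" using chartD(5)[OF ch] by auto
    next
      fix z assume "z \<in> {x' \<in> topspace (top_of_set UH). f x' \<in> mball x r}"
      then have z: "z \<in> UH" "f z \<in> mball x r" by auto
      then obtain A where "isom A" "A z \<in> hyp_ball a r" "\<And>u. u \<in> UH \<Longrightarrow> A u \<in> hyp_ball a r \<Longrightarrow> f u = \<psi> (A u)"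
        using developing_sheet[OF f ch] by metis
      then have "?W A \<in> \<V>" "z \<in> ?W A" using z unfolding \<V>_def by auto
      then show "z \<in> \<Union> \<V>" by blast
    qed
    show "pairwise disjnt \<V>"
      unfolding pairwise_def
    proof (intro ballI impI)
      fix V V' assume V: "V \<in> \<V>" "V' \<in> \<V>" "V \<noteq> V'"
      obtain A where A: "isom A" "V = ?W A" "\<forall>u\<in>V. f u = \<psi> (A u)" using V unfolding \<V>_def by blast
      obtain B where B: "isom B" "V' = ?W B" "\<forall>u\<in>V'. f u = \<psi> (B u)" using V unfolding \<V>_def by blast
      show "disjnt V V'"
      proof (rule ccontr)
        assume "\<not> disjnt V V'"
        then obtain u where u: "u \<in> V" "u \<in> V'" by (auto simp: disjnt_def)
        have "open (V \<inter> V')" using openW[OF A(1)] openW[OF B(1)] A(2) B(2) by blast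
        then have "eventually (\<lambda>u. \<psi> (A u) = \<psi> (B u)) (nhds u)"
          unfolding eventually_nhds using u A(3) B(3) by (intro exI[of _ "V \<inter> V'"]) (metis IntD1 IntD2 IntI)
        then have "A w = B w" if "w \<in> UH" for w
          using chart_isom_unique[OF ch A(1) B(1)] u A(2) B(2) that by blast
        then have "V = V'" using A(2) B(2) by auto
        then show False using V by blast
      qed
    qed
    fix V assume "V \<in> \<V>"
    then obtain A where A: "isom A" "V = ?W A" "\<forall>u\<in>V. f u = \<psi> (A u)" unfolding \<V>_def by blast
    have oV: "open V" using openW[OF A(1)] A(2) by simp
    have VU: "V \<subseteq> UH" using A(2) by blast
    then show "openin (top_of_set UH) V" using oV by (simp add: open_subset)
    obtain B where B: "isom B" "\<And>z. z \<in> UH \<Longrightarrow> A (B z) = z" using isom_inverse[OF A(1)] by metis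
    have sub: "subtopology (top_of_set UH) V = top_of_set V" using VU by (simp add: subtopology_subtopology inf.absorb2)
    have dist: "\<rho> (f u) (f v) = hyp_dist u v" if "u \<in> V" "v \<in> V" for u v
      using chartD(6)[OF ch] isom_dist[OF A(1)] A that by simp
    have onto: "\<exists>u\<in>V. f u = y" if y: "y \<in> mball x r" for y
    proof -
      obtain v where v: "v \<in> hyp_ball a r" "y = \<psi> v" using chartD(5)[OF ch] y by blast
      have vU: "v \<in> UH" using v hyp_ball_subset_UH by blast
      have "B v \<in> V" using A(2) B(2)[OF vU] isom_UH[OF B(1) vU] v by simp
      then show ?thesis using A(3) B(2)[OF vU] v by metis
    qed
    have into: "f u \<in> mball x r" if "u \<in> V" for u using chartD(5)[OF ch] A that by auto
    have top1: "topspace (top_of_set V) = V" and top2: "topspace (subtopology S (mball x r)) = mball x r"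
      using mball_subset_mspace by auto
    have "homeomorphic_map (top_of_set V) (subtopology S (mball x r)) f"
    proof (rule bijective_open_imp_homeomorphic_map)
      show "continuous_map (top_of_set V) (subtopology S (mball x r)) f"
        using continuous_map_from_subtopology_mono[OF cont VU] into by (auto simp: continuous_map_in_subtopology)
      show "f ` topspace (top_of_set V) = topspace (subtopology S (mball x r))"
        unfolding top1 top2 using onto into by blast
      show "inj_on f (topspace (top_of_set V))"
        unfolding top1
      proof (rule inj_onI)
        fix u v assume uv: "u \<in> V" "v \<in> V" "f u = f v"
        have "f u \<in> topspace S" using into[OF uv(1)] by simp
        then have "hyp_dist u v = 0" using dist[OF uv(1,2)] uv(3) by simp
        then show "u = v" using hyp_dist_eq_0 uv VU by blast
      qed
      show "open_map (top_of_set V) (subtopology S (mball x r)) f"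
        unfolding open_map_def
      proof (intro allI impI)
        fix Q assume "openin (top_of_set V) Q"
        then have Q: "open Q" "Q \<subseteq> V" using oV by (auto simp: openin_open_eq)
        have "openin mtopology (f ` Q)"
          unfolding openin_mtopology
        proof (intro conjI allI impI)
          show "f ` Q \<subseteq> topspace S" using Q into mball_subset_mspace by blast
          fix y assume "y \<in> f ` Q"
          then obtain z where z: "z \<in> Q" "y = f z" by blast
          have zU: "z \<in> UH" using z Q VU by blast
          obtain s where s: "s > 0" "hyp_ball z s \<subseteq> Q" using hyp_ball_in_open[OF zU Q(1) z(1)] by blast
          have yr: "y \<in> mball x r" using into z Q by blast
          define s' where "s' = min s (r - \<rho> x y)"
          have "s' > 0" using s yr by (simp add: s'_def)
          moreover have "mball y s' \<subseteq> f ` Q"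
          proof
            fix y' assume y': "y' \<in> mball y s'"
            then have "\<rho> x y' < r" using triangle[of x y y'] yr by (auto simp: s'_def)
            then have "y' \<in> mball x r" using y' x by simp
            then obtain u where u: "u \<in> V" "f u = y'" using onto by blast
            have "u \<in> UH" using u(1) VU by blast
            moreover have "hyp_dist z u < s" using dist[of z u] u z Q y' by (auto simp: s'_def)
            ultimately have "u \<in> hyp_ball z s" by (simp add: hyp_ball_def)
            then have "u \<in> Q" using s(2) by blast
            then show "y' \<in> f ` Q" using u by blast
          qed
          ultimately show "\<exists>r>0. mball y r \<subseteq> f ` Q" by blast
        qed
        then have "openin S (f ` Q)" by (simp add: mtopology_eq)
        moreover have "f ` Q \<subseteq> mball x r" using Q into by blast
        ultimately show "openin (subtopology S (mball x r)) (f ` Q)"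
          by (simp add: openin_subset_topspace_eq openin_subtopology) (metis inf.absorb1)
      qed
    qed
    then show "homeomorphic_map (subtopology (top_of_set UH) V) (subtopology S (mball x r)) f"
      unfolding sub .
  qed
qed

text \<open>
  If \<open>A1\<close> and \<open>A2\<close> describe \<open>f\<close> in the same chart near \<open>z\<close> and near \<open>w\<close>, then the isometry
  \<open>A2\<^sup>-\<^sup>1 A1\<close> preserves \<open>f\<close> near \<open>z\<close>, hence everywhere.
\<close>

lemma developing_deck:
  assumes f: "developing f" and z: "z \<in> UH" and w: "w \<in> UH" and eq: "f z = f w"
  obtains A where "isom A" "A z = w" "\<And>u. u \<in> UH \<Longrightarrow> f (A u) = f u"
proof -
  have fz: "f z \<in> topspace S" using f z isometric_near_topspace by (simp add: developing_def)
  then obtain r a \<psi> where ch: "chart (f z) r a \<psi>" using chart_exists by metis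
  have c: "f z \<in> mball (f z) r" "f w \<in> mball (f z) r" using chartD(2)[OF ch] fz eq by auto
  obtain A1 where A1: "isom A1" "A1 z \<in> hyp_ball a r" "\<And>u. u \<in> UH \<Longrightarrow> A1 u \<in> hyp_ball a r \<Longrightarrow> f u = \<psi> (A1 u)"
    using developing_sheet[OF f ch z c(1)] by blast
  obtain A2 where A2: "isom A2" "A2 w \<in> hyp_ball a r" "\<And>u. u \<in> UH \<Longrightarrow> A2 u \<in> hyp_ball a r \<Longrightarrow> f u = \<psi> (A2 u)"
    using developing_sheet[OF f ch w c(2)] by blast
  have A12: "A1 z = A2 w" using chart_inj[OF ch A1(2) A2(2)] A1(3)[OF z A1(2)] A2(3)[OF w A2(2)] eq by simp
  obtain B where B: "isom B" "\<And>z. z \<in> UH \<Longrightarrow> B (A2 z) = z" "\<And>z. z \<in> UH \<Longrightarrow> A2 (B z) = z"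
    using isom_inverse[OF A2(1)] by blast
  let ?A = "\<lambda>u. B (A1 u)"
  have A: "isom ?A" by (rule isom_comp[OF B(1) A1(1)])
  have op: "open (hyp_ball a r)" using open_hyp_ball chartD(2,3)[OF ch] by blast
  have "eventually (\<lambda>u. f (?A u) = f u) (nhds z)"
    using isom_nbhd[OF A1(1) z op A1(2)]
  proof eventually_elim
    case (elim u)
    then have u: "u \<in> UH" "A1 u \<in> hyp_ball a r" by auto
    have "A2 (?A u) = A1 u" using B(3)[OF isom_UH[OF A1(1) u(1)]] .
    then have "f (?A u) = \<psi> (A1 u)" using A2(3)[OF isom_UH[OF A u(1)]] u(2) by simp
    then show ?case using A1(3)[OF u] by simp
  qed
  then have "f (?A u) = f u" if "u \<in> UH" for u
    using developing_unique[OF developing_comp[OF f A] f z _ that] by simp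
  moreover have "?A z = w" using A12 B(2)[OF w] by simp
  ultimately show ?thesis using that[OF A] by blast
qed

lemma developing_locally_inj:
  assumes f: "developing f" and z: "z \<in> UH"
  shows "eventually (\<lambda>u. f u = f z \<longrightarrow> u = z) (nhds z)"
proof -
  obtain N where N: "open N" "z \<in> N" "N \<subseteq> UH" "\<And>u. u \<in> N \<Longrightarrow> f u \<in> topspace S"
    "\<And>u v. u \<in> N \<Longrightarrow> v \<in> N \<Longrightarrow> \<rho> (f u) (f v) = hyp_dist u v"
    using f z isometric_nearE unfolding developing_def by metis
  have "u = z" if "u \<in> N" "f u = f z" for u
  proof -
    have "hyp_dist u z = 0" using N(5)[OF that(1) N(2)] N(4)[OF N(2)] that(2) by simp
    then show ?thesis using hyp_dist_eq_0 N(2,3) that(1) by blast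
  qed
  then show ?thesis unfolding eventually_nhds using N(1,2) by blast
qed

text \<open>
  Deck transformations act freely: two of them that agree at a point are lifts of the same map with
  the same value there.
\<close>

lemma deck_free:
  assumes f: "developing f" and A: "isom A" "\<And>u. u \<in> UH \<Longrightarrow> f (A u) = f u"
    and B: "isom B" "\<And>u. u \<in> UH \<Longrightarrow> f (B u) = f u" and z: "z \<in> UH" "A z = B z" and u: "u \<in> UH"
  shows "A u = B u"
  by (rule covering_lift_unique[OF developing_covering[OF f] open_UH convex_UH continuous_isom[OF A(1)]
      continuous_isom[OF B(1)] _ z u]) (simp add: A B)

end

section \<open>Fixed points, axes and parabolic isometries\<close>

lemma isom_affine: "0 < a \<Longrightarrow> isom (\<lambda>z. of_real a * z + of_real b)"
  by (rule isom_cong[OF isom_mob[of a 1 b 0]]) (simp_all add: mob_def)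

text \<open>
  In suitable coordinates the isometry is a dilation or a glide reflection along the imaginary axis.
  The case \<open>l = 1\<close> of the identity and the reflection is not excluded.
\<close>

definition axial :: "(complex \<Rightarrow> complex) \<Rightarrow> bool" where
  "axial A \<longleftrightarrow> (\<exists>M l. isom M \<and> 0 < l \<and>
     ((\<forall>z\<in>UH. A (M z) = M (of_real l * z)) \<or> (\<forall>z\<in>UH. A (M z) = M (- of_real l * cnj z))))"

definition parabolic :: "(complex \<Rightarrow> complex) \<Rightarrow> bool" where
  "parabolic A \<longleftrightarrow> (\<exists>M. isom M \<and> ((\<forall>z\<in>UH. A (M z) = M (z + 1)) \<or> (\<forall>z\<in>UH. A (M (z + 1)) = M z)))"

text \<open>
  An affine map with dilation factor different from 1 has a real fixed point, which can be moved
  to 0.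
\<close>

lemma classify_affine:
  assumes M: "isom M" and \<alpha>: "0 < \<alpha>" and A: "\<And>z. z \<in> UH \<Longrightarrow> A (M z) = M (of_real \<alpha> * z + of_real \<beta>)"
  shows "(\<exists>z\<in>UH. A z = z) \<or> axial A \<or> parabolic A"
proof (cases "\<alpha> = 1")
  case False
  define x where "x = \<beta> / (1 - \<alpha>)"
  have x: "\<alpha> * x + \<beta> = x" using False by (simp add: x_def field_simps)
  let ?M = "\<lambda>z. M (z + of_real x)"
  have "isom ?M" using isom_comp[OF M isom_affine[of 1 x]] by simp
  moreover have "A (?M z) = ?M (of_real \<alpha> * z)" if "z \<in> UH" for z
  proof -
    have "of_real \<alpha> * (z + of_real x) + of_real \<beta> = of_real \<alpha> * z + of_real (\<alpha> * x + \<beta>)"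
      by (simp add: algebra_simps)
    then show ?thesis using A[of "z + of_real x"] that unfolding x by simp
  qed
  ultimately show ?thesis unfolding axial_def using \<alpha> by blast
next
  case True
  consider "\<beta> = 0" | "\<beta> > 0" | "\<beta> < 0" by linarith
  then show ?thesis
  proof cases
    case 1
    then have "A (M \<i>) = M \<i>" using A[of \<i>] True by simp
    moreover have "M \<i> \<in> UH" using isom_UH[OF M, of \<i>] by simp
    ultimately show ?thesis by blast
  next
    case 2
    let ?M = "\<lambda>z. M (of_real \<beta> * z)"
    have "isom ?M" using isom_comp[OF M isom_affine[of \<beta> 0]] 2 by simp
    moreover have "A (?M z) = ?M (z + 1)" if "z \<in> UH" for z
      using A[of "of_real \<beta> * z"] that 2 True by (simp add: algebra_simps)
    ultimately show ?thesis unfolding parabolic_def by blast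
  next
    case 3
    let ?M = "\<lambda>z. M (of_real (-\<beta>) * z)"
    have "isom ?M" using isom_comp[OF M isom_affine[of "-\<beta>" 0]] 3 by simp
    moreover have "A (?M (z + 1)) = ?M z" if "z \<in> UH" for z
    proof -
      have "0 < Im (of_real (-\<beta>) * (z + 1))" using that 3 by (simp add: mult_neg_pos)
      then have "A (?M (z + 1)) = M (of_real \<alpha> * (of_real (-\<beta>) * (z + 1)) + of_real \<beta>)" using A by simp
      also have "of_real \<alpha> * (of_real (-\<beta>) * (z + 1)) + of_real \<beta> = of_real (-\<beta>) * z"
        using True by (simp add: algebra_simps)
      finally show ?thesis .
    qed
    ultimately show ?thesis unfolding parabolic_def by blast
  qed
qed

lemma classify_anti_affine:
  assumes M: "isom M" and \<alpha>: "0 < \<alpha>" and A: "\<And>z. z \<in> UH \<Longrightarrow> A (M z) = M (of_real \<alpha> * (- cnj z) + of_real \<beta>)"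
  shows "axial A"
proof -
  define x where "x = \<beta> / (1 + \<alpha>)"
  have x: "- \<alpha> * x + \<beta> = x" using \<alpha> by (simp add: x_def field_simps)
  let ?M = "\<lambda>z. M (z + of_real x)"
  have "isom ?M" using isom_comp[OF M isom_affine[of 1 x]] by simp
  moreover have "A (?M z) = ?M (- of_real \<alpha> * cnj z)" if "z \<in> UH" for z
  proof -
    have "of_real \<alpha> * (- cnj (z + of_real x)) + of_real \<beta> = - of_real \<alpha> * cnj z + of_real (- \<alpha> * x + \<beta>)"
      by (simp add: algebra_simps)
    then show ?thesis using A[of "z + of_real x"] that unfolding x by simp
  qed
  ultimately show ?thesis unfolding axial_def using \<alpha> by blast
qed

text \<open>
  If the real point \<open>s\<close> is sent to \<open>r\<close>, then in the coordinates \<open>s - 1 / y\<close> and \<open>r - 1 / y\<close> the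
  transformation fixes infinity, so it is affine. With \<open>s = r\<close> this treats Moebius transformations
  with a real fixed point, with \<open>s = - r\<close> those preceded by the reflection.
\<close>

lemma mob_conjugate_to_affine:
  assumes D: "0 < a * d - b * c" and k: "k = c * s + d" and fixed: "a * s + b = r * k" and y: "y \<in> UH"
  shows "mob a b c d (of_real s - 1 / y) =
    of_real r - 1 / (of_real (k\<^sup>2 / (a * d - b * c)) * y + of_real (- c * k / (a * d - b * c)))"
    and "0 < k\<^sup>2 / (a * d - b * c)"
proof -
  let ?D = "a * d - b * c"
  have kD: "k * (a - r * c) = ?D"
  proof -
    have "k * (a - r * c) = a * k - c * (r * k)" by (simp add: algebra_simps)
    also have "\<dots> = ?D" unfolding fixed[symmetric] unfolding k by (simp add: algebra_simps)
    finally show ?thesis .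
  qed
  have k0: "k \<noteq> 0" using kD D by auto
  then show "0 < k\<^sup>2 / ?D" using D by simp
  have y0: "y \<noteq> 0" using y by auto
  have nz: "of_real k * y - of_real c \<noteq> 0"
  proof
    assume "of_real k * y - of_real c = 0"
    then have "Im (of_real k * y - of_real c) = 0" by simp
    then show False using k0 y by simp
  qed
  have "of_real a * (of_real s - 1 / y) + of_real b = (of_real (a * s + b) * y - of_real a) / y"
    "of_real c * (of_real s - 1 / y) + of_real d = (of_real k * y - of_real c) / y"
    using y0 by (simp_all add: k field_simps)
  then have "mob a b c d (of_real s - 1 / y) = (of_real (r * k) * y - of_real a) / (of_real k * y - of_real c)"
    unfolding mob_def fixed using y0 by simp
  also have "\<dots> = of_real r - of_real (a - r * c) / (of_real k * y - of_real c)"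
    using nz by (simp add: field_simps)
  also have "a - r * c = ?D / k" using kD k0 by (simp add: field_simps)
  also have "of_real (?D / k) / (of_real k * y - of_real c)
    = 1 / (of_real (k\<^sup>2 / ?D) * y + of_real (- c * k / ?D))"
  proof -
    have "of_real (k\<^sup>2 / E) * y + of_real (- c * k / E) = of_real (k / E) * (of_real k * y - of_real c)" for E
      by (simp add: algebra_simps power2_eq_square)
    from this[of ?D] show ?thesis using k0 D by simp
  qed
  finally show "mob a b c d (of_real s - 1 / y) =
    of_real r - 1 / (of_real (k\<^sup>2 / ?D) * y + of_real (- c * k / ?D))" .
qed

lemma isom_inversion: "isom (\<lambda>z. of_real r - 1 / z)"
proof (rule isom_cong[OF isom_mob[of r 0 "-1" 1]])
  show "r * 0 - (-1) * 1 > (0::real)" by simp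
  fix z assume "z \<in> UH"
  then have "z \<noteq> 0" by auto
  then show "of_real r - 1 / z = mob r (-1) 1 0 z" by (simp add: mob_def field_simps)
qed

text \<open>
  Unless it is affine, the fixed points of a Moebius transformation are the roots of a real quadratic
  polynomial: they are not real and one of them lies in the half-plane, or there is a real one and the
  transformation is conjugate to an affine one. For orientation-reversing isometries the discriminant
  is always positive.
\<close>

lemma isom_classify:
  assumes "isom A"
  shows "(\<exists>z\<in>UH. A z = z) \<or> axial A \<or> parabolic A"
  using isom_form[OF assms]
proof
  assume "moebius A"
  then obtain a b c d where D: "a * d - b * c > 0" and A: "\<And>z. z \<in> UH \<Longrightarrow> A z = mob a b c d z"
    unfolding moebius_def by blast
  show ?thesis
  proof (cases "c = 0")
    case True
    then have ad: "a * d > 0" using D by simp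
    have "0 < a / d" using ad by (auto simp: zero_less_mult_iff zero_less_divide_iff)
    moreover have "A z = of_real (a / d) * z + of_real (b / d)" if "z \<in> UH" for z
      using A[OF that] True by (simp add: mob_def add_divide_distrib)
    ultimately show ?thesis using classify_affine[OF isom_id] by blast
  next
    case c: False
    define disc where "disc = (a - d)\<^sup>2 + 4 * b * c"
    show ?thesis
    proof (cases "disc < 0")
      case True
      define p q where "p = (a - d) / (2 * c)" and "q = sqrt (- disc) / (2 * \<bar>c\<bar>)"
      have q: "0 < q" using True c by (simp add: q_def)
      have q2: "q\<^sup>2 = - disc / (4 * c\<^sup>2)" using True by (simp add: q_def power_divide power_mult_distrib)
      have cp: "2 * c * p = a - d" using c by (simp add: p_def)
      have cq: "4 * c\<^sup>2 * q\<^sup>2 = - disc" using c by (simp add: q2)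
      have "4 * c * (c * (p\<^sup>2 - q\<^sup>2) + (d - a) * p - b) = (2 * c * p)\<^sup>2 - 4 * c\<^sup>2 * q\<^sup>2 + 2 * (d - a) * (2 * c * p) - 4 * b * c"
        by (simp add: power2_eq_square algebra_simps)
      also have "\<dots> = 0" unfolding cp cq disc_def by (simp add: power2_eq_square algebra_simps)
      finally have re: "c * (p\<^sup>2 - q\<^sup>2) + (d - a) * p - b = 0" using c by simp
      let ?z = "Complex p q"
      have z: "?z \<in> UH" using q by simp
      have "of_real a * ?z + of_real b = ?z * (of_real c * ?z + of_real d)"
      proof (rule complex_eqI)
        show "Re (of_real a * ?z + of_real b) = Re (?z * (of_real c * ?z + of_real d))"
          using re by (simp add: power2_eq_square algebra_simps)
        show "Im (of_real a * ?z + of_real b) = Im (?z * (of_real c * ?z + of_real d))"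
        proof -
          have "a = 2 * c * p + d" using cp by simp
          then show ?thesis by (simp add: algebra_simps)
        qed
      qed
      then have "mob a b c d ?z = ?z" using denom_nonzero[OF D z] unfolding mob_def by (simp add: field_simps)
      then show ?thesis using A[OF z] z by metis
    next
      case False
      define r where "r = ((a - d) + sqrt disc) / (2 * c)"
      have cr: "2 * c * r = (a - d) + sqrt disc" using c by (simp add: r_def)
      have "4 * c * (c * r\<^sup>2 + (d - a) * r - b) = (2 * c * r)\<^sup>2 + 2 * (d - a) * (2 * c * r) - 4 * b * c"
        by (simp add: power2_eq_square algebra_simps)
      also have "\<dots> = (sqrt disc)\<^sup>2 - disc" unfolding cr disc_def by (simp add: power2_eq_square algebra_simps)
      also have "\<dots> = 0" using False by simp
      finally have r: "c * r\<^sup>2 + (d - a) * r - b = 0" using c by simp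
      have "a * r + b = r * (c * r + d)" using r by (simp add: power2_eq_square algebra_simps)
      note conj = mob_conjugate_to_affine[OF D refl this]
      have pos: "0 < (c * r + d)\<^sup>2 / (a * d - b * c)" by (rule conj(2)[of \<i>]) simp
      have "A (of_real r - 1 / z) = of_real r - 1 / (of_real ((c * r + d)\<^sup>2 / (a * d - b * c)) * z
          + of_real (- c * (c * r + d) / (a * d - b * c)))" if z: "z \<in> UH" for z
        using A isom_UH[OF isom_inversion z] conj(1)[OF z] by metis
      then show ?thesis by (rule classify_affine[where M = "\<lambda>z. of_real r - 1 / z", OF isom_inversion pos])
    qed
  qed
next
  assume "antimoebius A"
  then obtain a b c d where D: "a * d - b * c > 0" and A: "\<And>z. z \<in> UH \<Longrightarrow> A z = mob a b c d (- cnj z)"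
    unfolding antimoebius_def by blast
  show ?thesis
  proof (cases "c = 0")
    case True
    then have ad: "a * d > 0" using D by simp
    have "0 < a / d" using ad by (auto simp: zero_less_mult_iff zero_less_divide_iff)
    moreover have "A z = of_real (a / d) * (- cnj z) + of_real (b / d)" if "z \<in> UH" for z
      using A[OF that] True by (simp add: mob_def add_divide_distrib diff_divide_distrib)
    ultimately show ?thesis using classify_anti_affine[OF isom_id] by blast
  next
    case c: False
    define disc where "disc = (a - d)\<^sup>2 + 4 * (a * d - b * c)"
    have disc: "0 \<le> disc" using D by (simp add: disc_def)
    define r where "r = ((a + d) + sqrt disc) / (2 * c)"
    have cr: "2 * c * r = (a + d) + sqrt disc" using c by (simp add: r_def)
    have "4 * c * (c * r\<^sup>2 - (a + d) * r + b) = (2 * c * r)\<^sup>2 - 2 * (a + d) * (2 * c * r) + 4 * b * c"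
      by (simp add: power2_eq_square algebra_simps)
    also have "\<dots> = (sqrt disc)\<^sup>2 - disc" unfolding cr disc_def by (simp add: power2_eq_square algebra_simps)
    also have "\<dots> = 0" using disc by simp
    finally have r: "c * r\<^sup>2 - (a + d) * r + b = 0" using c by simp
    have "a * (- r) + b = r * (c * (- r) + d)" using r by (simp add: power2_eq_square algebra_simps)
    note conj = mob_conjugate_to_affine[OF D refl this]
    have pos: "0 < (c * (- r) + d)\<^sup>2 / (a * d - b * c)" by (rule conj(2)[of \<i>]) simp
    have "A (of_real r - 1 / z) = of_real r - 1 / (of_real ((c * (- r) + d)\<^sup>2 / (a * d - b * c)) * (- cnj z)
        + of_real (- c * (c * (- r) + d) / (a * d - b * c)))" if z: "z \<in> UH" for z
    proof -
      have "- cnj (of_real r - 1 / z) = of_real (- r) - 1 / (- cnj z)" by simp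
      moreover have "- cnj z \<in> UH" using z by simp
      ultimately show ?thesis using A isom_UH[OF isom_inversion z] conj(1) by metis
    qed
    then have "axial A" by (rule classify_anti_affine[where M = "\<lambda>z. of_real r - 1 / z", OF isom_inversion pos])
    then show ?thesis by blast
  qed
qed

section \<open>Closed curves and their lifts\<close>

lemma cis_eq_cis: "cis s = cis t \<longleftrightarrow> (\<exists>n::int. s = t + 2 * pi * n)"
  using sin_cos_eq_iff[of s t] by (auto simp: complex_eq_iff)

lemma periodic_int:
  fixes g :: "real \<Rightarrow> 'b"
  assumes "\<And>t. g (t + 2 * pi) = g t"
  shows "g (t + 2 * pi * of_int n) = g t"
proof (induction n rule: int_induct[of _ 0])
  case (step1 i)
  then show ?case using assms[of "t + 2 * pi * of_int i"] by (simp add: algebra_simps)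
next
  case (step2 i)
  then show ?case using assms[of "t + 2 * pi * of_int (i - 1)"] by (simp add: algebra_simps)
qed simp

lemma cis_Arg_sphere: "z \<in> sphere 0 1 \<Longrightarrow> cis (Arg z) = z"
  by (subst cis_Arg) (auto simp: sgn_eq)

lemma periodic_Arg_cis:
  fixes g :: "real \<Rightarrow> 'b"
  assumes "\<And>t. g (t + 2 * pi) = g t"
  shows "g (Arg (cis t)) = g t"
proof -
  have "cis (Arg (cis t)) = cis t" by (rule cis_Arg_sphere) simp
  then show ?thesis unfolding cis_eq_cis using periodic_int[of g, OF assms] by auto
qed

text \<open>
  The map \<open>(s, t) \<mapsto> (s, cis t)\<close> is a quotient map on a compact strip, so a periodic family
  of paths descends to the circle. This avoids the discontinuity of \<open>Arg\<close>.
\<close>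

lemma continuous_map_circle_family:
  fixes G :: "real \<times> real \<Rightarrow> 'a"
  assumes G: "continuous_map (top_of_set (I \<times> UNIV)) S G" and I: "compact I"
    and per: "\<And>s t. s \<in> I \<Longrightarrow> G (s, t + 2 * pi) = G (s, t)"
  shows "continuous_map (prod_topology (top_of_set I) circle) S (\<lambda>(s, z). G (s, Arg z))"
proof (rule continuous_compose_quotient_map)
  let ?X = "I \<times> {-pi..pi}" and ?q = "\<lambda>(s, t). (s, cis t)"
  have top: "prod_topology (top_of_set I) circle = top_of_set (I \<times> sphere 0 1)"
    by (simp add: prod_topology_subtopology_eu)
  show "quotient_map (top_of_set ?X) (prod_topology (top_of_set I) circle) ?q"
    unfolding top
  proof (rule continuous_imp_quotient_map)
    show "continuous_map (top_of_set ?X) (top_of_set (I \<times> sphere 0 1)) ?q"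
      by (auto simp: continuous_map_in_subtopology case_prod_unfold intro!: continuous_intros)
    show "compact_space (top_of_set ?X)" using I by (simp add: compact_space_subtopology compact_Times)
    show "Hausdorff_space (top_of_set (I \<times> sphere (0::complex) 1))" by (simp add: Hausdorff_space_subtopology)
    have "(s, z) \<in> ?q ` ?X" if "s \<in> I" "z \<in> sphere 0 1" for s z
      using that Arg_bounded[of z] cis_Arg_sphere[of z] by (intro image_eqI[of _ _ "(s, Arg z)"]) auto
    then show "?q ` topspace (top_of_set ?X) = topspace (top_of_set (I \<times> sphere 0 1))" by auto
  qed
  have "continuous_map (top_of_set ?X) S G" by (rule continuous_map_from_subtopology_mono[OF G]) auto
  then show "continuous_map (top_of_set ?X) S ((\<lambda>(s, z). G (s, Arg z)) \<circ> ?q)"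
    by (rule continuous_map_eq) (auto simp: periodic_Arg_cis[of "\<lambda>t. G (_, t)", OF per])
qed

text \<open>
  Two closed curves whose lifts are equivariant under the same deck transformation \<open>A\<close> are freely
  homotopic: when \<open>A\<close> respects affine combinations, the straight-line homotopy of the lifts is
  equivariant again and descends.
\<close>

lemma straight_line_homotopy:
  assumes F: "continuous_map (top_of_set UH) S F"
    and u: "continuous_on UNIV u" "\<And>t. u t \<in> UH" "\<And>t. F (u t) = c (cis t)" "\<And>t. u (t + 2 * pi) = A (u t)"
    and v: "continuous_on UNIV v" "\<And>t. v t \<in> UH" "\<And>t. F (v t) = c' (cis t)" "\<And>t. v (t + 2 * pi) = A (v t)"
    and A: "\<And>z. z \<in> UH \<Longrightarrow> F (A z) = F z"
    and aff: "\<And>s z w. A (of_real (1 - s) * z + of_real s * w) = of_real (1 - s) * A z + of_real s * A w"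
  shows "freely_homotopic S c c'"
proof -
  let ?I = "{0..1::real}"
  let ?w = "\<lambda>x. of_real (1 - fst x) * u (snd x) + of_real (fst x) * v (snd x)"
  define G where "G = (\<lambda>x. F (?w x))"
  have wUH: "?w x \<in> UH" if "fst x \<in> ?I" for x
  proof -
    have "(1 - fst x) *\<^sub>R u (snd x) + fst x *\<^sub>R v (snd x) \<in> UH"
      using convex_UH u(2) v(2) that unfolding convex_alt by (metis atLeastAtMost_iff)
    then show ?thesis by (simp add: scaleR_conv_of_real)
  qed
  have "continuous_on (?I \<times> UNIV) ?w"
    by (intro continuous_intros continuous_on_compose2[OF u(1)] continuous_on_compose2[OF v(1)]) auto
  then have "continuous_map (top_of_set (?I \<times> UNIV)) (top_of_set UH) ?w"
    using wUH by (auto simp: continuous_map_in_subtopology simp del: in_UH)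
  from continuous_map_compose[OF this F] have G: "continuous_map (top_of_set (?I \<times> UNIV)) S G"
    by (simp add: o_def G_def)
  have per: "G (s, t + 2 * pi) = G (s, t)" if s: "s \<in> ?I" for s t
    using A[OF wUH[of "(s, t)"]] aff[of s "u t" "v t"] u(4) v(4) s by (simp add: G_def)
  note d = continuous_map_circle_family[OF G compact_Icc per]
  have "homotopic_with (\<lambda>_. True) circle S c c' \<longleftrightarrow>
    (\<exists>h. continuous_map (prod_topology (subtopology euclideanreal {0..1}) circle) S h \<and>
        (\<forall>x\<in>topspace circle. h (0, x) = c x) \<and> (\<forall>x\<in>topspace circle. h (1, x) = c' x) \<and>
        (\<forall>t\<in>{0..1}. True))"
    by (simp add: homotopic_with)
  moreover have "G (0, Arg z) = c z" "G (1, Arg z) = c' z" if "z \<in> sphere 0 1" for z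
    using u(3)[of "Arg z"] v(3)[of "Arg z"] cis_Arg_sphere[OF that] by (simp_all add: G_def)
  ultimately show ?thesis unfolding freely_homotopic_def using d
    by (auto intro!: exI[of _ "\<lambda>(s, z). G (s, Arg z)"])
qed

context hyperbolic_surface
begin

text \<open>
  Both possible forms of \<open>A\<close> are real-linear and map the imaginary axis to itself, so the axis covers
  a closed geodesic, and \<open>straight_line_homotopy\<close> moves every closed curve with holonomy \<open>A\<close> to
  it.
\<close>

lemma axis_closed_geodesic:
  assumes F: "developing F" and l: "0 < l"
    and A: "A = (\<lambda>z. of_real l * z) \<or> A = (\<lambda>z. - of_real l * cnj z)"
    and FA: "\<And>z. z \<in> UH \<Longrightarrow> F (A z) = F z"
  obtains \<gamma> where "closed_geodesic S \<rho> \<bar>ln l\<bar> \<gamma>"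
    "\<And>t. \<gamma> (cis t) = F (\<i> * of_real (exp (ln l / (2 * pi) * t)))"
    "\<And>c u. continuous_on UNIV u \<Longrightarrow> (\<And>t. u t \<in> UH) \<Longrightarrow> (\<And>t. F (u t) = c (cis t)) \<Longrightarrow>
      (\<And>t. u (t + 2 * pi) = A (u t)) \<Longrightarrow> freely_homotopic S c \<gamma>"
proof -
  define \<kappa> where "\<kappa> = ln l / (2 * pi)"
  define v where "v t = \<i> * of_real (exp (\<kappa> * t))" for t
  define \<gamma> where "\<gamma> z = F (v (Arg z))" for z
  have vUH: "v t \<in> UH" for t by (simp add: v_def)
  have contv: "continuous_on UNIV v" unfolding v_def by (intro continuous_intros)
  have per: "v (t + 2 * pi) = A (v t)" for t
  proof -
    have "exp (\<kappa> * (t + 2 * pi)) = l * exp (\<kappa> * t)"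
      using l by (simp add: \<kappa>_def distrib_left exp_add)
    then have "v (t + 2 * pi) = of_real l * v t" unfolding v_def by simp
    moreover have "of_real l * v t = - of_real l * cnj (v t)" by (simp add: v_def)
    ultimately show ?thesis using A by auto
  qed
  have aff: "A (of_real (1 - s) * z + of_real s * w) = of_real (1 - s) * A z + of_real s * A w" for s z w
    using A by (auto simp: algebra_simps)
  note Fc = developing_continuous[OF F]
  have \<gamma>cis: "\<gamma> (cis t) = F (v t)" for t
  proof -
    have "F (v (t + 2 * pi)) = F (v t)" for t using per FA vUH by simp
    then show ?thesis unfolding \<gamma>_def by (rule periodic_Arg_cis)
  qed
  have hom: "freely_homotopic S c \<gamma>"
    if "continuous_on UNIV u" "\<And>t. u t \<in> UH" "\<And>t. F (u t) = c (cis t)" "\<And>t. u (t + 2 * pi) = A (u t)" for c u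
    by (rule straight_line_homotopy[OF Fc that contv vUH _ per FA aff]) (simp_all add: \<gamma>cis)
  have "freely_homotopic S \<gamma> \<gamma>" by (rule hom[OF contv vUH _ per]) (simp add: \<gamma>cis)
  then have cc: "closed_curve S \<gamma>"
    unfolding freely_homotopic_def closed_curve_def using homotopic_with_imp_continuous_maps by blast
  have "closed_geodesic S \<rho> \<bar>ln l\<bar> \<gamma>"
    unfolding closed_geodesic_def
  proof (intro conjI allI)
    fix t
    obtain N where N: "open N" "v t \<in> N" "\<And>u v. u \<in> N \<Longrightarrow> v \<in> N \<Longrightarrow> \<rho> (F u) (F v) = hyp_dist u v"
      using F vUH[of t] isometric_nearE unfolding developing_def by metis
    have "open (v -` N)" using N(1) contv by (metis open_vimage)
    then obtain d where d: "d > 0" "ball t d \<subseteq> v -` N" using openE[of "v -` N" t] N(2) by auto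
    have "\<rho> (\<gamma> (cis a)) (\<gamma> (cis b)) = \<bar>ln l\<bar> / (2 * pi) * \<bar>a - b\<bar>"
      if "\<bar>a - t\<bar> < d" "\<bar>b - t\<bar> < d" for a b
    proof -
      have "a \<in> ball t d" "b \<in> ball t d" using that by (auto simp: dist_real_def)
      then have "v a \<in> N" "v b \<in> N" using d(2) by auto
      then have "\<rho> (\<gamma> (cis a)) (\<gamma> (cis b)) = \<bar>\<kappa> * a - \<kappa> * b\<bar>"
        unfolding \<gamma>cis using N(3) hyp_dist_vertical[of "\<kappa> * a" "\<kappa> * b"] unfolding v_def by metis
      also have "\<dots> = \<bar>\<kappa>\<bar> * \<bar>a - b\<bar>" by (simp add: abs_mult[symmetric] right_diff_distrib)
      also have "\<bar>\<kappa>\<bar> = \<bar>ln l\<bar> / (2 * pi)" by (simp add: \<kappa>_def)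
      finally show ?thesis .
    qed
    then show "\<exists>\<delta>>0. \<forall>u v. \<bar>u - t\<bar> < \<delta> \<and> \<bar>v - t\<bar> < \<delta> \<longrightarrow>
        \<rho> (\<gamma> (cis u)) (\<gamma> (cis v)) = \<bar>ln l\<bar> / (2 * pi) * \<bar>u - v\<bar>" using d(1) by blast
  qed (use cc in auto)
  then show ?thesis using that[of \<gamma>] \<gamma>cis hom unfolding v_def \<kappa>_def by blast
qed

text \<open>
  The holonomy of \<open>c\<close> falls under one of the cases of \<open>isom_classify\<close>. If it has a fixed point, it is
  the identity and \<open>c\<close> contracts to a point, which is a closed geodesic of length 0. If it has an axis,
  \<open>c\<close> is homotopic to the closed geodesic covered by the axis. So it is parabolic, and it becomes
  \<open>z \<mapsto> z + 1\<close> or its inverse in suitable coordinates.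
\<close>

lemma developing_parabolic:
  assumes c: "closed_curve S c" and no: "\<nexists>l. has_geodesic_length S \<rho> c l"
  obtains F where "developing F" "\<And>z. z \<in> UH \<Longrightarrow> F (z + 1) = F z"
proof -
  have contc: "continuous_map euclidean S (\<lambda>t. c (cis t))"
  proof -
    have "continuous_map euclidean circle cis"
      by (auto simp: continuous_map_in_subtopology intro!: continuous_intros)
    from continuous_map_compose[OF this c[unfolded closed_curve_def]] show ?thesis by (simp add: o_def)
  qed
  then have "\<forall>t. c (cis t) \<in> topspace S" by (simp add: continuous_map_def Pi_iff)
  then have c0: "c (cis 0) \<in> topspace S" by blast
  then obtain f where f: "developing f" using developing_exists by blast
  note cov = developing_covering[OF f] and fc = developing_continuous[OF f]
  obtain z0 where z0: "z0 \<in> UH" "f z0 = c (cis 0)"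
  proof -
    have "f ` UH = topspace S" using cov unfolding covering_map_def by simp
    then have "c (cis 0) \<in> f ` UH" using c0 by simp
    then show ?thesis using that by (metis imageE)
  qed
  obtain u where u: "continuous_map (top_of_set UNIV) (top_of_set UH) u" "\<And>t::real. f (u t) = c (cis t)" "u 0 = z0"
    using covering_lift_exists[OF cov open_UNIV convex_UNIV, of "\<lambda>t. c (cis t)" 0 z0] contc z0 by auto
  have uc: "continuous_on UNIV u" and uUH: "u t \<in> UH" for t
    using u(1) by (auto simp: continuous_map_in_subtopology)
  have "f (u 0) = f (u (2 * pi))" unfolding u(2) by (simp add: cis_cnj)
  then obtain A where A: "isom A" "A (u 0) = u (2 * pi)" "\<And>z. z \<in> UH \<Longrightarrow> f (A z) = f z"
    using developing_deck[OF f uUH uUH] by metis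
  have uA: "u (t + 2 * pi) = A (u t)" for t
  proof (rule covering_lift_unique[OF cov open_UNIV convex_UNIV, where f = "\<lambda>t. u (t + 2 * pi)"
        and g = "\<lambda>t. A (u t)" and a = 0 and x = t])
    have "continuous_on UNIV (\<lambda>t. u (t + 2 * pi))"
      by (intro continuous_on_compose2[OF uc] continuous_intros) auto
    then show "continuous_map (top_of_set UNIV) (top_of_set UH) (\<lambda>t. u (t + 2 * pi))"
      using uUH by (auto simp: continuous_map_in_subtopology)
    show "continuous_map (top_of_set UNIV) (top_of_set UH) (\<lambda>t. A (u t))"
      using continuous_map_compose[OF u(1) continuous_isom[OF A(1)]] by (simp add: o_def)
    show "f (u (t + 2 * pi)) = f (A (u t))" for t
      using A(3)[OF uUH] u(2) by (simp add: cis_mult[symmetric] flip: cis_mult)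
    show "u (0 + 2 * pi) = A (u 0)" using A(2) by simp
  qed auto
  consider "\<exists>z\<in>UH. A z = z" | "axial A" | "parabolic A" using isom_classify[OF A(1)] by blast
  then show thesis
  proof cases
    case 1
    then obtain z where "z \<in> UH" "A z = z" by blast
    then have Aid: "A w = w" if "w \<in> UH" for w
      using deck_free[OF f A(1,3) isom_id _ _ _ that] by simp
    define g where "g = (\<lambda>_ :: complex. f \<i>)"
    have "freely_homotopic S c g"
      by (rule straight_line_homotopy[OF fc uc uUH u(2), of "\<lambda>z. z" "\<lambda>_. \<i>"]) (use uA Aid uUH in \<open>auto simp: g_def\<close>)
    moreover have "closed_geodesic S \<rho> 0 g"
    proof -
      have "f \<i> \<in> topspace S" using fc by (auto simp: continuous_map_def)
      then show ?thesis unfolding closed_geodesic_def closed_curve_def g_def by (auto intro!: exI[of _ 1])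
    qed
    ultimately show ?thesis using no unfolding has_geodesic_length_def by blast
  next
    case 2
    then obtain M l where M: "isom M" "0 < l"
      "(\<forall>z\<in>UH. A (M z) = M (of_real l * z)) \<or> (\<forall>z\<in>UH. A (M z) = M (- of_real l * cnj z))"
      unfolding axial_def by blast
    obtain N where N: "isom N" "\<And>z. z \<in> UH \<Longrightarrow> N (M z) = z" "\<And>z. z \<in> UH \<Longrightarrow> M (N z) = z"
      using isom_inverse[OF M(1)] by blast
    obtain B where B: "B = (\<lambda>z. of_real l * z) \<or> B = (\<lambda>z. - of_real l * cnj z)"
      and AB: "\<And>z. z \<in> UH \<Longrightarrow> A (M z) = M (B z)" using M(3) by metis
    have BU: "B z \<in> UH" if "z \<in> UH" for z using B that M(2) by auto
    let ?F = "\<lambda>z. f (M z)"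
    have F: "developing ?F" by (rule developing_comp[OF f M(1)])
    have FB: "?F (B z) = ?F z" if "z \<in> UH" for z using AB[OF that] A(3)[OF isom_UH[OF M(1) that]] by simp
    obtain \<gamma> where \<gamma>: "closed_geodesic S \<rho> \<bar>ln l\<bar> \<gamma>"
      "\<And>c u. continuous_on UNIV u \<Longrightarrow> (\<And>t. u t \<in> UH) \<Longrightarrow> (\<And>t. ?F (u t) = c (cis t)) \<Longrightarrow>
      (\<And>t. u (t + 2 * pi) = B (u t)) \<Longrightarrow> freely_homotopic S c \<gamma>"
      using axis_closed_geodesic[OF F M(2) B FB] by metis
    have "freely_homotopic S c \<gamma>"
    proof (rule \<gamma>(2)[of "\<lambda>t. N (u t)"])
      show "continuous_on UNIV (\<lambda>t. N (u t))"
        by (rule continuous_on_compose2[OF continuous_on_isom[OF N(1)] uc]) (use uUH in auto)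
      fix t
      show "N (u t) \<in> UH" using isom_UH[OF N(1) uUH] .
      show "f (M (N (u t))) = c (cis t)" using N(3)[OF uUH] u(2) by simp
      have "M (B (N (u t))) = A (u t)" using AB[OF isom_UH[OF N(1) uUH]] N(3)[OF uUH] by simp
      then have "N (A (u t)) = B (N (u t))" using N(2)[OF BU[OF isom_UH[OF N(1) uUH]]] by metis
      then show "N (u (t + 2 * pi)) = B (N (u t))" using uA by simp
    qed
    then show ?thesis using no \<gamma>(1) unfolding has_geodesic_length_def by blast
  next
    case 3
    then obtain M where M: "isom M" "(\<forall>z\<in>UH. A (M z) = M (z + 1)) \<or> (\<forall>z\<in>UH. A (M (z + 1)) = M z)"
      unfolding parabolic_def by blast
    have "f (M (z + 1)) = f (M z)" if z: "z \<in> UH" for z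
    proof -
      have "M z \<in> UH" "M (z + 1) \<in> UH" using isom_UH[OF M(1)] z by auto
      then show ?thesis using A(3) M(2) z by metis
    qed
    then show ?thesis using that[OF developing_comp[OF f M(1)]] by blast
  qed
qed

end

section \<open>An axis crosses its translates\<close>

lemma equivariant_periodic_factor:
  fixes w :: "real \<Rightarrow> complex"
  assumes l: "0 < l" and per: "\<And>t. w (t + 2 * pi) = of_real l * w t"
  obtains v where "v = (\<lambda>t. of_real (exp (- (ln l / (2 * pi)) * t)) * w t)" "\<And>t. v (t + 2 * pi) = v t"
    "\<And>t. w t = of_real (exp (ln l / (2 * pi) * t)) * v t"
proof
  let ?\<kappa> = "ln l / (2 * pi)"
  let ?v = "\<lambda>t. of_real (exp (- ?\<kappa> * t)) * w t"
  show "?v (t + 2 * pi) = ?v t" for t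
  proof -
    have "exp (- ?\<kappa> * (t + 2 * pi)) * l = exp (- ?\<kappa> * t)"
      using l by (simp add: distrib_left exp_diff)
    then show ?thesis unfolding per by (metis mult.assoc of_real_mult)
  qed
  show "w t = of_real (exp (?\<kappa> * t)) * ?v t" for t
    by (simp add: mult.assoc[symmetric] exp_minus flip: of_real_mult)
qed (rule refl)

text \<open>
  Up to the factor \<open>l\<close> raised to the power \<open>t / (2 * pi)\<close> the curve is periodic, so its modulus is
  comparable to that factor.
\<close>

lemma tendsto_axis_ends:
  fixes w :: "real \<Rightarrow> complex"
  assumes w: "continuous_on UNIV w" "\<And>t. w t \<in> UH" and l: "1 < l" and per: "\<And>t. w (t + 2 * pi) = of_real l * w t"
  shows "filterlim w at_infinity at_top" "(w \<longlongrightarrow> 0) at_bot"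
proof -
  define \<kappa> where "\<kappa> = ln l / (2 * pi)"
  have \<kappa>: "0 < \<kappa>" using l by (simp add: \<kappa>_def)
  have l0: "0 < l" using l by simp
  obtain v where v_def: "v = (\<lambda>t. of_real (exp (- \<kappa> * t)) * w t)" and vper: "\<And>t. v (t + 2 * pi) = v t"
    and wv: "\<And>t. w t = of_real (exp (\<kappa> * t)) * v t"
    using equivariant_periodic_factor[where w = w and l = l, OF l0 per] unfolding \<kappa>_def by metis
  have contv: "continuous_on UNIV v" unfolding v_def by (intro continuous_intros w(1))
  have v0: "v t \<noteq> 0" for t using w(2)[of t] by (auto simp: v_def)
  have cpt: "compact ((\<lambda>t. cmod (v t)) ` {0..2 * pi})"
    by (intro compact_continuous_image continuous_intros continuous_on_subset[OF contv]) auto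
  have red: "\<exists>t'\<in>{0..2 * pi}. v t' = v t" for t
  proof -
    define n where "n = \<lfloor>t / (2 * pi)\<rfloor>"
    have "of_int n \<le> t / (2 * pi)" "t / (2 * pi) < of_int n + 1" unfolding n_def by linarith+
    then have "0 \<le> t + 2 * pi * of_int (- n)" "t + 2 * pi * of_int (- n) \<le> 2 * pi"
      using pi_gt_zero by (simp_all add: field_simps)
    moreover have "v (t + 2 * pi * of_int (- n)) = v t" by (rule periodic_int[of v, OF vper])
    ultimately show ?thesis by (metis atLeastAtMost_iff)
  qed
  have ne: "(\<lambda>t. cmod (v t)) ` {0..2 * pi} \<noteq> {}" by simp
  obtain a where a: "0 < a" "\<And>t. a \<le> cmod (v t)"
  proof -
    obtain t0 where t0: "\<forall>t\<in>{0..2*pi}. cmod (v t0) \<le> cmod (v t)"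
      using compact_attains_inf[OF cpt ne] by blast
    show thesis
    proof (rule that[of "cmod (v t0)"])
      show "0 < cmod (v t0)" using v0 by simp
      show "cmod (v t0) \<le> cmod (v t)" for t using red[of t] t0 by metis
    qed
  qed
  obtain b where b: "\<And>t. cmod (v t) \<le> b"
  proof -
    obtain t0 where t0: "\<forall>t\<in>{0..2*pi}. cmod (v t) \<le> cmod (v t0)"
      using compact_attains_sup[OF cpt ne] by blast
    show thesis
      by (rule that[of "cmod (v t0)"]) (use red t0 in metis)
  qed
  have nw: "cmod (w t) = exp (\<kappa> * t) * cmod (v t)" for t unfolding wv[of t] by (simp add: norm_mult)
  have etop: "filterlim (\<lambda>t. exp (\<kappa> * t) * a) at_top at_top"
    using \<kappa> a by real_asymp
  have "filterlim (\<lambda>t. cmod (w t)) at_top at_top"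
    by (rule filterlim_at_top_mono[OF etop]) (auto simp: nw intro!: always_eventually mult_left_mono a)
  then show "filterlim w at_infinity at_top" by (rule filterlim_norm_at_top_imp_at_infinity)
  have ebot: "((\<lambda>t. exp (\<kappa> * t) * b) \<longlongrightarrow> 0) at_bot"
    using \<kappa> by real_asymp
  have "((\<lambda>t. cmod (w t)) \<longlongrightarrow> 0) at_bot"
    by (rule tendsto_sandwich[OF _ _ tendsto_const ebot])
       (auto simp: nw intro!: always_eventually mult_left_mono b)
  then show "(w \<longlongrightarrow> 0) at_bot" by (rule tendsto_norm_zero_cancel)
qed

text \<open>
  This is \<open>fashoda_interlace\<close> for a rectangle with one side on the real axis.
\<close>

lemma interlaced_curves_cross:
  fixes \<alpha> \<beta> :: "real \<Rightarrow> complex"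
  assumes \<alpha>: "continuous_on {0..1} \<alpha>" and \<beta>: "continuous_on {0..1} \<beta>"
    and Im: "\<And>t. t \<in> {0..1} \<Longrightarrow> 0 \<le> Im (\<alpha> t)" "\<And>t. t \<in> {0..1} \<Longrightarrow> 0 \<le> Im (\<beta> t)"
    and ends: "Im (\<alpha> 0) = 0" "Im (\<alpha> 1) = 0" "Im (\<beta> 0) = 0" "Im (\<beta> 1) = 0"
    and order: "Re (\<alpha> 0) < Re (\<beta> 0)" "Re (\<beta> 0) < Re (\<alpha> 1)" "Re (\<alpha> 1) < Re (\<beta> 1)"
  obtains s t where "s \<in> {0..1}" "t \<in> {0..1}" "\<alpha> s = \<beta> t"
proof -
  define \<phi> :: "complex \<Rightarrow> real ^ 2" where "\<phi> z = (\<chi> i. if i = 1 then Re z else Im z)" for z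
  have \<phi>1: "\<phi> z $ 1 = Re z" and \<phi>2: "\<phi> z $ 2 = Im z" for z by (simp_all add: \<phi>_def)
  have cont\<phi>: "continuous_on UNIV \<phi>"
    unfolding \<phi>_def
  proof (rule continuous_on_vec_lambda)
    show "continuous_on UNIV (\<lambda>z. if i = 1 then Re z else Im z)" for i :: 2
      by (cases "i = 1") (auto intro!: continuous_intros)
  qed
  have inj: "z = w" if "\<phi> z = \<phi> w" for z w
    using arg_cong[OF that, of "\<lambda>x. x $ 1"] arg_cong[OF that, of "\<lambda>x. x $ 2"]
    by (simp add: \<phi>1 \<phi>2 complex_eq_iff)
  have p: "path (\<lambda>t. \<phi> (\<alpha> t))" "path (\<lambda>t. \<phi> (\<beta> t))"
    unfolding path_def by (auto intro!: continuous_on_compose2[OF cont\<phi>] \<alpha> \<beta>)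
  have "bounded (\<alpha> ` {0..1} \<union> \<beta> ` {0..1})"
    using compact_continuous_image[OF \<alpha>] compact_continuous_image[OF \<beta>] by (simp add: compact_imp_bounded)
  then obtain B where B: "\<And>z. z \<in> \<alpha> ` {0..1} \<union> \<beta> ` {0..1} \<Longrightarrow> cmod z \<le> B" unfolding bounded_iff by blast
  define a b :: "real ^ 2" where "a = (\<chi> i. if i = 1 then - B else 0)" and "b = (\<chi> i. B)"
  have mem: "\<phi> z \<in> cbox a b" if "z \<in> \<alpha> ` {0..1} \<union> \<beta> ` {0..1}" "0 \<le> Im z" for z
  proof -
    have "\<bar>Re z\<bar> \<le> B" "\<bar>Im z\<bar> \<le> B" using B[OF that(1)] abs_Re_le_cmod[of z] abs_Im_le_cmod[of z] by linarith+
    then show ?thesis using that(2) unfolding mem_box_cart by (auto simp: forall_2 \<phi>1 \<phi>2 a_def b_def)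
  qed
  have a2: "a $ 2 = 0" by (simp add: a_def)
  obtain z where z: "z \<in> path_image (\<lambda>t. \<phi> (\<alpha> t))" "z \<in> path_image (\<lambda>t. \<phi> (\<beta> t))"
  proof (rule fashoda_interlace[OF p, of a b])
    show "path_image (\<lambda>t. \<phi> (\<alpha> t)) \<subseteq> cbox a b" "path_image (\<lambda>t. \<phi> (\<beta> t)) \<subseteq> cbox a b"
      unfolding path_image_def using mem Im by auto
  qed (use ends order in \<open>auto simp: pathstart_def pathfinish_def \<phi>1 \<phi>2 a2\<close>)
  then obtain s t where "s \<in> {0..1}" "t \<in> {0..1}" "\<phi> (\<alpha> s) = \<phi> (\<beta> t)"
    unfolding path_image_def by auto
  then show ?thesis using inj that by blast
qed

text \<open>
  The Moebius transformation sends 0 and infinity to \<open>r1\<close> and \<open>r2\<close>, so the image of \<open>w\<close> becomes a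
  path from \<open>r1\<close> to \<open>r2\<close> when the two ends are added. Its translate by \<open>m\<close> has interlaced ends. The
  crossing is not at an end, because the four ends are distinct and the rest of the paths lies in the
  open half-plane.
\<close>

lemma axis_crosses_translate:
  fixes w :: "real \<Rightarrow> complex"
  assumes w: "continuous_on UNIV w" "\<And>t. w t \<in> UH" and l: "1 < l" and per: "\<And>t. w (t + 2 * pi) = of_real l * w t"
    and m: "0 < m" "m < r2 - r1"
  obtains s t where "mob r2 r1 1 1 (w s) = mob r2 r1 1 1 (w t) + of_real m"
proof -
  have D: "r2 * 1 - r1 * 1 > 0" using m by simp
  define \<alpha> where "\<alpha> t = mob r2 r1 1 1 (w t)" for t
  have \<alpha>UH: "\<alpha> t \<in> UH" for t unfolding \<alpha>_def by (rule mob_UH[OF D w(2)])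
  have cont\<alpha>: "continuous_on UNIV \<alpha>"
    unfolding \<alpha>_def by (rule continuous_on_compose2[OF continuous_on_isom[OF isom_mob[OF D]] w(1)]) (use w(2) in auto)
  note lim = tendsto_axis_ends[OF w l per]
  have w1: "w t + 1 \<noteq> 0" for t
  proof
    assume "w t + 1 = 0"
    then have "Im (w t + 1) = 0" by simp
    then show False using w(2)[of t] by simp
  qed
  have top: "(\<alpha> \<longlongrightarrow> of_real r2) at_top"
  proof -
    have "filterlim (\<lambda>t. 1 + w t) at_infinity at_top"
      by (rule tendsto_add_filterlim_at_infinity[OF tendsto_const lim(1)])
    then have "((\<lambda>t. of_real r2 + of_real (r1 - r2) * inverse (1 + w t)) \<longlongrightarrow> of_real r2 + of_real (r1 - r2) * 0) at_top"
      by (intro tendsto_intros filterlim_compose[OF tendsto_inverse_0])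
    moreover have "of_real r2 + of_real (r1 - r2) * inverse (1 + w t) = \<alpha> t" for t
      using w1[of t] unfolding \<alpha>_def mob_def by (simp add: field_simps)
    ultimately show ?thesis by simp
  qed
  have bot: "(\<alpha> \<longlongrightarrow> of_real r1) at_bot"
  proof -
    have "((\<lambda>t. (of_real r2 * w t + of_real r1) / (of_real 1 * w t + of_real 1)) \<longlongrightarrow>
        (of_real r2 * 0 + of_real r1) / (of_real 1 * 0 + of_real 1)) at_bot"
      by (intro tendsto_intros lim(2)) simp
    then show ?thesis unfolding \<alpha>_def mob_def by simp
  qed
  \<comment> \<open>\<open>\<tau>\<close> maps the open unit interval increasingly onto the real line\<close>
  define \<tau> where "\<tau> x = ln x - ln (1 - x)" for x :: real
  have \<tau>0: "filterlim \<tau> at_bot (at_right 0)" unfolding \<tau>_def by real_asymp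
  have \<tau>1: "filterlim \<tau> at_top (at_left 1)" unfolding \<tau>_def by real_asymp
  define P where "P x = (if x \<le> 0 then of_real r1 else if 1 \<le> x then of_real r2 else \<alpha> (\<tau> x))" for x
  have inner: "P x = \<alpha> (\<tau> x)" if "0 < x" "x < 1" for x using that by (simp add: P_def)
  have contP: "continuous_on {0..1} P"
  proof (rule continuous_on_IccI)
    have "((\<lambda>x. \<alpha> (\<tau> x)) \<longlongrightarrow> of_real r1) (at_right 0)" by (rule filterlim_compose[OF bot \<tau>0])
    moreover have "eventually (\<lambda>x. \<alpha> (\<tau> x) = P x) (at_right 0)"
      using eventually_at_right_real[of 0 "1::real"] by (auto elim!: eventually_mono simp: inner)
    ultimately have "(P \<longlongrightarrow> of_real r1) (at_right 0)" by (rule Lim_transform_eventually)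
    then show "(P \<longlongrightarrow> P 0) (at_right 0)" by (simp add: P_def)
    have "((\<lambda>x. \<alpha> (\<tau> x)) \<longlongrightarrow> of_real r2) (at_left 1)" by (rule filterlim_compose[OF top \<tau>1])
    moreover have "eventually (\<lambda>x. \<alpha> (\<tau> x) = P x) (at_left 1)"
      using eventually_at_left_real[of 0 "1::real"] by (auto elim!: eventually_mono simp: inner)
    ultimately have "(P \<longlongrightarrow> of_real r2) (at_left 1)" by (rule Lim_transform_eventually)
    then show "(P \<longlongrightarrow> P 1) (at_left 1)" by (simp add: P_def)
    fix x :: real assume x: "0 < x" "x < 1"
    have "isCont \<tau> x" unfolding \<tau>_def using x by (intro continuous_intros) auto
    moreover have "isCont \<alpha> (\<tau> x)" using cont\<alpha> by (simp add: continuous_on_eq_continuous_at)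
    ultimately have "isCont (\<lambda>x. \<alpha> (\<tau> x)) x" by (rule isCont_o2)
    then have "((\<lambda>x. \<alpha> (\<tau> x)) \<longlongrightarrow> P x) (at x)" using x by (simp add: isCont_def inner)
    moreover have "eventually (\<lambda>x. \<alpha> (\<tau> x) = P x) (at x)"
      using eventually_at_in_open'[of "{0<..<1}" x] x by (auto elim!: eventually_mono simp: inner)
    ultimately show "(P \<longlongrightarrow> P x) (at x)" by (rule Lim_transform_eventually)
  qed simp
  have ImP: "0 \<le> Im (P x)" for x using \<alpha>UH[of "\<tau> x"] by (simp add: P_def)
  have contP': "continuous_on {0..1} (\<lambda>x. P x + of_real m)" by (intro continuous_intros contP)
  obtain x y where xy: "x \<in> {0..1}" "y \<in> {0..1}" "P x = P y + of_real m"
    by (rule interlaced_curves_cross[OF contP contP']) (use ImP m in \<open>auto simp: P_def\<close>)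
  have pos: "0 < Im (P x)" if "0 < x" "x < 1" for x using \<alpha>UH[of "\<tau> x"] inner[OF that] by simp
  have "Im (P x) = Im (P y)" using xy(3) by simp
  have "0 < x \<and> x < 1 \<and> 0 < y \<and> y < 1"
  proof (rule ccontr)
    assume "\<not> ?thesis"
    then have "x = 0 \<or> x = 1 \<or> y = 0 \<or> y = 1" using xy by auto
    then have "Im (P x) = 0" using \<open>Im (P x) = Im (P y)\<close> by (auto simp: P_def)
    then have "(x = 0 \<or> x = 1) \<and> (y = 0 \<or> y = 1)"
      using pos[of x] pos[of y] \<open>Im (P x) = Im (P y)\<close> xy(1,2) by force
    moreover have "Re (P x) = Re (P y) + m" using xy(3) by simp
    ultimately show False using m by (auto simp: P_def)
  qed
  then have "\<alpha> (\<tau> x) = \<alpha> (\<tau> y) + of_real m" using xy(3) inner by simp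
  then show ?thesis using that unfolding \<alpha>_def by blast
qed

section \<open>A lower bound for the degree\<close>

lemma simple_representative:
  assumes "simple_curve X c"
  obtains c' where "freely_homotopic X c c'" "inj_on c' (sphere 0 1)"
proof -
  let ?A = "(\<lambda>c'. enat (card (double_points c'))) ` {c'. freely_homotopic X c c' \<and> finite (double_points c')}"
  have inf: "Inf ?A = 0" using assms by (simp add: simple_curve_def self_intersection_number_def)
  have "?A \<noteq> {}"
  proof
    assume "?A = {}"
    then have "Inf ?A = (\<infinity> :: enat)" by (simp add: Inf_enat_def)
    then show False using inf by simp
  qed
  then have "Inf ?A \<in> ?A" by (meson all_not_in_conv wellorder_InfI)
  then obtain c' where c': "freely_homotopic X c c'" "finite (double_points c')" "enat (card (double_points c')) = 0"
    unfolding inf by auto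
  then have "double_points c' = {}" by (simp add: zero_enat_def)
  then have "inj_on c' (sphere 0 1)" unfolding double_points_def inj_on_def by blast
  then show ?thesis using that c' by blast
qed

lemma translation_of_nat:
  assumes T: "\<And>z. z \<in> UH \<Longrightarrow> f (z + 1) = f z" and z: "z \<in> UH"
  shows "f (z + of_nat j) = f z"
proof (induction j)
  case (Suc j)
  then show ?case using T[of "z + of_nat j"] z by (simp add: algebra_simps)
qed simp

text \<open>
  A translation by \<open>m \<le> d\<close> that fixes the lift \<open>g\<close> comes from the pigeonhole principle, applied to the
  points over \<open>f \<i>\<close>.
\<close>

lemma finite_cover_translation:
  assumes cov: "finite_cover S' S p d" and f: "continuous_map (top_of_set UH) S f"
    and T: "\<And>z. z \<in> UH \<Longrightarrow> f (z + 1) = f z"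
    and g: "continuous_map (top_of_set UH) S' g" "\<And>z. z \<in> UH \<Longrightarrow> p (g z) = f z"
  obtains m :: nat where "0 < m" "m \<le> d" "\<And>z. z \<in> UH \<Longrightarrow> g (z + of_nat m) = g z"
proof -
  have cp: "covering_map S' S p" and d: "0 < d" using cov by (auto simp: finite_cover_def)
  have fib: "card {x' \<in> topspace S'. p x' = x} = d" if "x \<in> topspace S" for x
    using cov that by (simp add: finite_cover_def)
  have gS: "g z \<in> topspace S'" and fS: "f z \<in> topspace S" if "z \<in> UH" for z
    using g(1) f that by (auto simp: continuous_map_def)
  have fj: "f (z + of_nat j) = f z" if "z \<in> UH" for z j
    using T that by (rule translation_of_nat)
  let ?h = "\<lambda>j::nat. g (\<i> + of_nat j)"
  have iU: "\<i> + of_nat j \<in> UH" for j by simp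
  have fin: "card {x' \<in> topspace S'. p x' = f \<i>} = d" using fib[OF fS] by simp
  have "?h ` {..d} \<subseteq> {x' \<in> topspace S'. p x' = f \<i>}"
    using gS[OF iU] g(2)[OF iU] fj[of \<i>] by auto
  moreover have "finite {x' \<in> topspace S'. p x' = f \<i>}" using fin d card_ge_0_finite by metis
  ultimately have "card (?h ` {..d}) \<le> d" using fin card_mono by metis
  then have "\<not> inj_on ?h {..d}" using pigeonhole[of ?h "{..d}"] by simp
  then obtain j k where jk: "j < k" "k \<le> d" "?h j = ?h k"
    unfolding inj_on_def by (metis atMost_iff nat_neq_iff)
  have ct: "continuous_map (top_of_set UH) S' (\<lambda>z. g (z + of_nat j))" for j
  proof -
    have "continuous_map (top_of_set UH) (top_of_set UH) (\<lambda>z. z + of_nat j)"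
      by (auto simp: continuous_map_in_subtopology intro!: continuous_intros)
    from continuous_map_compose[OF this g(1)] show ?thesis by (simp add: o_def)
  qed
  have eq: "g (z + of_nat j) = g (z + of_nat k)" if "z \<in> UH" for z
    using covering_lift_unique[OF cp open_UH convex_UH ct[of j] ct[of k] _ _ jk(3) that] g(2) fj by simp
  have "g (z + of_nat (k - j)) = g z" if z: "z \<in> UH" for z
    using eq[of "z - of_nat j"] z jk(1) by (simp add: of_nat_diff algebra_simps)
  moreover have "0 < k - j" "k - j \<le> d" using jk by auto
  ultimately show ?thesis using that by blast
qed

text \<open>
  Clearing denominators gives a quadratic polynomial that vanishes on the half-plane; its real part
  at \<open>\<i>\<close> and at \<open>2 * \<i>\<close> gives contradictory values for \<open>l\<close>.
\<close>

lemma translation_not_axial: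
  assumes m: "0 < m" and eq: "\<And>z. z \<in> UH \<Longrightarrow> mob r2 r1 1 1 z + of_real m = mob r2 r1 1 1 (of_real l * z)"
    and l: "0 < l"
  shows False
proof -
  have pol: "of_real (m * l) * z\<^sup>2 + of_real ((r2 + m) + (r1 + m) * l - r2 * l - r1) * z + of_real m = 0"
    if z: "z \<in> UH" for z
  proof -
    have nz: "z + 1 \<noteq> 0" "of_real l * z + 1 \<noteq> 0"
      using denom_nonzero[of 1 1 0 1 z] denom_nonzero[of 1 1 0 l z] z by simp_all
    have "((of_real r2 * z + of_real r1) + of_real m * (z + 1)) * (of_real l * z + 1)
      = (of_real r2 * (of_real l * z) + of_real r1) * (z + 1)"
      using eq[OF z] nz unfolding mob_def by (simp add: field_simps)
    then show ?thesis by (simp add: power2_eq_square algebra_simps)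
  qed
  have "Re (of_real (m * l) * (\<i> * of_real y)\<^sup>2 + of_real ((r2 + m) + (r1 + m) * l - r2 * l - r1) * (\<i> * of_real y) + of_real m) = 0"
    if "0 < y" for y :: real
    using pol[of "\<i> * of_real y"] that by simp
  then have "m * l * y\<^sup>2 = m" if "0 < y" for y :: real
    using that by (simp add: power2_eq_square)
  from this[of 1] this[of 2] show False using m by simp
qed

text \<open>
  Here \<open>mob r2 r1 1 1\<close> maps the imaginary axis to the axis with the ends \<open>r1\<close> and \<open>r2\<close>, and \<open>\<gamma>\<close> is
  the closed geodesic covered by it. If \<open>d \<le> n\<close>, then \<open>finite_cover_translation\<close> and
  \<open>axis_crosses_translate\<close> yield two parameters at which an injective representative has the same
  value. They differ by a multiple of the period, so a translation and a power of the holonomy of \<open>\<gamma>\<close>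
  agree at a point. Then they agree everywhere, which \<open>translation_not_axial\<close> excludes.
\<close>

lemma degree_lower_bound:
  fixes S :: "'a topology" and S' :: "'b topology"
  assumes covf: "covering_map (top_of_set UH) S f" and T: "\<And>z. z \<in> UH \<Longrightarrow> f (z + 1) = f z"
    and covg: "covering_map (top_of_set UH) S (\<lambda>z. f (mob r2 r1 1 1 z))"
    and l: "1 < l" and g: "\<And>z. z \<in> UH \<Longrightarrow> f (mob r2 r1 1 1 (of_real l * z)) = f (mob r2 r1 1 1 z)"
    and \<gamma>: "\<And>t. \<gamma> (cis t) = f (mob r2 r1 1 1 (\<i> * of_real (exp (ln l / (2 * pi) * t))))"
    and fc: "finite_cover S' S p d" and ls: "lifts_simply S' S p \<gamma>"
    and n: "real n < r2 - r1"
  shows "n < d"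
proof (rule ccontr)
  assume "\<not> n < d"
  then have dn: "d \<le> n" by simp
  define M where "M = mob r2 r1 1 1"
  define g where "g = (\<lambda>z. f (M z))"
  have D: "r2 * 1 - r1 * 1 > 0" using n by linarith
  have MU: "M z \<in> UH" if "z \<in> UH" for z unfolding M_def by (rule mob_UH[OF D that])
  have contM: "continuous_map (top_of_set UH) (top_of_set UH) M"
    unfolding M_def by (rule continuous_isom[OF isom_mob[OF D]])
  have covg: "covering_map (top_of_set UH) S g" using covg by (simp add: g_def M_def)
  have gl: "g (of_real l * z) = g z" if "z \<in> UH" for z using g[OF that] by (simp add: g_def M_def)
  have cp: "covering_map S' S p" using fc by (simp add: finite_cover_def)
  have contp: "continuous_map S' S p" and contf: "continuous_map (top_of_set UH) S f"
    using cp covf by (simp_all add: covering_map_def)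
  obtain c' where c': "simple_curve S' c'" "freely_homotopic S \<gamma> (p \<circ> c')"
    using ls unfolding lifts_simply_def by blast
  obtain c where c: "freely_homotopic S' c' c" "inj_on c (sphere 0 1)"
    using simple_representative[OF c'(1)] by blast
  have contc: "continuous_map circle S' c"
    using c(1) unfolding freely_homotopic_def by (blast dest: homotopic_with_imp_continuous_maps)
  have "homotopic_with (\<lambda>_. True) circle S (p \<circ> c') (p \<circ> c)"
    using c(1) unfolding freely_homotopic_def
    by (rule homotopic_with_compose_continuous_map_left[OF _ contp]) auto
  then have "homotopic_with (\<lambda>_. True) circle S \<gamma> (p \<circ> c)"
    using c'(2) unfolding freely_homotopic_def by (rule homotopic_with_trans[rotated])
  then obtain h where h: "continuous_map (prod_topology (top_of_set {0..1::real}) circle) S h"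
    "\<And>x. h (0, x) = \<gamma> x" "\<And>x. h (1, x) = p (c x)"
    unfolding homotopic_with_def by auto
  \<comment> \<open>the first parameter is clamped to the unit interval, so that \<open>F\<close> is defined on a convex open set\<close>
  define F where "F x = h (max 0 (min 1 (fst x)), cis (snd x))" for x :: "real \<times> real"
  have contF: "continuous_map (top_of_set UNIV) S F"
  proof -
    have "continuous_map euclidean (prod_topology (top_of_set {0..1::real}) circle)
       (\<lambda>x :: real \<times> real. (max 0 (min 1 (fst x)), cis (snd x)))"
      by (auto simp: continuous_map_pairwise o_def continuous_map_in_subtopology intro!: continuous_intros)
    from continuous_map_compose[OF this h(1)] show ?thesis by (simp add: o_def F_def[abs_def])
  qed
  have "g \<i> = F (0, 0)" using \<gamma>[of 0] by (simp add: F_def h g_def M_def)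
  then obtain u where u: "continuous_map (top_of_set UNIV) (top_of_set UH) u" "\<And>x. g (u x) = F x" "u (0, 0) = \<i>"
    using covering_lift_exists[OF covg open_UNIV convex_UNIV contF, of "(0, 0)" \<i>] by auto
  have contu: "continuous_on UNIV u" and uU: "u x \<in> UH" for x
    using u(1) by (auto simp: continuous_map_in_subtopology)
  have contu': "continuous_map (top_of_set UNIV) (top_of_set UH) (\<lambda>x. u (k x))"
    if "continuous_on UNIV k" for k :: "'c::topological_space \<Rightarrow> real \<times> real"
    using continuous_on_compose2[OF contu that] uU by (auto simp: continuous_map_in_subtopology)
  have u0: "u (0, t) = \<i> * of_real (exp (ln l / (2 * pi) * t))" for t
  proof (rule covering_lift_unique[OF covg open_UNIV convex_UNIV,
        where f = "\<lambda>t. u (0, t)" and g = "\<lambda>t. \<i> * of_real (exp (ln l / (2 * pi) * t))" and a = "0::real" and x = t])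
    show "continuous_map (top_of_set UNIV) (top_of_set UH) (\<lambda>t. u (0, t))"
      by (rule contu') (intro continuous_intros)
    show "continuous_map (top_of_set UNIV) (top_of_set UH) (\<lambda>t. \<i> * of_real (exp (ln l / (2 * pi) * t)))"
      by (auto simp: continuous_map_in_subtopology intro!: continuous_intros)
    show "g (u (0, t)) = g (\<i> * of_real (exp (ln l / (2 * pi) * t)))" for t
    proof -
      have "g (u (0, t)) = \<gamma> (cis t)" unfolding u(2) by (simp add: F_def h)
      also have "\<dots> = g (\<i> * of_real (exp (ln l / (2 * pi) * t)))" unfolding \<gamma> g_def M_def ..
      finally show ?thesis .
    qed
  qed (use u(3) in auto)
  have uper: "u (s, t + 2 * pi) = of_real l * u (s, t)" for s t
  proof (rule covering_lift_unique[OF covg open_UNIV convex_UNIV,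
        where f = "\<lambda>x. u (fst x, snd x + 2 * pi)" and g = "\<lambda>x. of_real l * u x" and a = "(0,0)" and x = "(s, t)", simplified fst_conv snd_conv])
    show "continuous_map (top_of_set UNIV) (top_of_set UH) (\<lambda>x. u (fst x, snd x + 2 * pi))"
      by (rule contu') (intro continuous_intros)
    show "continuous_map (top_of_set UNIV) (top_of_set UH) (\<lambda>x. of_real l * u x)"
      using contu uU l by (auto simp: continuous_map_in_subtopology intro!: continuous_intros)
    show "g (u (fst x, snd x + 2 * pi)) = g (of_real l * u x)" for x
    proof -
      have "cis (snd x + 2 * pi) = cis (snd x)" unfolding cis_eq_cis by (intro exI[of _ 1]) simp
      then show ?thesis using gl[OF uU] by (simp add: u(2) F_def)
    qed
    show "u (0, 0 + 2 * pi) = of_real l * u (0, 0)" using l unfolding u0 by simp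
  qed auto
  define w where "w t = u (1, t)" for t
  have wU: "w t \<in> UH" for t unfolding w_def by (rule uU)
  have contw: "continuous_on UNIV w" unfolding w_def by (intro continuous_on_compose2[OF contu] continuous_intros) auto
  have wper: "w (t + 2 * pi) = of_real l * w t" for t unfolding w_def by (rule uper)
  have gw: "g (w t) = p (c (cis t))" for t by (simp add: w_def u(2) F_def h)
  have cS: "c z \<in> topspace S'" if "z \<in> sphere 0 1" for z using contc that by (auto simp: continuous_map_def)
  \<comment> \<open>normalising the lift \<open>k\<close> on the curve makes \<open>k\<close> map the lifted curve to \<open>c\<close> itself\<close>
  obtain k where k: "continuous_map (top_of_set UH) S' k" "\<And>z. z \<in> UH \<Longrightarrow> p (k z) = f z" "k (M (w 0)) = c (cis 0)"
  proof (rule covering_lift_exists[OF cp open_UH convex_UH contf])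
    show "M (w 0) \<in> UH" by (rule MU[OF wU])
    show "c (cis 0) \<in> topspace S'" by (rule cS) simp
    show "p (c (cis 0)) = f (M (w 0))" using gw[of 0] by (simp add: g_def)
  qed blast
  have kw: "k (M (w t)) = c (cis t)" for t
  proof (rule covering_lift_unique[OF cp open_UNIV convex_UNIV,
        where f = "\<lambda>t. k (M (w t))" and g = "\<lambda>t. c (cis t)" and a = "0::real" and x = t])
    have "continuous_map (top_of_set UNIV) (top_of_set UH) w"
      using contw wU by (auto simp: continuous_map_in_subtopology)
    from continuous_map_compose[OF continuous_map_compose[OF this contM] k(1)]
    show "continuous_map (top_of_set UNIV) S' (\<lambda>t. k (M (w t)))" by (simp add: o_def)
    have "continuous_map (top_of_set UNIV) circle cis"
      by (auto simp: continuous_map_in_subtopology intro!: continuous_intros)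
    from continuous_map_compose[OF this contc]
    show "continuous_map (top_of_set UNIV) S' (\<lambda>t. c (cis t))" by (simp add: o_def)
    show "p (k (M (w t))) = p (c (cis t))" for t using k(2)[OF MU[OF wU]] gw[of t] by (simp add: g_def)
  qed (use k(3) in auto)
  obtain m :: nat where m: "0 < m" "m \<le> d" "\<And>z. z \<in> UH \<Longrightarrow> k (z + of_nat m) = k z"
    using finite_cover_translation[OF fc contf T k(1,2)] by metis
  have "real m < r2 - r1" using m(2) dn n by linarith
  then obtain s t where st: "M (w s) = M (w t) + of_real (real m)"
    using axis_crosses_translate[OF contw wU l wper, of "real m" r2 r1] m(1) unfolding M_def by auto
  have "c (cis s) = c (cis t)" using kw[of s] kw[of t] m(3)[OF MU[OF wU[of t]]] st by simp
  then have "cis s = cis t" using c(2) by (auto dest: inj_onD)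
  then obtain q :: int where q: "s = t + 2 * pi * of_int q" unfolding cis_eq_cis by blast
  define l' where "l' = exp (ln l * of_int q)"
  have l': "0 < l'" by (simp add: l'_def)
  have ws: "w s = of_real l' * w t"
  proof -
    have l0: "0 < l" using l by simp
    obtain v where v: "\<And>t. v (t + 2 * pi) = v t" "\<And>t. w t = of_real (exp (ln l / (2 * pi) * t)) * v t"
      using equivariant_periodic_factor[where w = w and l = l, OF l0 wper] by metis
    have "exp (ln l / (2 * pi) * s) = l' * exp (ln l / (2 * pi) * t)"
      unfolding q l'_def exp_add[symmetric] by (simp add: field_simps)
    moreover have "v s = v t" unfolding q by (rule periodic_int[of v, OF v(1)])
    ultimately show ?thesis unfolding v(2)[of s] v(2)[of t] by simp
  qed
  have gl': "g (of_real l' * z) = g z" if z: "z \<in> UH" for z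
  proof -
    \<comment> \<open>the invariance under \<open>l\<close> is periodicity in the logarithmic scale\<close>
    define \<theta> where "\<theta> t = g (of_real (exp (ln l / (2 * pi) * t)) * z)" for t
    have "\<theta> (t + 2 * pi) = \<theta> t" for t
    proof -
      have "exp (ln l / (2 * pi) * (t + 2 * pi)) = l * exp (ln l / (2 * pi) * t)"
        using l by (simp add: distrib_left exp_add)
      then have "\<theta> (t + 2 * pi) = g (of_real l * (of_real (exp (ln l / (2 * pi) * t)) * z))"
        unfolding \<theta>_def by (simp add: mult.assoc)
      also have "\<dots> = \<theta> t" unfolding \<theta>_def by (rule gl) (use z in simp)
      finally show ?thesis .
    qed
    then have "\<theta> (0 + 2 * pi * of_int q) = \<theta> 0" by (rule periodic_int)
    then show ?thesis by (simp add: \<theta>_def l'_def)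
  qed
  have fm: "f (z + of_nat j) = f z" if "z \<in> UH" for z j
    using T that by (rule translation_of_nat)
  have "M z + of_real (real m) = M (of_real l' * z)" if z: "z \<in> UH" for z
  proof (rule covering_lift_unique[OF covf open_UH convex_UH,
        where f = "\<lambda>z. M z + of_real (real m)" and g = "\<lambda>z. M (of_real l' * z)" and a = "w t" and x = z])
    have cM: "continuous_on UH M" using contM by (simp add: continuous_map_in_subtopology)
    show "continuous_map (top_of_set UH) (top_of_set UH) (\<lambda>z. M z + of_real (real m))"
      using MU by (auto simp: continuous_map_in_subtopology intro!: continuous_intros cM)
    have "continuous_on UH (\<lambda>z. M (of_real l' * z))"
      by (rule continuous_on_compose2[OF cM]) (use l' in \<open>auto intro!: continuous_intros\<close>)
    then show "continuous_map (top_of_set UH) (top_of_set UH) (\<lambda>z. M (of_real l' * z))"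
      using MU l' by (auto simp: continuous_map_in_subtopology)
    show "f (M y + of_real (real m)) = f (M (of_real l' * y))" if "y \<in> UH" for y
      using fm[OF MU[OF that], of m] gl'[OF that] by (simp add: g_def)
    show "M (w t) + of_real (real m) = M (of_real l' * w t)" using st ws by simp
  qed (use wU z in auto)
  then show False using translation_not_axial[of "real m" r2 r1 l'] m(1) l' unfolding M_def by auto
qed

section \<open>Homology of the circle\<close>

lemma abelian_rank_cong:
  assumes "group G" "group H" "G \<cong> H"
  shows "abelian_rank G = abelian_rank H"
proof -
  have "mon (free_Abelian_group {..<n}) H \<noteq> {}"
    if m: "mon (free_Abelian_group {..<n}) G \<noteq> {}" for n :: nat
  proof -
    obtain \<phi> where "\<phi> \<in> iso G H" using assms(3) by (auto simp: is_iso_def)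
    then have "\<phi> \<in> mon G H" by (auto simp: mon_def iso_def bij_betw_def)
    moreover obtain f where "f \<in> mon (free_Abelian_group {..<n}) G" using m by blast
    ultimately show ?thesis using mon_compose by blast
  qed
  moreover have "mon (free_Abelian_group {..<n}) G \<noteq> {}"
    if m: "mon (free_Abelian_group {..<n}) H \<noteq> {}" for n :: nat
  proof -
    have "H \<cong> G" using group.iso_sym assms by blast
    then obtain \<phi> where "\<phi> \<in> iso H G" by (auto simp: is_iso_def)
    then have "\<phi> \<in> mon H G" by (auto simp: mon_def iso_def bij_betw_def)
    moreover obtain f where "f \<in> mon (free_Abelian_group {..<n}) H" using m by blast
    ultimately show ?thesis using mon_compose by blast
  qed
  ultimately have "{n. mon (free_Abelian_group {..<n::nat}) G \<noteq> {}} = {n. mon (free_Abelian_group {..<n}) H \<noteq> {}}"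
    using assms by blast
  then show ?thesis by (simp add: abelian_rank_def)
qed

lemma circle_homeomorphic_nsphere: "circle homeomorphic_space nsphere 1"
proof -
  let ?f = "\<lambda>z. (\<lambda>i::nat. if i = 0 then Re z else if i = 1 then Im z else 0)"
  let ?g = "\<lambda>x::nat \<Rightarrow> real. Complex (x 0) (x 1)"
  have sum: "(\<Sum>i\<le>1. (x i)\<^sup>2) = (x 0)\<^sup>2 + (x 1)\<^sup>2" for x :: "nat \<Rightarrow> real"
    by (simp add: atMost_Suc)
  have "homeomorphic_maps circle (nsphere 1) ?f ?g"
    unfolding homeomorphic_maps_def
  proof (intro conjI ballI)
    show "continuous_map circle (nsphere 1) ?f"
      unfolding nsphere continuous_map_in_subtopology continuous_map_componentwise_UNIV
    proof (intro conjI allI)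
      show "continuous_map circle euclideanreal (\<lambda>z. ?f z k)" for k
        by (cases "k = 0"; cases "k = 1") (auto intro!: continuous_intros)
      show "?f \<in> topspace circle \<rightarrow> {x. (\<Sum>i\<le>1. (x i)\<^sup>2) = 1 \<and> (\<forall>i>1. x i = 0)}"
        unfolding sum by (auto simp: cmod_def)
    qed
    have "continuous_map (nsphere 1) (prod_topology euclideanreal euclideanreal) (\<lambda>x. (x 0, x 1))"
      by (intro continuous_map_pairedI continuous_map_nsphere_projection)
    moreover have "prod_topology euclideanreal euclideanreal = (euclidean :: (real \<times> real) topology)"
      by (metis prod_topology_subtopology_eu subtopology_UNIV UNIV_Times_UNIV)
    moreover have "continuous_map euclidean euclidean (\<lambda>p::real \<times> real. Complex (fst p) (snd p))"
      by (simp add: continuous_on_Complex continuous_on_fst continuous_on_snd continuous_on_id)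
    ultimately have "continuous_map (nsphere 1) euclidean ((\<lambda>p::real \<times> real. Complex (fst p) (snd p)) \<circ> (\<lambda>x. (x 0, x 1)))"
      by (smt (verit) continuous_map_compose)
    then have "continuous_map (nsphere 1) euclidean ?g" by (simp add: o_def)
    then show "continuous_map (nsphere 1) circle ?g"
      unfolding continuous_map_in_subtopology by (auto simp: nsphere sum cmod_def)
    show "?g (?f z) = z" for z by (simp add: complex_eq_iff)
    fix x assume "x \<in> topspace (nsphere 1)"
    then have "\<forall>i>1. x i = 0" by (simp add: nsphere)
    then show "?f (?g x) = x" by (intro ext) (auto simp: not_less_eq less_Suc_eq)
  qed
  then show ?thesis unfolding homeomorphic_space_def by blast
qed

text \<open>
  The homology groups in dimensions 0 and 1 are both infinite cyclic, so their ranks cancel.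
\<close>

lemma euler_char_homotopy_circle:
  assumes "S homotopy_equivalent_space circle"
  shows "0 \<le> euler_char S"
proof -
  have eq: "S homotopy_equivalent_space nsphere 1"
    using homotopy_eqv_trans[OF assms homeomorphic_imp_homotopy_equivalent_space[OF circle_homeomorphic_nsphere]] .
  have 1: "homology_group 1 S \<cong> integer_group"
    using iso_trans[OF homotopy_equivalent_space_imp_isomorphic_homology_groups[OF eq, of 1]]
      reduced_homology_group_nsphere(1)[of 1] un_reduced_homology_group[of 1 "nsphere 1"] by auto
  have "path_connected (sphere (0::complex) 1)" by (rule path_connected_sphere) simp
  then have "path_connected_space circle" by (simp add: path_connectedin_topspace[symmetric] path_connectedin_subtopology)
  then have "path_connected_space (nsphere 1)"
    using homeomorphic_path_connected_space[OF circle_homeomorphic_nsphere] by blast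
  then have "homology_group 0 (nsphere 1) \<cong> integer_group"
    using isomorphic_integer_zeroth_homology_group in_topspace_nsphere by blast
  then have 2: "homology_group 0 S \<cong> integer_group"
    using iso_trans[OF homotopy_equivalent_space_imp_isomorphic_homology_groups[OF eq, of 0]] by blast
  have "abelian_rank (homology_group 0 S) = abelian_rank (homology_group 1 S)"
    using abelian_rank_cong[OF _ _ 1] abelian_rank_cong[OF _ _ 2] by simp
  then show ?thesis unfolding euler_char_def by (simp add: eval_nat_numeral atMost_Suc)
qed

section \<open>The second parabolic deck transformation\<close>

lemma covering_open_map:
  assumes cov: "covering_map X' X p"
  shows "open_map X' X p"
  unfolding open_map_def
proof (intro allI impI)
  fix Q assume Q: "openin X' Q"
  show "openin X (p ` Q)"
  proof (subst openin_subopen, intro ballI)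
    fix x assume "x \<in> p ` Q"
    then obtain e where e: "e \<in> Q" "x = p e" by blast
    have eX: "e \<in> topspace X'" using e Q openin_subset by blast
    have "x \<in> topspace X" using cov eX e unfolding covering_map_def by blast
    then obtain U sh sec where ev: "evenly_covered X' X p U sh sec" and xU: "x \<in> U"
      using covering_sheets[OF cov] by blast
    have pe: "p e \<in> U" using xU e by simp
    note sh = evenly_coveredD(2)[OF ev eX pe] and sec = evenly_coveredD(3-5)[OF ev eX pe]
    let ?V = "sh e \<inter> Q"
    have U: "openin X U" by (rule evenly_coveredD(1)[OF ev])
    have "openin X' ?V" using sh Q by blast
    from openin_continuous_map_preimage[OF sec(2) this]
    have "openin (subtopology X U) {y \<in> topspace (subtopology X U). sec e y \<in> ?V}" .
    then have op: "openin X {y \<in> topspace (subtopology X U). sec e y \<in> ?V}" using U by (rule openin_trans_full)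
    have top: "topspace (subtopology X U) = U" using U openin_subset by fastforce
    show "\<exists>T. openin X T \<and> x \<in> T \<and> T \<subseteq> p ` Q"
    proof (intro exI conjI)
      show "openin X {y \<in> topspace (subtopology X U). sec e y \<in> ?V}" by (rule op)
      show "x \<in> {y \<in> topspace (subtopology X U). sec e y \<in> ?V}"
        unfolding top using xU e sec(1)[of e] sh by auto
      show "{y \<in> topspace (subtopology X U). sec e y \<in> ?V} \<subseteq> p ` Q"
        unfolding top using sec(3) by (auto simp: image_iff) metis
    qed
  qed
qed

lemma covering_quotient_map:
  assumes "covering_map X' X p" shows "quotient_map X' X p"
  using continuous_open_imp_quotient_map[OF _ covering_open_map[OF assms]] assms
  by (simp add: covering_map_def)

lemma continuous_map_circle:
  fixes g :: "real \<Rightarrow> 'a"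
  assumes g: "continuous_map euclideanreal S g" and per: "\<And>t. g (t + 2 * pi) = g t"
  shows "continuous_map circle S (\<lambda>z. g (Arg z))"
proof -
  have "continuous_map (top_of_set ({0::real..1} \<times> UNIV)) euclideanreal snd"
    by (simp add: continuous_on_snd continuous_on_id)
  from continuous_map_compose[OF this g]
  have "continuous_map (top_of_set ({0::real..1} \<times> UNIV)) S (\<lambda>x. g (snd x))" by (simp add: o_def)
  from continuous_map_circle_family[OF this] per
  have "continuous_map (prod_topology (top_of_set {0::real..1}) circle) S (\<lambda>(s, z). g (Arg z))" by simp
  moreover have "continuous_map circle (prod_topology (top_of_set {0::real..1}) circle) (\<lambda>z. (0, z))"
    by (intro continuous_map_pairedI) (auto simp: continuous_map_in_subtopology)
  ultimately have "continuous_map circle S ((\<lambda>(s::real, z). g (Arg z)) \<circ> (\<lambda>z. (0, z)))"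
    by (rule continuous_map_compose[rotated])
  then show ?thesis by (simp add: o_def)
qed

text \<open>
  The quotient of the half-plane by a horizontal translation is an annulus. The map to the circle is
  given by the real part, and vertical straight lines contract the annulus to the image of the
  horizontal line at height 1. Everything is defined on the half-plane and descends because \<open>F\<close> and
  its product with an interval are quotient maps.
\<close>

lemma parabolic_quotient_homotopy_circle:
  assumes cov: "covering_map (top_of_set UH) S F" and b: "0 < b"
    and F: "\<And>z. z \<in> UH \<Longrightarrow> F (z + of_real b) = F z"
    and only: "\<And>z w. z \<in> UH \<Longrightarrow> w \<in> UH \<Longrightarrow> F z = F w \<Longrightarrow> \<exists>k::int. w = z + of_real (b * of_int k)"
  shows "S homotopy_equivalent_space circle"
proof -
  note q = covering_quotient_map[OF cov]
  have contF: "continuous_map (top_of_set UH) S F" and onto: "F ` UH = topspace S"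
    using cov by (simp_all add: covering_map_def)
  define e where "e t = F (of_real (b / (2 * pi) * t) + \<i>)" for t
  have eper: "e (t + 2 * pi) = e t" for t
  proof -
    have eq: "of_real (b / (2 * pi) * (t + 2 * pi)) + \<i> = (of_real (b / (2 * pi) * t) + \<i>) + of_real b"
      by (simp add: field_simps)
    show ?thesis unfolding e_def eq by (rule F) simp
  qed
  have conte: "continuous_map euclideanreal S e"
  proof -
    have "continuous_map euclideanreal (top_of_set UH) (\<lambda>t. of_real (b / (2 * pi) * t) + \<i>)"
      by (auto simp: continuous_map_in_subtopology intro!: continuous_intros)
    from continuous_map_compose[OF this contF] show ?thesis by (simp add: o_def e_def[abs_def])
  qed
  let ?e = "\<lambda>z. e (Arg z)"
  have conte': "continuous_map circle S ?e" by (rule continuous_map_circle[OF conte eper])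
  have ecis: "?e (cis t) = e t" for t
    by (rule periodic_Arg_cis[of e, OF eper])
  define sel where "sel x = (SOME z. z \<in> UH \<and> F z = x)" for x
  have sel: "sel x \<in> UH \<and> F (sel x) = x" if "x \<in> topspace S" for x
  proof -
    have "\<exists>z. z \<in> UH \<and> F z = x" using onto that by (metis imageE)
    then show ?thesis unfolding sel_def by (rule someI_ex)
  qed
  have FS: "F z \<in> topspace S" if "z \<in> UH" for z using onto that by blast
  define g where "g x = cis (2 * pi / b * Re (sel x))" for x
  have gF: "g (F z) = cis (2 * pi / b * Re z)" if z: "z \<in> UH" for z
  proof -
    obtain k :: int where k: "sel (F z) = z + of_real (b * of_int k)"
      using only[OF z, of "sel (F z)"] sel[OF FS[OF z]] by metis
    show ?thesis unfolding g_def cis_eq_cis k using b by (intro exI[of _ k]) (simp add: field_simps)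
  qed
  have contg: "continuous_map S circle g"
  proof (rule continuous_compose_quotient_map[OF q])
    have "continuous_map (top_of_set UH) circle (\<lambda>z. cis (2 * pi / b * Re z))"
      using b by (auto simp: continuous_map_in_subtopology intro!: continuous_intros)
    then show "continuous_map (top_of_set UH) circle (g \<circ> F)"
      by (rule continuous_map_eq) (simp add: gF)
  qed
  define H where "H s z = of_real (Re z) + \<i> * of_real ((1 - s) * Im z + s)" for s z
  have HU: "H s z \<in> UH" if "s \<in> {0..1}" "z \<in> UH" for s z
  proof -
    have "0 < (1 - s) * Im z + s" using that by (cases "s = 0") (auto intro: add_nonneg_pos)
    then show ?thesis by (simp add: H_def)
  qed
  define K where "K x = F (H (fst x) (sel (snd x)))" for x
  have KF: "K (s, F z) = F (H s z)" if s: "s \<in> {0..1}" and z: "z \<in> UH" for s z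
  proof -
    obtain k :: int where k: "sel (F z) = z + of_real (b * of_int k)"
      using only[OF z, of "sel (F z)"] sel[OF FS[OF z]] by metis
    have Fk: "F (w + of_real (b * of_int k)) = F w" if w: "w \<in> UH" for w
    proof -
      define \<theta> where "\<theta> t = F (w + of_real (b / (2 * pi) * t))" for t
      have "\<theta> (t + 2 * pi) = \<theta> t" for t
      proof -
        have eq: "w + of_real (b / (2 * pi) * (t + 2 * pi)) = (w + of_real (b / (2 * pi) * t)) + of_real b"
          by (simp add: field_simps)
        show ?thesis unfolding \<theta>_def eq by (rule F) (use w in simp)
      qed
      then have "\<theta> (0 + 2 * pi * of_int k) = \<theta> 0" by (rule periodic_int)
      then show ?thesis by (simp add: \<theta>_def)
    qed
    have "H s (z + of_real (b * of_int k)) = H s z + of_real (b * of_int k)" by (simp add: H_def)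
    then show ?thesis unfolding K_def fst_conv snd_conv k using Fk[OF HU[OF s z]] by simp
  qed
  have "homotopic_with (\<lambda>x. True) S S id (?e \<circ> g)"
  proof -
    have "continuous_map (prod_topology (top_of_set {0..1::real}) S) S K"
    proof (rule continuous_compose_quotient_map[OF quotient_map_prod_right[OF _ _ q]])
      show "locally_compact_space (top_of_set {0..1::real})"
        by (rule compact_imp_locally_compact_space) (simp add: compact_space_subtopology)
      show "Hausdorff_space (top_of_set {0..1::real}) \<or> regular_space (top_of_set {0..1::real})"
        by (simp add: Hausdorff_space_subtopology)
      have "continuous_map (top_of_set ({0..1::real} \<times> UH)) (top_of_set UH) (\<lambda>x. H (fst x) (snd x))"
        using HU by (auto simp: continuous_map_in_subtopology H_def[abs_def] intro!: continuous_intros simp del: in_UH)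
      from continuous_map_compose[OF this contF]
      have "continuous_map (prod_topology (top_of_set {0..1::real}) (top_of_set UH)) S (\<lambda>x. F (H (fst x) (snd x)))"
        by (simp add: o_def prod_topology_subtopology_eu)
      then show "continuous_map (prod_topology (top_of_set {0..1::real}) (top_of_set UH)) S (K \<circ> (\<lambda>(x, y). (x, F y)))"
        by (rule continuous_map_eq) (auto simp: KF simp del: in_UH)
    qed
    moreover have "K (0, x) = id x \<and> K (1, x) = (?e \<circ> g) x" if x: "x \<in> topspace S" for x
    proof -
      obtain z where z: "z \<in> UH" "x = F z" using onto x by blast
      have "H 0 z = z" by (simp add: H_def complex_eq_iff)
      moreover have "(?e \<circ> g) (F z) = F (H 1 z)"
      proof -
        have 1: "(?e \<circ> g) (F z) = e (2 * pi / b * Re z)" unfolding o_def gF[OF z(1)] ecis ..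
        have "b / (2 * pi) * (2 * pi / b * Re z) = Re z" using b by simp
        then show ?thesis unfolding 1 unfolding e_def H_def by simp
      qed
      ultimately show ?thesis using KF[of 0 z] KF[of 1 z] z by simp
    qed
    ultimately show ?thesis by (subst homotopic_with) (auto intro!: exI[of _ K])
  qed
  then have 1: "homotopic_with (\<lambda>x. True) S S (?e \<circ> g) id" by (rule homotopic_with_symD)
  have "(g \<circ> ?e) z = id z" if "z \<in> topspace circle" for z
  proof -
    have "cis (Arg z) = z" using that by (intro cis_Arg_sphere) simp
    moreover have "g (e t) = cis t" for t
      unfolding e_def using gF[of "of_real (b / (2 * pi) * t) + \<i>"] b by simp
    ultimately show ?thesis by simp
  qed
  then have 2: "homotopic_with (\<lambda>x. True) circle circle (g \<circ> ?e) id"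
    using continuous_map_compose[OF conte' contg] by (intro homotopic_with_equal) auto
  show ?thesis unfolding homotopy_equivalent_space_def using contg conte' 1 2 by blast
qed

context hyperbolic_surface
begin

text \<open>
  Suppose that all deck transformations fix infinity. The horizontal translations among them form a
  subgroup \<open>B\<close> of the reals, which is discrete because \<open>F\<close> is locally injective. Conjugation by a
  deck transformation with dilation factor \<open>\<alpha>\<close> multiplies \<open>B\<close> by \<open>\<alpha>\<close> up to sign, so \<open>\<alpha> = 1\<close> by
  discreteness. An orientation-reversing one would then have a fixed point. So the deck group is
  \<open>B\<close>, which is generated by its least positive element.
\<close>

lemma cusp_group_cyclic:
  assumes F: "developing F" and T: "\<And>z. z \<in> UH \<Longrightarrow> F (z + 1) = F z"
    and elem: "\<And>A. isom A \<Longrightarrow> (\<And>z. z \<in> UH \<Longrightarrow> F (A z) = F z) \<Longrightarrow>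
      \<exists>\<alpha> \<beta>. 0 < \<alpha> \<and> ((\<forall>z\<in>UH. A z = of_real \<alpha> * z + of_real \<beta>) \<or> (\<forall>z\<in>UH. A z = of_real \<alpha> * (- cnj z) + of_real \<beta>))"
  shows "S homotopy_equivalent_space circle"
proof -
  define B where "B = {x::real. \<forall>z\<in>UH. F (z + of_real x) = F z}"
  have B1: "1 \<in> B" using T by (simp add: B_def)
  have Bneg: "- x \<in> B" if "x \<in> B" for x
    unfolding B_def
  proof (rule CollectI, rule ballI)
    fix z assume "z \<in> UH"
    then have "z + of_real (- x) \<in> UH" by simp
    then show "F (z + of_real (- x)) = F z" using that unfolding B_def by fastforce
  qed
  have Badd: "x + y \<in> B" if "x \<in> B" "y \<in> B" for x y
    unfolding B_def
  proof (rule CollectI, rule ballI)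
    fix z assume z: "z \<in> UH"
    then have "F ((z + of_real x) + of_real y) = F (z + of_real x)" using that(2) unfolding B_def by simp
    then show "F (z + of_real (x + y)) = F z" using that(1) z unfolding B_def by (simp add: add.assoc)
  qed
  obtain r where r: "0 < r" "\<And>x. x \<in> B \<Longrightarrow> \<bar>x\<bar> < r \<Longrightarrow> x = 0"
  proof -
    have "eventually (\<lambda>u. F u = F \<i> \<longrightarrow> u = \<i>) (nhds \<i>)" by (rule developing_locally_inj[OF F]) simp
    then obtain r where r: "r > 0" "\<And>u. dist u \<i> < r \<Longrightarrow> F u = F \<i> \<Longrightarrow> u = \<i>"
      unfolding eventually_nhds_metric by blast
    have "x = 0" if "x \<in> B" "\<bar>x\<bar> < r" for x
    proof -
      have "F (\<i> + of_real x) = F \<i>" using that(1) unfolding B_def by simp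
      moreover have "dist (\<i> + of_real x) \<i> < r" using that(2) by (simp add: dist_norm)
      ultimately have "\<i> + of_real x = \<i>" using r(2) by blast
      then show ?thesis by simp
    qed
    then show ?thesis using that r(1) by blast
  qed
  have noscale: "\<mu> = 1" if \<mu>: "0 < \<mu>" and s: "\<And>x. x \<in> B \<Longrightarrow> \<mu> * x \<in> B" "\<And>x. x \<in> B \<Longrightarrow> x / \<mu> \<in> B" for \<mu>
  proof -
    have no: "\<not> \<nu> < 1" if "0 < \<nu>" "\<And>x. x \<in> B \<Longrightarrow> \<nu> * x \<in> B" for \<nu> :: real
    proof
      assume "\<nu> < 1"
      then obtain n where n: "\<nu> ^ n < r" using real_arch_pow_inv[OF r(1)] by blast
      have "\<nu> ^ k \<in> B" for k by (induction k) (auto simp: B1 that)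
      then have "\<nu> ^ n = 0" using r(2)[of "\<nu> ^ n"] n that by simp
      then show False using that by simp
    qed
    have "\<not> inverse \<mu> < 1" using no[of "inverse \<mu>"] \<mu> s(2) by (simp add: divide_inverse mult.commute)
    then have "\<not> 1 < \<mu>" using \<mu> by (simp add: inverse_less_1_iff)
    then show ?thesis using no[OF \<mu> s(1)] by linarith
  qed
  have deck: "\<exists>x\<in>B. \<forall>z\<in>UH. A z = z + of_real x"
    if A: "isom A" "\<And>z. z \<in> UH \<Longrightarrow> F (A z) = F z" for A
  proof -
    obtain \<alpha> \<beta> where ab: "0 < \<alpha>"
      "(\<forall>z\<in>UH. A z = of_real \<alpha> * z + of_real \<beta>) \<or> (\<forall>z\<in>UH. A z = of_real \<alpha> * (- cnj z) + of_real \<beta>)"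
      using elem[OF A] by blast
    obtain A' where A': "isom A'" "\<And>z. z \<in> UH \<Longrightarrow> A (A' z) = z" using isom_inverse[OF A(1)] by metis
    have "\<exists>\<sigma>\<in>{1, -1}. \<forall>x. \<forall>z\<in>UH. A (z + of_real x) = A z + of_real (\<sigma> * \<alpha> * x)"
      using ab(2)
    proof
      assume pos: "\<forall>z\<in>UH. A z = of_real \<alpha> * z + of_real \<beta>"
      have "A (z + of_real x) = A z + of_real (1 * \<alpha> * x)" if z: "z \<in> UH" for z x
      proof -
        have z': "z + of_real x \<in> UH" using z by simp
        show ?thesis unfolding pos[rule_format, OF z'] pos[rule_format, OF z] by (simp add: algebra_simps)
      qed
      then show ?thesis by blast
    next
      assume neg: "\<forall>z\<in>UH. A z = of_real \<alpha> * (- cnj z) + of_real \<beta>"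
      have "A (z + of_real x) = A z + of_real (-1 * \<alpha> * x)" if z: "z \<in> UH" for z x
      proof -
        have z': "z + of_real x \<in> UH" using z by simp
        show ?thesis unfolding neg[rule_format, OF z'] neg[rule_format, OF z] by (simp add: algebra_simps)
      qed
      then show ?thesis by blast
    qed
    then obtain \<sigma> :: real where \<sigma>: "\<sigma> \<in> {1, -1}"
      "\<And>x z. z \<in> UH \<Longrightarrow> A (z + of_real x) = A z + of_real (\<sigma> * \<alpha> * x)" by blast
    have sign: "y \<in> B" if "\<sigma> * y \<in> B" for y using \<sigma>(1) that Bneg[OF that] by auto
    have conj: "\<alpha> * x \<in> B \<and> x / \<alpha> \<in> B" if x: "x \<in> B" for x
    proof
      have "F (z + of_real (\<sigma> * (\<alpha> * x))) = F z" if z: "z \<in> UH" for z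
      proof -
        have z': "A' z \<in> UH" "A' z + of_real x \<in> UH" using isom_UH[OF A'(1) z] by auto
        have "F (z + of_real (\<sigma> * (\<alpha> * x))) = F (A (A' z + of_real x))"
          unfolding \<sigma>(2)[OF z'(1)] A'(2)[OF z] by (simp add: mult.assoc)
        also have "\<dots> = F (A' z)" using A(2)[OF z'(2)] x z'(1) unfolding B_def by simp
        also have "\<dots> = F z" using A(2)[OF z'(1)] A'(2)[OF z] by simp
        finally show ?thesis .
      qed
      then have "\<sigma> * (\<alpha> * x) \<in> B" unfolding B_def by blast
      then show "\<alpha> * x \<in> B" by (rule sign)
      have "F (z + of_real (\<sigma> * (x / \<alpha>))) = F z" if z: "z \<in> UH" for z
      proof -
        have z': "z + of_real (\<sigma> * (x / \<alpha>)) \<in> UH" using z by simp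
        have "\<sigma> * \<alpha> * (\<sigma> * (x / \<alpha>)) = x" using \<sigma>(1) ab(1) by auto
        then have "A (z + of_real (\<sigma> * (x / \<alpha>))) = A z + of_real x" using \<sigma>(2)[OF z] by metis
        then show ?thesis using A(2)[OF z'] A(2)[OF z] x isom_UH[OF A(1) z] unfolding B_def by simp
      qed
      then have "\<sigma> * (x / \<alpha>) \<in> B" unfolding B_def by blast
      then show "x / \<alpha> \<in> B" by (rule sign)
    qed
    have \<alpha>1: "\<alpha> = 1" using noscale[OF ab(1)] conj by blast
    show ?thesis using ab(2)
    proof
      assume "\<forall>z\<in>UH. A z = of_real \<alpha> * z + of_real \<beta>"
      then have eq: "\<forall>z\<in>UH. A z = z + of_real \<beta>" using \<alpha>1 by simp
      then have "\<beta> \<in> B" unfolding B_def using A(2) by simp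
      then show ?thesis using eq by blast
    next
      assume neg: "\<forall>z\<in>UH. A z = of_real \<alpha> * (- cnj z) + of_real \<beta>"
      have U: "of_real (\<beta> / 2) + \<i> \<in> UH" "of_real (\<beta> / 2 + 1) + \<i> \<in> UH" by simp_all
      have "A (of_real (\<beta> / 2) + \<i>) = of_real (\<beta> / 2) + \<i>" using neg U(1) \<alpha>1 by (simp add: complex_eq_iff)
      then have "A (of_real (\<beta> / 2 + 1) + \<i>) = of_real (\<beta> / 2 + 1) + \<i>"
        using deck_free[OF F A isom_id _ U(1) _ U(2)] by simp
      then show ?thesis using neg U(2) \<alpha>1 by (simp add: complex_eq_iff)
    qed
  qed
  define P where "P = {x\<in>B. 0 < x}"
  have Pne: "1 \<in> P" using B1 by (simp add: P_def)
  have bdd: "bdd_below P" by (rule bdd_belowI[of _ 0]) (simp add: P_def)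
  define b where "b = Inf P"
  have ble: "b \<le> x" if "x \<in> P" for x unfolding b_def using bdd that by (rule cInf_lower[rotated])
  have near: "\<exists>x\<in>P. x < b + e" if "0 < e" for e
    using cInf_lessD[of P "b + e"] Pne that unfolding b_def by fastforce
  have bP: "b \<in> P"
  proof (rule ccontr)
    assume nb: "b \<notin> P"
    obtain x where x: "x \<in> P" "x < b + r" using near[OF r(1)] by blast
    have bx: "b < x" using ble[OF x(1)] nb x(1) by (cases "b = x") auto
    obtain y where y: "y \<in> P" "y < b + (x - b)" using near[of "x - b"] bx by auto
    have "x + (- y) \<in> B" using Badd[of x "- y"] Bneg x(1) y(1) by (simp add: P_def)
    moreover have "\<bar>x + (- y)\<bar> < r" using ble[OF y(1)] x y by simp
    ultimately have "x + (- y) = 0" using r(2) by blast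
    then show False using y by simp
  qed
  then have b: "0 < b" "b \<in> B" by (auto simp: P_def)
  have Bmult: "b * of_int k \<in> B" for k
  proof -
    have nat: "b * of_nat n \<in> B" for n
    proof (induction n)
      case 0
      have "0 \<in> B" by (simp add: B_def)
      then show ?case by simp
    next
      case (Suc n)
      have "b * of_nat (Suc n) = b * of_nat n + b" by (simp add: algebra_simps)
      then show ?case using Badd[OF Suc b(2)] by simp
    qed
    show ?thesis
    proof (cases k)
      case (nonneg n)
      then show ?thesis using nat by simp
    next
      case (neg n)
      have "b * of_int k = - (b * of_nat (Suc n))" unfolding neg by (simp add: algebra_simps)
      then show ?thesis using Bneg[OF nat[of "Suc n"]] by simp
    qed
  qed
  have Bb: "\<exists>k::int. x = b * of_int k" if x: "x \<in> B" for x
  proof -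
    define k where "k = \<lfloor>x / b\<rfloor>"
    have "of_int k \<le> x / b" "x / b < of_int k + 1" unfolding k_def by linarith+
    then have k: "b * of_int k \<le> x" "x < b * of_int k + b" using b(1) by (simp_all add: field_simps)
    have "x + (- (b * of_int k)) \<in> B" by (rule Badd[OF x Bneg[OF Bmult]])
    then have "x + (- (b * of_int k)) \<notin> P \<or> b \<le> x + (- (b * of_int k))" using ble by blast
    then have "x = b * of_int k" using \<open>x + (- (b * of_int k)) \<in> B\<close> k unfolding P_def by force
    then show ?thesis by blast
  qed
  show ?thesis
  proof (rule parabolic_quotient_homotopy_circle[OF developing_covering[OF F] b(1)])
    show "F (z + of_real b) = F z" if "z \<in> UH" for z using b(2) that by (simp add: B_def)
    fix z w assume zw: "z \<in> UH" "w \<in> UH" "F z = F w"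
    obtain A where A: "isom A" "A z = w" "\<And>u. u \<in> UH \<Longrightarrow> F (A u) = F u" using developing_deck[OF F zw] by blast
    obtain x where x: "x \<in> B" "\<forall>z\<in>UH. A z = z + of_real x" using deck[OF A(1,3)] by blast
    then show "\<exists>k::int. w = z + of_real (b * of_int k)" using Bb[OF x(1)] A(2) zw(1) by metis
  qed
qed

text \<open>
  By \<open>cusp_group_cyclic\<close> some deck transformation does not fix infinity. Whether or not it reverses
  the orientation, the conjugate of \<open>z \<mapsto> z + 1\<close> or of its inverse by it is a conjugate by a Moebius
  transformation \<open>k\<close> with \<open>c \<noteq> 0\<close>. Writing \<open>k z = a / c - 1 / W\<close> with \<open>W\<close> affine in \<open>z\<close>, a
  translation of \<open>z\<close> is a translation of \<open>W\<close>, and in the coordinate \<open>y = - 1 / W\<close> this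
  becomes the asserted form.
\<close>

lemma second_parabolic:
  assumes F: "developing F" and T: "\<And>z. z \<in> UH \<Longrightarrow> F (z + 1) = F z" and chi: "euler_char S < 0"
  obtains f c where "developing f" "0 < c" "\<And>z. z \<in> UH \<Longrightarrow> f (z + 1) = f z"
    "\<And>z. z \<in> UH \<Longrightarrow> f (z / (of_real c * z + 1)) = f z"
proof -
  have nonelem: "\<exists>a b c d. a * d - b * c > 0 \<and> c \<noteq> 0 \<and> (\<forall>z\<in>UH. F (mob a b c d (z + 1)) = F (mob a b c d z))"
  proof (rule ccontr)
    assume no: "\<not> ?thesis"
    have "\<exists>\<alpha> \<beta>. 0 < \<alpha> \<and> ((\<forall>z\<in>UH. A z = of_real \<alpha> * z + of_real \<beta>) \<or> (\<forall>z\<in>UH. A z = of_real \<alpha> * (- cnj z) + of_real \<beta>))"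
      if A: "isom A" "\<And>z. z \<in> UH \<Longrightarrow> F (A z) = F z" for A
      using isom_form[OF A(1)]
    proof
      assume "moebius A"
      then obtain a b c d where m: "a * d - b * c > 0" "\<forall>z\<in>UH. A z = mob a b c d z" unfolding moebius_def by blast
      have "F (mob a b c d (z + 1)) = F (mob a b c d z)" if "z \<in> UH" for z
        using A(2)[of z] A(2)[of "z + 1"] T[OF that] m(2) that by simp
      then have c: "c = 0" using no m(1) by blast
      then have ad: "a * d > 0" using m(1) by simp
      have "0 < a / d" using ad by (auto simp: zero_less_mult_iff zero_less_divide_iff)
      moreover have "A z = of_real (a / d) * z + of_real (b / d)" if "z \<in> UH" for z
        using m(2) that c by (simp add: mob_def add_divide_distrib)
      ultimately show ?thesis by blast
    next
      assume "antimoebius A"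
      then obtain a b c d where m: "a * d - b * c > 0" "\<forall>z\<in>UH. A z = mob a b c d (- cnj z)" unfolding antimoebius_def by blast
      have "F (mob a b c d (z + 1)) = F (mob a b c d z)" if z: "z \<in> UH" for z
      proof -
        have U: "- cnj z \<in> UH" "- cnj z - 1 \<in> UH" using z by auto
        have "F (mob a b c d (z + 1)) = F (A (- cnj z - 1))" using m(2) U(2) by (simp add: add.commute)
        also have "\<dots> = F (- cnj z)" using A(2)[OF U(2)] T[OF U(2)] by simp
        also have "\<dots> = F (mob a b c d z)" using A(2)[OF U(1)] m(2) U(1) by simp
        finally show ?thesis .
      qed
      then have c: "c = 0" using no m(1) by blast
      then have ad: "a * d > 0" using m(1) by simp
      have "0 < a / d" using ad by (auto simp: zero_less_mult_iff zero_less_divide_iff)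
      moreover have "A z = of_real (a / d) * (- cnj z) + of_real (b / d)" if "z \<in> UH" for z
        using m(2) that c by (simp add: mob_def add_divide_distrib diff_divide_distrib)
      ultimately show ?thesis by blast
    qed
    then have "S homotopy_equivalent_space circle" using cusp_group_cyclic[OF F T] by blast
    then show False using euler_char_homotopy_circle chi by fastforce
  qed
  then obtain a b c d where D: "a * d - b * c > 0" and c: "c \<noteq> 0"
    and k: "\<And>z. z \<in> UH \<Longrightarrow> F (mob a b c d (z + 1)) = F (mob a b c d z)" by blast
  define D' where "D' = a * d - b * c"
  define c' where "c' = c\<^sup>2 / D'"
  have c': "0 < c'" using D c by (simp add: c'_def D'_def)
  have cD: "c' * D' = c\<^sup>2" using D by (simp add: c'_def D'_def)
  define f where "f z = F (z + of_real (a / c))" for z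
  have "developing f" unfolding f_def using developing_comp[OF F isom_affine[of 1 "a / c"]] by simp
  moreover have "f (z + 1) = f z" if "z \<in> UH" for z
    using T[of "z + of_real (a / c)"] that by (simp add: f_def algebra_simps)
  moreover have "f (y / (of_real c' * y + 1)) = f y" if y: "y \<in> UH" for y
  proof -
    have y0: "y \<noteq> 0" using y by auto
    have c0: "of_real c' * y + 1 \<noteq> 0" using denom_nonzero[of 1 1 0 c' y] y by simp
    have kform: "mob a b c d (of_real (1 / c') * W - of_real (d / c)) = of_real (a / c) - 1 / W"
      if "W \<noteq> 0" for W
    proof -
      have cW: "of_real c * (of_real (1 / c') * W - of_real (d / c)) + of_real d = of_real (c / c') * W"
        using c c' by (simp add: field_simps)
      have bad: "b - a * d / c = - (D' / c)" using c by (simp add: D'_def field_simps)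
      have "of_real a * (of_real (1 / c') * W - of_real (d / c)) + of_real b = of_real (a / c') * W + of_real (b - a * d / c)"
        by (simp add: algebra_simps)
      also have "\<dots> = of_real (a / c') * W - of_real (D' / c)" unfolding bad by simp
      finally have "mob a b c d (of_real (1 / c') * W - of_real (d / c))
         = (of_real (a / c') * W - of_real (D' / c)) / (of_real (c / c') * W)"
        unfolding mob_def cW by simp
      also have "\<dots> = of_real (a / c) - of_real (D' * c' / c\<^sup>2) / W"
        using that c c' by (simp add: field_simps power2_eq_square)
      also have "D' * c' / c\<^sup>2 = 1" using cD c by (simp add: mult.commute)
      finally show ?thesis by simp
    qed
    \<comment> \<open>\<open>W\<close> and \<open>W + c'\<close> correspond to the two points \<open>y / (c' y + 1)\<close> and \<open>y\<close>\<close>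
    define W where "W = - 1 / y - of_real c'"
    have ImW: "0 < Im (- 1 / y)" using isom_UH[OF isom_inversion[of 0] y] by simp
    then have W0: "W \<noteq> 0" "W + of_real c' \<noteq> 0" by (auto simp: W_def complex_eq_iff)
    let ?z = "of_real (1 / c') * W - of_real (d / c)"
    have z: "?z \<in> UH" using ImW c' by (simp add: W_def divide_neg_pos)
    have z1: "?z + 1 = of_real (1 / c') * (W + of_real c') - of_real (d / c)"
      using c' by (simp add: ring_distribs)
    have "f (y / (of_real c' * y + 1)) = F (of_real (a / c) - 1 / W)"
    proof -
      have W: "W = - (of_real c' * y + 1) / y" using y0 by (simp add: W_def field_simps)
      have "- 1 / (- D / y) = y / D" for D :: complex by simp
      then have "- 1 / W = y / (of_real c' * y + 1)" unfolding W by blast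
      moreover have "of_real (a / c) - 1 / W = - 1 / W + of_real (a / c)" by simp
      ultimately show ?thesis unfolding f_def by metis
    qed
    also have "\<dots> = F (mob a b c d ?z)" unfolding kform[OF W0(1)] ..
    also have "\<dots> = F (mob a b c d (?z + 1))" using k[OF z] by simp
    also have "\<dots> = F (of_real (a / c) - 1 / (W + of_real c'))" unfolding z1 kform[OF W0(2)] ..
    also have "of_real (a / c) - 1 / (W + of_real c') = y + of_real (a / c)" using y0 by (simp add: W_def add.commute)
    also have "F \<dots> = f y" by (simp add: f_def)
    finally show ?thesis .
  qed
  ultimately show ?thesis using that c' by blast
qed

end

section \<open>Exponential growth of the degree\<close>

context hyperbolic_surface
begin

text \<open>
  The curve is covered by the axis of \<open>z \<mapsto> z / (c z + 1) + n\<close>. The end points are the roots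
  \<open>r1\<close> and \<open>r2\<close> of \<open>c z\<^sup>2 - n c z - n\<close>, whose difference exceeds \<open>n\<close>. The numbers \<open>k1\<close> and
  \<open>k2\<close> are the eigenvalues of the matrix, with product 1 and sum \<open>2 + n c\<close>, and the translation
  length is \<open>ln (k2 / k1) = 2 ln k2\<close>.
\<close>

lemma long_cusp_excursion:
  assumes f: "developing f" and c: "0 < c" and T: "\<And>z. z \<in> UH \<Longrightarrow> f (z + 1) = f z"
    and Q: "\<And>z. z \<in> UH \<Longrightarrow> f (z / (of_real c * z + 1)) = f z" and n: "0 < n"
  obtains \<gamma> l where "closed_curve S \<gamma>" "has_geodesic_length S \<rho> \<gamma> l" "l \<le> 2 * ln (2 + real n * c)"
    "curve_degree S \<gamma> \<ge> enat n"
proof -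
  define R where "R = sqrt ((real n)\<^sup>2 + 4 * real n / c)"
  have R2: "R\<^sup>2 = (real n)\<^sup>2 + 4 * real n / c" using c by (simp add: R_def)
  have Rn: "real n < R" unfolding R_def using n c by (intro real_less_rsqrt) simp
  define r2 r1 where "r2 = (real n + R) / 2" and "r1 = (real n - R) / 2"
  have diff: "real n < r2 - r1" using Rn by (simp add: r2_def r1_def field_simps)
  have prod: "c * (r1 * r2) = - real n"
  proof -
    have "4 * (r1 * r2) = (real n)\<^sup>2 - R\<^sup>2" by (simp add: r1_def r2_def power2_eq_square field_simps)
    then have "r1 * r2 = - (real n / c)" unfolding R2 by simp
    then show ?thesis using c by simp
  qed
  have sum: "r1 + r2 = real n" by (simp add: r1_def r2_def field_simps)
  define k2 k1 where "k2 = c * r2 + 1" and "k1 = c * r1 + 1"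
  have k12: "k1 * k2 = 1"
  proof -
    have "k1 * k2 = c * (c * (r1 * r2)) + c * (r1 + r2) + 1" by (simp add: k1_def k2_def algebra_simps)
    then show ?thesis unfolding prod sum by simp
  qed
  have k2: "1 < k2" using Rn n c by (simp add: k2_def r2_def)
  then have k1: "0 < k1" using k12 by (metis less_trans zero_less_mult_pos2 zero_less_one)
  have k1eq: "k1 = 1 / k2" using k12 k2 by (simp add: field_simps)
  have "k1 + k2 = c * (r1 + r2) + 2" by (simp add: k1_def k2_def algebra_simps)
  then have ksum: "k2 < 2 + real n * c" using k1 unfolding sum by (simp add: mult.commute)
  define l where "l = k2 / k1"
  have lk: "l = k2\<^sup>2" using k2 by (simp add: l_def k1eq power2_eq_square)
  have l: "1 < l" using k2 by (simp add: lk)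
  define M where "M = mob r2 r1 1 1"
  have D: "r2 * 1 - r1 * 1 > 0" using diff by linarith
  have MU: "M z \<in> UH" if "z \<in> UH" for z unfolding M_def by (rule mob_UH[OF D that])
  have isoM: "isom M" unfolding M_def by (rule isom_mob[OF D])
  have fixed: "r2 + real n * k2 = r2 * k2" "r1 + real n * k1 = r1 * k1"
  proof -
    have r1: "r1 = real n - r2" and r2: "r2 = real n - r1" using sum by simp_all
    show "r2 + real n * k2 = r2 * k2" using prod unfolding k2_def r1 by (simp add: algebra_simps)
    show "r1 + real n * k1 = r1 * k1" using prod unfolding k1_def r2 by (simp add: algebra_simps)
  qed
  have fn: "f (z + of_nat j) = f z" if "z \<in> UH" for z j
    using T that by (rule translation_of_nat)
  have gM: "f (M (of_real l * z)) = f (M z)" if z: "z \<in> UH" for z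
  proof -
    let ?u = "M z / (of_real c * M z + 1)"
    have nz: "z + 1 \<noteq> 0" "of_real c * M z + 1 \<noteq> 0"
      using denom_nonzero[of 1 1 0 1 z] denom_nonzero[of 1 1 0 c "M z"] z MU[OF z] by simp_all
    have uU: "?u \<in> UH" using mob_UH[of 1 1 0 c "M z"] MU[OF z] by (simp add: mob_def)
    have Mz: "M z = (of_real r2 * z + of_real r1) / (z + 1)" by (simp add: M_def mob_def)
    have den: "of_real c * M z + 1 = (of_real k2 * z + of_real k1) / (z + 1)"
      unfolding Mz using nz(1) by (simp add: k1_def k2_def field_simps)
    have dnz: "of_real k2 * z + of_real k1 \<noteq> 0" using den nz by auto
    have "?u = (of_real r2 * z + of_real r1) / (of_real k2 * z + of_real k1)"
      unfolding den unfolding Mz using nz(1) by simp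
    then have "?u + of_nat n = ((of_real r2 * z + of_real r1) + of_nat n * (of_real k2 * z + of_real k1)) / (of_real k2 * z + of_real k1)"
      using dnz by (simp add: add_divide_distrib)
    also have "(of_real r2 * z + of_real r1) + of_nat n * (of_real k2 * z + of_real k1)
      = of_real (r2 + real n * k2) * z + of_real (r1 + real n * k1)" by (simp add: algebra_simps)
    also have "\<dots> = of_real (r2 * k2) * z + of_real (r1 * k1)" unfolding fixed ..
    also have "(of_real (r2 * k2) * z + of_real (r1 * k1)) / (of_real k2 * z + of_real k1) = M (of_real l * z)"
    proof -
      have e: "of_real p * (of_real l * z) + of_real q = (of_real (p * k2) * z + of_real (q * k1)) / of_real k1" for p q
        using k1 by (simp add: l_def field_simps)
      show ?thesis unfolding M_def mob_def e using k1 by simp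
    qed
    finally have "f (M (of_real l * z)) = f (?u + of_nat n)" by simp
    also have "\<dots> = f (M z)" using fn[OF uU] Q[OF MU[OF z]] by simp
    finally show ?thesis .
  qed
  let ?F = "\<lambda>z. f (M z)"
  have F: "developing ?F" by (rule developing_comp[OF f isoM])
  obtain \<gamma> where \<gamma>: "closed_geodesic S \<rho> \<bar>ln l\<bar> \<gamma>"
    "\<And>t. \<gamma> (cis t) = ?F (\<i> * of_real (exp (ln l / (2 * pi) * t)))"
  proof (rule axis_closed_geodesic[OF F _ disjI1[OF refl] gM])
    show "0 < l" using l by simp
  next
    fix \<gamma> assume g: "closed_geodesic S \<rho> \<bar>ln l\<bar> \<gamma>"
      "\<And>t. \<gamma> (cis t) = ?F (\<i> * of_real (exp (ln l / (2 * pi) * t)))"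
    show thesis by (rule that[OF g])
  qed
  have cc: "closed_curve S \<gamma>" using \<gamma>(1) by (simp add: closed_geodesic_def)
  then have "freely_homotopic S \<gamma> \<gamma>" by (simp add: freely_homotopic_def closed_curve_def)
  then have "has_geodesic_length S \<rho> \<gamma> \<bar>ln l\<bar>" using \<gamma>(1) unfolding has_geodesic_length_def by blast
  moreover have "\<bar>ln l\<bar> \<le> 2 * ln (2 + real n * c)"
  proof -
    have "ln l = 2 * ln k2" using k2 by (simp add: lk ln_realpow)
    moreover have "ln k2 \<le> ln (2 + real n * c)" using k2 ksum by simp
    moreover have "0 \<le> ln k2" using k2 by simp
    ultimately show ?thesis by simp
  qed
  moreover have "enat n \<le> curve_degree S \<gamma>"
    unfolding curve_degree_def
  proof (rule INF_greatest)
    fix d assume "d \<in> {d. \<exists>(S' :: ('a \<times> nat) topology) p. finite_cover S' S p d \<and> lifts_simply S' S p \<gamma>}"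
    then obtain S' :: "('a \<times> nat) topology" and p where S': "finite_cover S' S p d" "lifts_simply S' S p \<gamma>" by blast
    have "n < d"
      by (rule degree_lower_bound[OF developing_covering[OF f] T developing_covering[OF F[unfolded M_def]] l
            gM[unfolded M_def] \<gamma>(2)[unfolded M_def] S' diff])
    then show "enat n \<le> enat d" by simp
  qed
  ultimately show ?thesis using that cc by blast
qed

end

lemma exp_rate_dominates:
  fixes \<epsilon> c :: real
  assumes \<epsilon>: "0 < \<epsilon>" and c: "0 < c"
  obtains L0 where "\<And>L n. L0 \<le> L \<Longrightarrow> real n \<le> exp (L / (2 + \<epsilon>)) + 1 \<Longrightarrow> 2 * ln (2 + real n * c) \<le> L"
proof -
  \<comment> \<open>the gain in the exponent, which absorbs the constant \<open>2 + 2 c\<close>\<close>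
  define \<delta> where "\<delta> = 1 / 2 - 1 / (2 + \<epsilon>)"
  have \<delta>: "0 < \<delta>" using \<epsilon> by (simp add: \<delta>_def field_simps)
  have "2 * ln (2 + real n * c) \<le> L"
    if L: "max 0 (ln (2 + 2 * c) / \<delta>) \<le> L" and n: "real n \<le> exp (L / (2 + \<epsilon>)) + 1" for L n
  proof -
    let ?E = "exp (L / (2 + \<epsilon>))"
    have E: "1 \<le> ?E" using L \<epsilon> by simp
    have "ln (2 + 2 * c) \<le> \<delta> * L" using L \<delta> by (simp add: field_simps)
    then have d: "2 + 2 * c \<le> exp (\<delta> * L)" using c by (simp flip: ln_le_cancel_iff add: add_pos_pos)
    have "2 + real n * c \<le> 2 + (?E + 1) * c" using n c by (simp add: mult_right_mono)
    also have "\<dots> \<le> (2 + 2 * c) * ?E"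
    proof -
      have "c \<le> c * ?E" using E c by simp
      moreover have "(2 + 2 * c) * ?E - (2 + (?E + 1) * c) = 2 * (?E - 1) + (c * ?E - c)"
        by (simp add: algebra_simps)
      ultimately show ?thesis using E by (smt (verit))
    qed
    also have "\<dots> \<le> exp (\<delta> * L) * ?E" using d by (simp add: mult_right_mono)
    also have "\<dots> = exp (L / 2)" unfolding exp_add[symmetric] by (simp add: \<delta>_def algebra_simps)
    finally have "ln (2 + real n * c) \<le> ln (exp (L / 2))" using c by (simp add: add_pos_nonneg del: ln_exp)
    then show ?thesis by simp
  qed
  then show ?thesis using that by blast
qed

theorem theorem4:
  fixes S :: "'a topology" and \<rho> :: "'a \<Rightarrow> 'a \<Rightarrow> real" and \<epsilon> :: real
  assumes "finite_type S"
    and "euler_char S < 0"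
    and "complete_hyperbolic_metric S \<rho>"
    and "has_puncture S \<rho>"
    and "\<epsilon> > 0"
  shows "\<exists>L\<^sub>0. \<forall>L\<ge>L\<^sub>0. ereal (exp (L / (2 + \<epsilon>))) \<le> ereal_of_enat (max_degree S \<rho> L)"
proof -
  interpret hyperbolic_surface S \<rho>
    using assms(1,3) by unfold_locales (auto simp: finite_type_def surface_def)
  obtain c0 where c0: "end_curve S c0" "\<nexists>l. has_geodesic_length S \<rho> c0 l"
    using assms(4) unfolding has_puncture_def by blast
  have "closed_curve S c0"
    using c0(1) homotopic_with_imp_continuous_maps
    unfolding end_curve_def freely_homotopic_def closed_curve_def by blast
  then obtain F where F: "developing F" "\<And>z. z \<in> UH \<Longrightarrow> F (z + 1) = F z"
    using developing_parabolic[OF _ c0(2)] by blast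
  obtain f c where f: "developing f" "0 < c" "\<And>z. z \<in> UH \<Longrightarrow> f (z + 1) = f z"
    "\<And>z. z \<in> UH \<Longrightarrow> f (z / (of_real c * z + 1)) = f z"
    using second_parabolic[OF F assms(2)] by blast
  obtain L0 where L0: "\<And>L n. L0 \<le> L \<Longrightarrow> real n \<le> exp (L / (2 + \<epsilon>)) + 1 \<Longrightarrow> 2 * ln (2 + real n * c) \<le> L"
    using exp_rate_dominates[OF assms(5) f(2)] by blast
  have "ereal (exp (L / (2 + \<epsilon>))) \<le> ereal_of_enat (max_degree S \<rho> L)" if L: "L0 \<le> L" for L
  proof -
    define n where "n = nat \<lceil>exp (L / (2 + \<epsilon>))\<rceil>"
    have n0: "0 < n" by (simp add: n_def)
    have n1: "exp (L / (2 + \<epsilon>)) \<le> real n" unfolding n_def by (rule real_nat_ceiling_ge)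
    have n2: "real n \<le> exp (L / (2 + \<epsilon>)) + 1"
      using n0 unfolding n_def by linarith
    obtain \<gamma> l where \<gamma>: "closed_curve S \<gamma>" "has_geodesic_length S \<rho> \<gamma> l" "l \<le> 2 * ln (2 + real n * c)"
      "enat n \<le> curve_degree S \<gamma>"
      using long_cusp_excursion[where f = f and c = c and n = n, OF f n0] by blast
    have lL: "l \<le> L" using \<gamma>(3) L0[OF L n2] by linarith
    have "enat n \<le> max_degree S \<rho> L"
      unfolding max_degree_def
    proof (rule INF_greatest)
      fix d assume "d \<in> {d :: nat. \<forall>c l. closed_curve S c \<and> has_geodesic_length S \<rho> c l \<and> l \<le> L \<longrightarrow> curve_degree S c \<le> enat d}"
      then have "curve_degree S \<gamma> \<le> enat d" using \<gamma>(1,2) lL by blast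
      then show "enat n \<le> enat d" using \<gamma>(4) by (rule order_trans[rotated])
    qed
    then have "ereal_of_enat (enat n) \<le> ereal_of_enat (max_degree S \<rho> L)"
      using ereal_of_enat_le_iff by presburger
    moreover have "ereal (exp (L / (2 + \<epsilon>))) \<le> ereal_of_enat (enat n)" using n1 by simp
    ultimately show ?thesis by (rule order_trans[rotated])
  qed
  then show ?thesis by blast
qed

end
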